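(* Let $\tau\in\{A',A,B,C,D\}$, let $(G_N)_N$ be the sequence of compact classical groups of type $\tau$ with $G_N\subset\mathrm{GL}_N(\mathbb C)$, and let $\mu_N=\sum_{\lambda\in\widehat G_N}\delta_{c_2(\lambda)}$ be the counting measure of Casimir numbers. There exists a locally finite measure $\mu_\tau$ on $[0,\infty)$ such that, at every continuity point $\Lambda$ of $\mu_\tau$ (i.e. $\mu_\tau(\{\Lambda\})=0$), $$\mu_N([0,\Lambda])\xrightarrow[N\to\infty]{}\mu_\tau([0,\Lambda]).$$ Moreover, setting $\mathcal N_\tau(\Lambda)=\mu_\tau([0,\Lambda])$, as $\Lambda\to\infty$, $$\mathcal N_{A'}(\Lambda)\sim\frac1{4\pi}\Lambda^{-1/2}e^{2\pi\sqrt{\Lambda/3}},\qquad \mathcal N_A(\Lambda)\sim\frac1{4\pi\,3^{1/4}}\Lambda^{-3/4}e^{2\pi\sqrt{\Lambda/3}},$$ $$\mathcal N_B(\Lambda)\sim\mathcal N_C(\Lambda)\sim\mathcal N_D(\Lambda)\sim\frac1{2\pi\sqrt2}\Lambda^{-1/2}e^{\pi\sqrt{2\Lambda/3}}.$$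
   Context: Compact classical groups are indexed by matrix size $N$, $G_N\subset\mathrm{GL}_N(\mathbb C)$: type $A'$: $\mathrm U(N)$; type $A$: $\mathrm{SU}(N)$; type $B$: $\mathrm{SO}(N)$ with $N$ odd; type $D$: $\mathrm{SO}(N)$ with $N$ even; type $C$: $\mathrm{Sp}(N/2)=\{S\in\mathrm{GL}_N(\mathbb C):S^*=S^{-1},S^tJS=J\}$ with $N$ even, $J=\begin{pmatrix}0&I\\-I&0\end{pmatrix}$. $N\to\infty$ through the values admissible for the type. The Lie algebra $\mathfrak g_N$ carries the inner product $\langle X,Y\rangle=c_N\mathrm{Tr}(X^*Y)$ with $c_N=N$ for types $A',A$ and $c_N=N/2$ for types $B,C,D$. With an orthonormal basis $(X_i)$ of $\mathfrak g_N$, $\Delta_{G_N}f(g)=\sum_i\frac{d^2}{ds^2}\big|_{s=0}f(ge^{sX_i})$. For an irreducible representation $\lambda\in\widehat G_N$ with character $\chi_\lambda$, the Casimir number $c_2(\lambda)\ge0$ is defined by $\Delta_{G_N}\chi_\lambda=-c_2(\lambda)\chi_\lambda$. Explicitly, with highest weights $\lambda=(\lambda_1,\dots,\lambda_r)$, $r=N$ for $A',A$, $r=(N-1)/2$ for $B$, $r=N/2$ for $C,D$ ($\mathbb N$ contains $0$): - $A'$: $\lambda\in\mathbb Z^N$ nonincreasing, $c_2(\lambda)=\frac1N\sum_i\lambda_i(\lambda_i+N+1-2i)$; - $A$: $\lambda\in\mathbb N^N$ nonincreasing with $\lambda_N=0$, $c_2(\lambda)=\frac1N\sum_i\lambda_i(\lambda_i+N+1-2i)-\frac1{N^2}(\sum_i\lambda_i)^2$;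 - $B$: $\lambda\in\mathbb N^r$ nonincreasing, $c_2(\lambda)=\frac1N\sum_i\lambda_i(\lambda_i+N-2i)$; - $C$: $\lambda\in\mathbb N^r$ nonincreasing, $c_2(\lambda)=\frac1N\sum_i\lambda_i(\lambda_i+N+2-2i)$; - $D$: $\lambda\in\mathbb N^{r-1}\times\mathbb Z$ with $\lambda_1\ge\dots\ge\lambda_{r-1}\ge|\lambda_r|$, $c_2(\lambda)=\frac1N\sum_i\lambda_i(\lambda_i+N-2i)$. *)

theory Defs
  imports "HOL-Analysis.Analysis" "HOL-Library.Landau_Symbols"
begin

datatype classical_type = TypeA' | TypeA | TypeB | TypeC | TypeD

text \<open>
  The compact classical groups $G_N \subset GL_N(C)$ are $U(N)$ (A'), $SU(N)$ (A),
  $SO(N)$ with $N$ odd (B), $Sp(N/2)$ with $N$ even (C), $SO(N)$ with $N$ even (D).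
\<close>

fun admissible :: "classical_type \<Rightarrow> nat \<Rightarrow> bool" where
  "admissible TypeA' N \<longleftrightarrow> 1 \<le> N"
| "admissible TypeA N \<longleftrightarrow> 1 \<le> N"
| "admissible TypeB N \<longleftrightarrow> odd N"
| "admissible TypeC N \<longleftrightarrow> 2 \<le> N \<and> even N"
| "admissible TypeD N \<longleftrightarrow> 2 \<le> N \<and> even N"

fun weight_length :: "classical_type \<Rightarrow> nat \<Rightarrow> nat" where
  "weight_length TypeA' N = N"
| "weight_length TypeA N = N"
| "weight_length TypeB N = (N - 1) div 2"
| "weight_length TypeC N = N div 2"
| "weight_length TypeD N = N div 2"

text \<open>
  The dual of $G_N$, each irreducible representation being given by its highest weight
  $(\lambda_1, \dots, \lambda_r)$. A weight is an extensional function on $\{1, \dots, r\}$,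
  so that distinct functions are distinct tuples. For type A the weights of $SU(N)$ are
  represented by their unique lift to $N$-tuples with last entry $0$.
\<close>

definition weights :: "classical_type \<Rightarrow> nat \<Rightarrow> (nat \<Rightarrow> int) set" where
  "weights \<tau> N = {1..weight_length \<tau> N} \<rightarrow>\<^sub>E UNIV"

fun unitary_dual :: "classical_type \<Rightarrow> nat \<Rightarrow> (nat \<Rightarrow> int) set" where
  "unitary_dual TypeA' N = {l \<in> weights TypeA' N. antimono_on {1..N} l}"
| "unitary_dual TypeA N =
     {l \<in> weights TypeA N. (\<forall>i\<in>{1..N}. 0 \<le> l i) \<and> antimono_on {1..N} l \<and> l N = 0}"
| "unitary_dual TypeB N =
     (let r = weight_length TypeB N in
      {l \<in> weights TypeB N. (\<forall>i\<in>{1..r}. 0 \<le> l i) \<and> antimono_on {1..r} l})"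
| "unitary_dual TypeC N =
     (let r = weight_length TypeC N in
      {l \<in> weights TypeC N. (\<forall>i\<in>{1..r}. 0 \<le> l i) \<and> antimono_on {1..r} l})"
| "unitary_dual TypeD N =
     (let r = weight_length TypeD N in
      {l \<in> weights TypeD N. (\<forall>i\<in>{1..<r}. 0 \<le> l i) \<and> antimono_on {1..<r} l \<and>
         (\<forall>i\<in>{1..<r}. \<bar>l r\<bar> \<le> l i)})"

text \<open>
  The Casimir number: $-c_2(\lambda)$ is the eigenvalue of the Laplacian of $G_N$ on the character
  of highest weight $\lambda$, for the inner product $c_N \mathrm{Tr}(X^* Y)$ on the Lie algebra
  with $c_N = N$ (types A', A) or $c_N = N/2$ (types B, C, D). It is given here by its expression
  in terms of the highest weight. The factors are real, so the subtraction of $2i$ does not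
  truncate.
\<close>

fun casimir :: "classical_type \<Rightarrow> nat \<Rightarrow> (nat \<Rightarrow> int) \<Rightarrow> real" where
  "casimir TypeA' N l =
     1 / real N * (\<Sum>i=1..N. real_of_int (l i) * (real_of_int (l i) + real N + 1 - 2 * real i))"
| "casimir TypeA N l =
     1 / real N * (\<Sum>i=1..N. real_of_int (l i) * (real_of_int (l i) + real N + 1 - 2 * real i))
     - 1 / (real N)\<^sup>2 * (\<Sum>i=1..N. real_of_int (l i))\<^sup>2"
| "casimir TypeB N l =
     1 / real N * (\<Sum>i=1..weight_length TypeB N.
                     real_of_int (l i) * (real_of_int (l i) + real N - 2 * real i))"
| "casimir TypeC N l =
     1 / real N * (\<Sum>i=1..weight_length TypeC N.
                     real_of_int (l i) * (real_of_int (l i) + real N + 2 - 2 * real i))"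
| "casimir TypeD N l =
     1 / real N * (\<Sum>i=1..weight_length TypeD N.
                     real_of_int (l i) * (real_of_int (l i) + real N - 2 * real i))"

abbreviation borel_nonneg :: "real measure" where
  "borel_nonneg \<equiv> restrict_space borel {0..}"

text \<open>The sum of the Dirac masses at the Casimir numbers, as the image of counting measure.\<close>

definition casimir_measure :: "classical_type \<Rightarrow> nat \<Rightarrow> real measure" where
  "casimir_measure \<tau> N = distr (count_space (unitary_dual \<tau> N)) borel_nonneg (casimir \<tau> N)"

definition locally_finite_measure :: "'a::topological_space measure \<Rightarrow> bool" where
  "locally_finite_measure M \<longleftrightarrow>
     (\<forall>x\<in>space M. \<exists>U. open U \<and> x \<in> U \<and> emeasure M (U \<inter> space M) < \<infinity>)"

text \<open>The filter for $N \to \infty$ through the sizes admissible for the type.\<close>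

definition size_at_top :: "classical_type \<Rightarrow> nat filter" where
  "size_at_top \<tau> = inf sequentially (principal {N. admissible \<tau> N})"

end

theory Submission
  imports Defs "HOL-Real_Asymp.Real_Asymp" "HOL-Probability.Sinc_Integral"
    "HOL-Probability.Characteristic_Functions"
begin

text \<open>
  For large $N$ a weight with bounded Casimir number is a partition with few rows (types B, C, D),
  has one small partition at each end (type A), or is such a pair of partitions shifted by an
  integer $n$ (type A'); up to $O(1/N)$ its Casimir number is the total size of the partitions, plus
  $n^2$ for type A'. So the limit measures sit on the natural numbers, and
  their distribution functions have the generating functions $P(w)/(1-w)$, $P(w)^2/(1-w)$ and
  $P(w)^2 \vartheta(w)/(1-w)$ with $P(w) = \prod_k 1/(1-w^k)$ and $\vartheta(w) = \sum_n w^{n^2}$.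
  The coefficients are found by Cauchy's formula on the circle $|w| = e^{-x}$ through the saddle
  point. There $\log P(e^{-z}) = \sum_m \frac 1m (\frac 1{mz} + h(mz))$ with
  $h(z) = 1/(e^z-1) - 1/z$, and the $h$-terms vary little within a sector, so that only
  $\pi^2/(6z)$ contributes to the shape of the Gaussian peak. Away from the
  peak the term $m = 1$ alone gives enough decay for dominated convergence.
\<close>

section \<open>The partition generating function near the unit circle\<close>

text \<open>Two classical inputs are reached by elementary means. The modular transformation of the
  eta function would give log P(e^(-x)) = pi^2/(6x) + ln(x/(2 pi))/2 + o(1) at once; here the
  constant comes from Stirling's formula, because the first n factors of the product behave like
  1/(n! x^n) and the others form an Euler-Maclaurin tail. For the theta series a sum-integral
  comparison replaces Poisson summation. Off the real axis only the quotient P(e^(-z))/P(e^(-x))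
  matters. The peak has width x^(3/2), much smaller than x, so an error of order |y|/x is harmless
  near the axis. No division into major and minor arcs occurs: after y = x^(3/2) u one majorant
  C/(1+u^2) serves the whole circle. On the group side, adding n to all entries of a weight of U(N)
  changes the Casimir number by n^2 plus a cross term of order 1/N for weights of bounded size, and
  the square subtracted for SU(N) removes exactly this change. Every natural number is an atom of
  the limit, so continuity points are non-integers, where the counts are eventually equal to their
  limit.\<close>

definition bose :: "complex \<Rightarrow> complex" where
  "bose w = 1 / (exp w - 1) - 1 / w"

lemma exp_minus_one_nz:
  fixes w :: complex assumes "Re w > 0" shows "exp w - 1 \<noteq> 0"
proof
  assume "exp w - 1 = 0"
  then have "norm (exp w) = 1" by simp
  with assms show False by simp
qed

lemma has_field_derivative_bose:
  assumes "Re w > 0"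
  shows "(bose has_field_derivative (1 / w\<^sup>2 - exp w / (exp w - 1)\<^sup>2)) (at w within S)"
proof -
  have "w \<noteq> 0" using assms by auto
  with exp_minus_one_nz[OF assms] show ?thesis
    unfolding bose_def by (auto intro!: derivative_eq_intros simp: power2_eq_square)
qed

text \<open>With u = e^a - 1 the claim reads a^2 (1+u) <= 2 u^2, and u >= a + a^2/2 gives it. The
  sharp constant would be 1, as the quotient is 1/(4 sinh^2(a/2)); the factor 2 spares the
  hyperbolic functions.\<close>

lemma exp_div_square_le:
  fixes a :: real assumes "a > 0"
  shows "exp a / (exp a - 1)\<^sup>2 \<le> 2 / a\<^sup>2"
proof -
  have 1: "exp a \<ge> 1 + a + a\<^sup>2 / 2" by (rule exp_lower_Taylor_quadratic) (use assms in auto)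
  have "0 < a + a\<^sup>2 / 2" using assms by (simp add: add_pos_pos)
  have "a\<^sup>2 * exp a \<le> 2 * (exp a - 1)\<^sup>2"
  proof -
    define u where "u = exp a - 1"
    have u: "u \<ge> a + a\<^sup>2 / 2" using 1 by (simp add: u_def)
    have "u \<ge> a" using u assms by (smt (verit) zero_le_power2 divide_nonneg_nonneg)
    have "u * u \<ge> (a + a\<^sup>2/2) * u" using u \<open>u \<ge> a\<close> assms by (intro mult_right_mono) auto
    moreover have "a * u \<ge> a * a" using \<open>u \<ge> a\<close> assms by (intro mult_left_mono) auto
    moreover have "(a + a\<^sup>2/2) * u = a * u + a\<^sup>2 * u / 2" by (simp add: algebra_simps)
    moreover have "a\<^sup>2 * (1 + u) = a * a + a\<^sup>2 * u" "2 * u\<^sup>2 = 2 * (u * u)" by (simp_all add: algebra_simps power2_eq_square)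
    ultimately have "a\<^sup>2 * (1 + u) \<le> 2 * u\<^sup>2" using zero_le_square[of a] by linarith
    then show ?thesis by (simp add: u_def)
  qed
  moreover have "exp a - 1 > 0" using assms by simp
  ultimately show ?thesis using assms by (simp add: field_simps)
qed

text \<open>For Re w >= 1/2 each of the two terms alone is O(1/(Re w)^2). Near 0 both have a double
  pole and the poles cancel: over the common denominator the numerator is O(w^4). The sector keeps w
  away from the other poles, the nonzero multiples of 2 pi i. The decay in Re w is what makes the
  sum over m in \<open>log_partition_expansion\<close> cost only 1/x.\<close>

lemma norm_deriv_bose_le:
  assumes a: "Re w > 0" and b: "\<bar>Im w\<bar> \<le> Re w"
  shows "norm (1 / w\<^sup>2 - exp w / (exp w - 1)\<^sup>2) \<le> 500 / (1 + Re w)\<^sup>2"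
proof (cases "Re w \<ge> 1/2")
  case True
  define a where "a = Re w"
  have nw: "norm w \<ge> a" unfolding a_def by (rule complex_Re_le_cmod)
  have a0: "a > 0" using assms by (simp add: a_def)
  have 1: "norm (1 / w\<^sup>2) \<le> 1 / a\<^sup>2"
    using nw a0 by (simp add: norm_divide norm_power frac_le power_mono)
  have "norm (exp w - 1) \<ge> exp a - 1"
    using norm_triangle_ineq2[of "exp w" 1] by (simp add: a_def)
  then have "norm (exp w / (exp w - 1)\<^sup>2) \<le> exp a / (exp a - 1)\<^sup>2"
    unfolding norm_divide norm_power norm_exp_eq_Re a_def[symmetric]
    using a0 by (intro divide_left_mono power_mono) (auto intro!: mult_pos_pos)
  also have "\<dots> \<le> 2 / a\<^sup>2" by (rule exp_div_square_le[OF a0])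
  finally have "norm (1 / w\<^sup>2 - exp w / (exp w - 1)\<^sup>2) \<le> 1 / a\<^sup>2 + 2 / a\<^sup>2"
    using 1 norm_triangle_ineq4 by (smt (verit))
  also have "\<dots> = 3 / a\<^sup>2" by (simp add: field_simps)
  also have "\<dots> \<le> 500 / (1 + a)\<^sup>2"
  proof -
    have "(1 + a)\<^sup>2 \<le> (3 * a)\<^sup>2" using True a0 by (intro power_mono) (auto simp: a_def)
    also have "\<dots> = 9 * a\<^sup>2" by (simp add: power_mult_distrib)
    finally have "3 * (1 + a)\<^sup>2 \<le> 500 * a\<^sup>2" using zero_le_power2[of a] by linarith
    with a0 show ?thesis by (simp add: field_simps)
  qed
  finally show ?thesis by (simp add: a_def)
next
  case False
  define v where "v = norm w"
  define \<rho> where "\<rho> = exp w - (1 + w + w\<^sup>2 / 2)"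
  have w0: "w \<noteq> 0" using a by auto
  have v0: "v > 0" using w0 by (simp add: v_def)
  have v2: "v\<^sup>2 \<le> 1/2"
  proof -
    have "v\<^sup>2 = (Re w)\<^sup>2 + (Im w)\<^sup>2" by (simp add: v_def cmod_power2)
    also have "(Re w)\<^sup>2 \<le> (1/2)\<^sup>2" using False a by (intro power_mono) auto
    also have "(Im w)\<^sup>2 \<le> (1/2)\<^sup>2" using False b by (intro abs_le_square_iff[THEN iffD1]) auto
    finally show ?thesis by (simp add: power2_eq_square)
  qed
  \<comment> \<open>71/100 is 1/sqrt 2 rounded up.\<close>
  have v1: "v \<le> 71/100"
  proof (rule ccontr)
    assume "\<not> v \<le> 71/100"
    then have "v\<^sup>2 \<ge> (71/100)\<^sup>2" by (intro power_mono) auto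
    with v2 show False by (simp add: power2_eq_square)
  qed
  have \<rho>: "norm \<rho> \<le> v ^ 3"
  proof -
    have "norm (exp w - (\<Sum>i\<le>2. w ^ i / fact i)) \<le> exp \<bar>Re w\<bar> * (norm w) ^ Suc 2 / fact 2"
      by (rule Taylor_exp)
    moreover have "(\<Sum>i\<le>2. w ^ i / fact i) = 1 + w + w\<^sup>2 / 2"
      by (simp add: numeral_2_eq_2)
    ultimately have "norm \<rho> \<le> exp \<bar>Re w\<bar> * v ^ 3 / 2"
      by (simp add: \<rho>_def v_def numeral_3_eq_3)
    also have "exp \<bar>Re w\<bar> \<le> 2"
    proof -
      have "exp (Re w) \<le> 1 + Re w + (Re w)\<^sup>2" using a False by (intro exp_bound) auto
      also have "(Re w)\<^sup>2 \<le> (1/2)\<^sup>2" using False a by (intro power_mono) auto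
      finally show ?thesis using False a by (simp add: power2_eq_square)
    qed
    finally show ?thesis using v0 by simp
  qed
  have ex: "exp w = 1 + w + w\<^sup>2 / 2 + \<rho>" by (simp add: \<rho>_def)
  \<comment> \<open>The terms of order 2 and 3 in w cancel, and so does w^2 \<rho>.\<close>
  have num: "(exp w - 1)\<^sup>2 - w\<^sup>2 * exp w = \<rho>\<^sup>2 + 2 * w * \<rho> - w ^ 4 / 4"
    unfolding ex by (simp add: field_simps power2_eq_square power4_eq_xxxx)
  have "norm ((exp w - 1)\<^sup>2 - w\<^sup>2 * exp w) \<le> norm (\<rho>\<^sup>2) + norm (2 * w * \<rho>) + norm (w ^ 4 / 4)"
    unfolding num using norm_triangle_ineq4[of "\<rho>\<^sup>2 + 2 * w * \<rho>" "w^4/4"] norm_triangle_ineq[of "\<rho>\<^sup>2" "2 * w * \<rho>"] by linarith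
  also have "\<dots> = (norm \<rho>)\<^sup>2 + 2 * v * norm \<rho> + v ^ 4 / 4"
    by (simp add: norm_mult norm_power norm_divide v_def)
  also have "\<dots> \<le> (v ^ 3)\<^sup>2 + 2 * v * v ^ 3 + v ^ 4 / 4"
    using \<rho> v0 by (intro add_mono power_mono mult_left_mono) auto
  also have "\<dots> = v ^ 4 * (v\<^sup>2 + 9/4)" by (simp add: field_simps power_numeral_reduce)
  also have "\<dots> \<le> v ^ 4 * 3" using v2 v0 by (intro mult_left_mono) auto
  finally have N: "norm ((exp w - 1)\<^sup>2 - w\<^sup>2 * exp w) \<le> 3 * v ^ 4" by simp
  \<comment> \<open>Subtracting the quadratic term and \<rho> leaves at least 1 - 0.355 - 0.5 > 1/8
    of |w|.\<close>
  have D: "norm (exp w - 1) \<ge> v / 8"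
  proof -
    have "v = norm ((exp w - 1) - w\<^sup>2 / 2 - \<rho>)" by (simp add: ex v_def)
    also have "\<dots> \<le> norm (exp w - 1) + norm (w\<^sup>2 / 2) + norm \<rho>"
      using norm_triangle_ineq4[of "exp w - 1 - w\<^sup>2 / 2" \<rho>] norm_triangle_ineq4[of "exp w - 1" "w\<^sup>2 / 2"]
      by linarith
    also have "norm (w\<^sup>2/2) = v * v / 2" by (simp add: norm_divide norm_mult v_def power2_eq_square)
    also have "v * v / 2 \<le> v * (71/100) / 2" using v1 v0 by (intro divide_right_mono mult_left_mono) auto
    also have "norm \<rho> \<le> v * v\<^sup>2" using \<rho> by (simp add: power_numeral_reduce)
    also have "v * v\<^sup>2 \<le> v * (1/2)" using v2 v0 by (intro mult_left_mono) auto
    finally show ?thesis using v0 by simp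
  qed
  have nz: "exp w - 1 \<noteq> 0" by (rule exp_minus_one_nz[OF a])
  have "1 / w\<^sup>2 - exp w / (exp w - 1)\<^sup>2 = ((exp w - 1)\<^sup>2 - w\<^sup>2 * exp w) / (w\<^sup>2 * (exp w - 1)\<^sup>2)"
    using w0 nz by (simp add: diff_frac_eq)
  then have "norm (1 / w\<^sup>2 - exp w / (exp w - 1)\<^sup>2) = norm ((exp w - 1)\<^sup>2 - w\<^sup>2 * exp w) / (v\<^sup>2 * (norm (exp w - 1))\<^sup>2)"
    by (simp add: norm_divide norm_mult norm_power v_def)
  also have "\<dots> \<le> 3 * v ^ 4 / (v\<^sup>2 * (v / 8)\<^sup>2)"
    using N D v0 by (intro frac_le mult_left_mono power_mono) auto
  \<comment> \<open>The factor 192 is 3 times 8^2; with (1 + Re w)^2 <= 9/4 it gives 432, whence the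
    constant 500.\<close>
  also have "\<dots> = 192" using v0 by (simp add: field_simps power_numeral_reduce)
  also have "\<dots> \<le> 500 / (1 + Re w)\<^sup>2"
  proof -
    have "(1 + Re w)\<^sup>2 \<le> (3/2)\<^sup>2" using False a by (intro power_mono) auto
    then have "192 * (1 + Re w)\<^sup>2 \<le> 500" by (simp add: power2_eq_square)
    then show ?thesis using a by (simp add: field_simps)
  qed
  finally show ?thesis .
qed

text \<open>Mean value inequality along the vertical segment from a to a + ib. The real part is
  constant there, so the derivative bound is one number.\<close>

lemma bose_lipschitz:
  assumes a: "a > 0" and b: "\<bar>b\<bar> \<le> a"
  shows "norm (bose (Complex a b) - bose (of_real a)) \<le> 500 / (1 + a)\<^sup>2 * \<bar>b\<bar>"
proof -
  define S where "S = closed_segment (of_real a) (Complex a b)"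
  have S: "Re w = a \<and> \<bar>Im w\<bar> \<le> a" if "w \<in> S" for w
  proof -
    from that obtain u where u: "0 \<le> u" "u \<le> 1" "w = (1 - u) *\<^sub>R of_real a + u *\<^sub>R Complex a b"
      by (auto simp: S_def in_segment)
    have "Re w = (1 - u) * a + u * a" "Im w = u * b" unfolding u(3) by simp_all
    moreover have "\<bar>u * b\<bar> \<le> 1 * a" unfolding abs_mult using u b a by (intro mult_mono) auto
    ultimately show ?thesis by (simp add: algebra_simps)
  qed
  have "norm (bose (Complex a b) - bose (of_real a)) \<le> 500 / (1 + a)\<^sup>2 * norm (Complex a b - of_real a)"
  proof (rule field_differentiable_bound[where S = S and f = bose
        and f' = "\<lambda>w. 1 / w\<^sup>2 - exp w / (exp w - 1)\<^sup>2"])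
    show "convex S" by (simp add: S_def)
    show "(bose has_field_derivative 1 / w\<^sup>2 - exp w / (exp w - 1)\<^sup>2) (at w within S)" if "w \<in> S" for w
      using S[OF that] a by (intro has_field_derivative_bose) auto
    show "norm (1 / w\<^sup>2 - exp w / (exp w - 1)\<^sup>2) \<le> 500 / (1 + a)\<^sup>2" if "w \<in> S" for w
      using norm_deriv_bose_le[of w] S[OF that] a by simp
  qed (auto simp: S_def)
  also have "Complex a b - of_real a = \<i> * of_real b" by (simp add: complex_eq_iff)
  finally show ?thesis by (simp add: norm_mult)
qed

text \<open>The value of \<open>bose\<close> at 0 would be -1/2. Adding 1/2 corresponds to the
  half-weighted end point of the trapezoidal rule, and these bounds control the Euler-Maclaurin
  remainder in \<open>log_partition_stirling_defect\<close>.\<close>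

lemma bose_real_bounds:
  fixes w :: real assumes "w > 0"
  shows "0 \<le> 1 / (exp w - 1) - 1 / w + 1 / 2" "1 / (exp w - 1) - 1 / w + 1 / 2 \<le> w / 4"
proof -
  have e: "exp w \<ge> 1 + w + w\<^sup>2 / 2" by (rule exp_lower_Taylor_quadratic) (use assms in auto)
  have e1: "exp w - 1 > 0" using assms by simp
  have p: "w + w\<^sup>2 / 2 > 0" using assms by (simp add: add_pos_pos)
  have "1 / (exp w - 1) \<le> 1 / (w + w\<^sup>2 / 2)" using e p e1 by (intro divide_left_mono mult_pos_pos) auto
  also have "\<dots> = 1 / w - 1 / (2 + w)" using assms p by (simp add: field_simps power2_eq_square)
  finally have "1 / (exp w - 1) - 1 / w + 1 / 2 \<le> 1/2 - 1 / (2 + w)" by simp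
  also have "\<dots> \<le> w / 4" using assms by (simp add: field_simps)
  finally show "1 / (exp w - 1) - 1 / w + 1 / 2 \<le> w / 4" .
  \<comment> \<open>Cleared of denominators, the lower bound is (2-w) e^w <= 2+w. The difference
    vanishes at 0 and has derivative 1 - (1-w) e^w, which is nonnegative because 1-w <=
    e^(-w).\<close>
  have "2 + 0 - (2 - 0) * exp 0 \<le> 2 + w - (2 - w) * exp w"
  proof (rule DERIV_nonneg_imp_nondecreasing[of 0 w "\<lambda>w. 2 + w - (2 - w) * exp w"])
    fix x :: real assume x: "0 \<le> x" "x \<le> w"
    have "(1 - x) * exp x \<le> exp (-x) * exp x"
      using exp_ge_add_one_self[of "-x"] by (intro mult_right_mono) auto
    then have "1 - (1 - x) * exp x \<ge> 0" by (simp add: exp_minus)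
    moreover have "((\<lambda>w. 2 + w - (2 - w) * exp w) has_real_derivative (1 - (1 - x) * exp x)) (at x)"
      by (auto intro!: derivative_eq_intros simp: algebra_simps)
    ultimately show "\<exists>y. ((\<lambda>w. 2 + w - (2 - w) * exp w) has_real_derivative y) (at x) \<and> 0 \<le> y" by blast
  qed (use assms in auto)
  then have "(2 - w) * exp w \<le> 2 + w" by simp
  then show "0 \<le> 1 / (exp w - 1) - 1 / w + 1 / 2"
    using assms e1 by (simp add: field_simps)
qed

section \<open>The logarithm of the partition generating function\<close>

abbreviation log_term :: "'a::real_normed_field \<Rightarrow> nat \<Rightarrow> 'a" where
  "log_term w m \<equiv> w ^ Suc m / (1 - w ^ Suc m) / of_nat (Suc m)"

text \<open>This Lambert series is the sum over k of -log(1 - w^k), with the logarithms expanded and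
  the geometric series in k summed. It needs no choice of branch;
  \<open>prod_geometric_tendsto\<close> links it to the product.\<close>

definition log_partition :: "'a::{real_normed_field,banach} \<Rightarrow> 'a" where
  "log_partition w = (\<Sum>m. log_term w m)"

lemma norm_one_minus_power_ge:
  fixes w :: "'a::real_normed_field" assumes "norm w < 1"
  shows "norm (1 - w ^ Suc m) \<ge> 1 - norm w"
proof -
  have "norm w ^ Suc m \<le> norm w ^ 1" using assms by (intro power_decreasing) auto
  moreover have "norm (1 - w ^ Suc m) \<ge> norm (1::'a) - norm (w ^ Suc m)" by (rule norm_triangle_ineq2)
  ultimately show ?thesis by (simp add: norm_mult norm_power)
qed

lemma one_minus_power_nz:
  fixes w :: "'a::real_normed_field" assumes "norm w < 1"
  shows "1 - w ^ Suc m \<noteq> 0"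
  using norm_one_minus_power_ge[OF assms, of m] assms by (metis diff_gt_0_iff_gt norm_zero not_le)

lemma log_partition_abs_summable:
  fixes w :: "'a::{real_normed_field,banach}" assumes "norm w < 1"
  shows "summable (\<lambda>m. norm (log_term w m))"
proof (rule summable_comparison_test)
  have "norm (log_term w m) \<le> norm w ^ Suc m / (1 - norm w) / 1" for m
    unfolding norm_divide norm_power norm_of_nat using assms norm_one_minus_power_ge[OF assms, of m]
    by (intro frac_le) auto
  then show "\<exists>N. \<forall>m\<ge>N. norm (norm (log_term w m)) \<le> norm w ^ m * (norm w / (1 - norm w))"
    by (simp add: mult.commute)
  show "summable (\<lambda>m. norm w ^ m * (norm w / (1 - norm w)))"
    using assms by (intro summable_mult2 summable_geometric) auto
qed

lemmas log_partition_summable = summable_norm_cancel[OF log_partition_abs_summable]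

lemma log_partition_of_real:
  assumes "\<bar>r\<bar> < 1"
  shows "log_partition (complex_of_real r) = of_real (log_partition r)"
proof -
  have "of_real (log_partition r) = (\<Sum>m. complex_of_real (r ^ Suc m / (1 - r ^ Suc m) / real (Suc m)))"
    unfolding log_partition_def by (rule suminf_of_real, rule log_partition_summable) (use assms in auto)
  also have "\<dots> = log_partition (complex_of_real r)"
    unfolding log_partition_def by simp
  finally show ?thesis by simp
qed

text \<open>All terms of the series have nonnegative Taylor coefficients, so the first one alone
  controls the decay away from the positive real axis.\<close>

lemma Re_log_partition_le:
  assumes "norm w < 1"
  shows "Re (log_partition w) - log_partition (norm w) \<le> Re (w / (1 - w)) - norm w / (1 - norm w)"
proof -
  define f where "f m = Re (log_term w m)
    - norm w ^ Suc m / (1 - norm w ^ Suc m) / of_nat (Suc m)" for m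
  have s1: "summable (\<lambda>m. Re (log_term w m))"
    using log_partition_summable[OF assms] by (rule summable_Re)
  have s2: "summable (\<lambda>m. norm w ^ Suc m / (1 - norm w ^ Suc m) / of_nat (Suc m))"
    using assms by (intro log_partition_summable) auto
  have sf: "summable f" unfolding f_def by (rule summable_diff[OF s1 s2])
  have "Re (log_partition w) - log_partition (norm w) = suminf f"
    unfolding log_partition_def f_def
    by (subst Re_suminf[OF log_partition_summable[OF assms]], rule suminf_diff[OF s1 s2])
  also have "\<dots> = f 0 + (\<Sum>m. f (Suc m))" using suminf_split_head[OF sf] by simp
  also have "(\<Sum>m. f (Suc m)) \<le> (\<Sum>m. 0)"
  proof (rule suminf_le)
    fix m
    have "Re (w ^ Suc n / (1 - w ^ Suc n) / of_nat (Suc n)) \<le> norm w ^ Suc n / (1 - norm w ^ Suc n) / of_nat (Suc n)" for n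
    proof -
      have "norm (1 - w ^ Suc n) \<ge> 1 - norm w ^ Suc n"
        using norm_triangle_ineq2[of 1 "w ^ Suc n"] by (simp add: norm_mult norm_power)
      moreover have "norm w ^ Suc n < 1" using assms by (simp add: power_less_one_iff del: power_Suc)
      ultimately have "norm (w ^ Suc n / (1 - w ^ Suc n) / of_nat (Suc n)) \<le> norm w ^ Suc n / (1 - norm w ^ Suc n) / of_nat (Suc n)"
        unfolding norm_divide norm_power norm_of_nat by (intro divide_right_mono divide_left_mono) (auto intro!: mult_pos_pos)
      then show ?thesis using complex_Re_le_cmod order_trans by blast
    qed
    from this[of "Suc m"] show "f (Suc m) \<le> 0" by (simp only: f_def diff_le_0_iff_le)
  qed (use sf in \<open>auto simp: summable_Suc_iff\<close>)
  finally show ?thesis by (simp add: f_def)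
qed

text \<open>Everything follows from |1-w|^2 = A^2 + D, where D measures how far w lies from the
  positive real axis on its circle. The shape D/(A(A^2+D)) is monotone in both variables, which
  \<open>Re_log_partition_decay\<close> exploits.\<close>

lemma Re_geometric_eq:
  fixes w :: complex
  assumes "norm w < 1"
  defines "A \<equiv> 1 - norm w" and "D \<equiv> 2 * (norm w - Re w)"
  shows "Re (w / (1 - w)) - norm w / (1 - norm w) = - D * (1 + norm w) / (2 * A * (A\<^sup>2 + D))"
proof -
  define r where "r = norm w"
  have r: "r < 1" using assms by (simp add: r_def)
  have r2: "(Re w)\<^sup>2 + (Im w)\<^sup>2 = r\<^sup>2" by (simp add: r_def cmod_power2)
  have D0: "D \<ge> 0" using complex_Re_le_cmod[of w] by (simp add: D_def)
  have pos: "A\<^sup>2 + D > 0" using r D0 by (simp add: A_def r_def add_pos_nonneg)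
  have eq: "(1 - Re w)\<^sup>2 + (Im w)\<^sup>2 = A\<^sup>2 + D"
    using r2 by (simp add: A_def D_def r_def[symmetric] power2_eq_square algebra_simps)
  have "Re (w / (1 - w)) = (Re w - ((Re w)\<^sup>2 + (Im w)\<^sup>2)) / ((1 - Re w)\<^sup>2 + (Im w)\<^sup>2)"
    by (simp add: Re_divide power2_eq_square algebra_simps)
  also have "\<dots> = (Re w - r\<^sup>2) / (A\<^sup>2 + D)" by (simp only: eq r2)
  finally have "Re (w / (1 - w)) - r / (1 - r) = (Re w - r\<^sup>2) / (A\<^sup>2 + D) - r / A" by (simp add: A_def r_def)
  also have "Re w = r - D / 2" by (simp add: D_def r_def field_simps)
  also have "(r - D / 2 - r\<^sup>2) / (A\<^sup>2 + D) - r / A = ((r - D / 2 - r\<^sup>2) * A - r * (A\<^sup>2 + D)) / (A * (A\<^sup>2 + D))"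
    using pos r by (subst diff_frac_eq) (auto simp: A_def r_def mult.commute)
  also have "(r - D / 2 - r\<^sup>2) * A - r * (A\<^sup>2 + D) = - D * (1 + r) / 2"
    by (simp add: A_def r_def[symmetric] power2_eq_square field_simps)
  finally show ?thesis by (simp add: r_def)
qed

text \<open>Since 1 - cos y = 2 sin^2(y/2), this is Jordan's inequality sin t >= 2t/pi squared;
  Jordan's inequality is concavity of the sine.\<close>

lemma one_minus_cos_ge:
  fixes y :: real assumes "\<bar>y\<bar> \<le> pi"
  shows "1 - cos y \<ge> 2 * y\<^sup>2 / pi\<^sup>2"
proof -
  have *: "sin t \<ge> 2 * t / pi" if "0 \<le> t" "t \<le> pi / 2" for t :: real
  proof -
    have c: "concave_on {0..pi} sin"
      by (rule f''_le0_imp_concave[where f' = cos and f'' = "\<lambda>x. - sin x"])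
         (auto intro!: derivative_eq_intros sin_ge_zero)
    define u where "u = 2 * t / pi"
    have u: "0 \<le> u" "u \<le> 1" using that by (auto simp: u_def field_simps)
    have "(1 - u) * sin 0 + u * sin (pi / 2) \<le> sin ((1 - u) *\<^sub>R 0 + u *\<^sub>R (pi / 2))"
      using c u by (intro concave_onD[of "{0..pi}"]) auto
    then show ?thesis by (simp add: u_def)
  qed
  have "\<bar>2 * (y / 2) / pi\<bar> \<le> \<bar>sin (y / 2)\<bar>"
  proof (cases "y \<ge> 0")
    case True
    with *[of "y/2"] assms show ?thesis by simp
  next
    case False
    with *[of "-y/2"] assms show ?thesis by simp
  qed
  then have "(2 * (y / 2) / pi)\<^sup>2 \<le> (sin (y / 2))\<^sup>2" by (simp only: abs_le_square_iff)
  moreover have "cos y = 1 - 2 * (sin (y / 2))\<^sup>2" using cos_double_sin[of "y/2"] by simp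
  ultimately show ?thesis by (simp add: power_divide)
qed

text \<open>Replacing one of the two equal factors by the smaller 1 + mx turns the term into a
  difference of consecutive values of 1/(1+mx), divided by x, and the series telescopes.\<close>

lemma sum_inverse_square_le:
  fixes x :: real assumes "x > 0"
  shows "summable (\<lambda>m. 1 / (1 + real (Suc m) * x)\<^sup>2)" "(\<Sum>m. 1 / (1 + real (Suc m) * x)\<^sup>2) \<le> 1 / x"
proof -
  define g where "g m = 1 / (1 + real m * x)" for m
  have "g \<longlonglongrightarrow> 0" unfolding g_def using assms by real_asymp
  then have "(\<lambda>m. g m - g (Suc m)) sums (g 0 - 0)" by (rule telescope_sums')
  then have S: "(\<lambda>m. (g m - g (Suc m)) / x) sums (1 / x)"
    using sums_divide[of _ "g 0 - 0" x] by (simp add: g_def)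
  have le: "1 / (1 + real (Suc m) * x)\<^sup>2 \<le> (g m - g (Suc m)) / x" for m
  proof -
    have p: "1 + real m * x > 0" "1 + real (Suc m) * x > 0" using assms by (auto intro: add_pos_nonneg)
    have "(g m - g (Suc m)) / x = 1 / ((1 + real m * x) * (1 + real (Suc m) * x))"
      proof -
      have "g m - g (Suc m) = x / ((1 + real m * x) * (1 + real (Suc m) * x))"
        unfolding g_def using p by (subst diff_frac_eq) (auto simp: algebra_simps)
      then show ?thesis using assms by simp
    qed
    also have "\<dots> \<ge> 1 / (1 + real (Suc m) * x)\<^sup>2"
      unfolding power2_eq_square using p assms by (intro divide_left_mono mult_right_mono mult_pos_pos) auto
    finally show ?thesis .
  qed
  show s: "summable (\<lambda>m. 1 / (1 + real (Suc m) * x)\<^sup>2)"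
    by (rule summable_comparison_test[OF _ sums_summable[OF S]]) (use le in auto)
  show "(\<Sum>m. 1 / (1 + real (Suc m) * x)\<^sup>2) \<le> 1 / x"
    using suminf_le[OF le s sums_summable[OF S]] sums_unique[OF S] by simp
qed

lemma geometric_exp_eq_bose:
  assumes "Re z > 0"
  shows "exp (- z) ^ Suc m / (1 - exp (- z) ^ Suc m) = bose (of_nat (Suc m) * z) + 1 / (of_nat (Suc m) * z)"
proof -
  define E where "E = exp (of_nat (Suc m) * z)"
  have E: "E \<noteq> 0" "E - 1 \<noteq> 0"
    using exp_minus_one_nz[of "of_nat (Suc m) * z"] assms by (simp_all add: E_def del: of_nat_Suc)
  have "exp (- z) ^ Suc m = 1 / E"
    by (simp add: E_def exp_of_nat_mult exp_minus power_inverse inverse_eq_divide[symmetric] del: of_nat_Suc power_Suc)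
  moreover have "1 / E / (1 - 1 / E) = 1 / (E - 1)" using E by (simp add: divide_simps)
  ultimately show ?thesis by (simp add: bose_def E_def del: of_nat_Suc power_Suc)
qed

text \<open>Each term splits into a pole part and a \<open>bose\<close> part. The pole parts sum to
  zeta(2) (1/z - 1/x). In the differences of the \<open>bose\<close> parts the factor m of the
  displacement my cancels the weight 1/m, and \<open>sum_inverse_square_le\<close> adds up the rest.
  The error tends to 0 whenever |y| = o(x).\<close>

lemma log_partition_expansion:
  assumes x: "x > 0" and y: "\<bar>y\<bar> \<le> x"
  defines "z \<equiv> Complex x y"
  shows "norm (log_partition (exp (- z)) - log_partition (exp (- of_real x))
           - of_real (pi\<^sup>2 / 6) * (1 / z - 1 / of_real x)) \<le> 500 * \<bar>y\<bar> / x"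
proof -
  define d where "d m = (bose (of_nat (Suc m) * z) - bose (of_nat (Suc m) * of_real x)) / of_nat (Suc m)" for m
  have z: "Re z > 0" "z \<noteq> 0" using x by (auto simp: z_def complex_eq_iff)
  have n: "norm (exp (- z)) < 1" "norm (exp (- complex_of_real x)) < 1" using x by (auto simp: z_def)
  have "(\<lambda>m. log_term (exp (- z)) m
       - log_term (exp (- of_real x)) m
       - of_real (1 / (real m + 1)\<^sup>2) * (1 / z - 1 / of_real x))
     sums (log_partition (exp (- z)) - log_partition (exp (- of_real x)) - of_real (pi\<^sup>2 / 6) * (1 / z - 1 / of_real x))"
    unfolding log_partition_def
    by (intro sums_diff summable_sums log_partition_summable n sums_mult2 sums_of_real)
       (use inverse_squares_sums in \<open>simp add: add.commute\<close>)
  moreover have "log_term (exp (- z)) m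
       - log_term (exp (- of_real x)) m
       - of_real (1 / (real m + 1)\<^sup>2) * (1 / z - 1 / of_real x) = d m" for m
    unfolding d_def using geometric_exp_eq_bose[of z m] geometric_exp_eq_bose[of "of_real x" m] z x
    by (simp add: diff_divide_distrib add_divide_distrib power2_eq_square algebra_simps)
  ultimately have S: "d sums (log_partition (exp (- z)) - log_partition (exp (- of_real x)) - of_real (pi\<^sup>2 / 6) * (1 / z - 1 / of_real x))"
    by simp
  have le: "norm (d m) \<le> 500 * \<bar>y\<bar> * (1 / (1 + real (Suc m) * x)\<^sup>2)" for m
  proof -
    define M where "M = real (Suc m)"
    have M: "M > 0" by (simp add: M_def)
    have "norm (bose (Complex (M * x) (M * y)) - bose (of_real (M * x))) \<le> 500 / (1 + M * x)\<^sup>2 * \<bar>M * y\<bar>"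
      using x y M by (intro bose_lipschitz) (auto simp: abs_mult)
    moreover have "Complex (M * x) (M * y) = of_nat (Suc m) * z" "complex_of_real (M * x) = of_nat (Suc m) * of_real x"
      by (simp_all add: M_def z_def complex_eq_iff del: of_nat_Suc)
    ultimately have "norm (d m) \<le> 500 / (1 + M * x)\<^sup>2 * \<bar>M * y\<bar> / M"
      unfolding d_def norm_divide norm_of_nat M_def[symmetric] using M by (intro divide_right_mono) auto
    then show ?thesis using M by (simp add: M_def abs_mult)
  qed
  have s: "summable (\<lambda>m. 500 * \<bar>y\<bar> * (1 / (1 + real (Suc m) * x)\<^sup>2))"
    by (intro summable_mult sum_inverse_square_le x)
  have "norm (suminf d) \<le> (\<Sum>m. 500 * \<bar>y\<bar> * (1 / (1 + real (Suc m) * x)\<^sup>2))"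
    using le s by (rule norm_suminf_le)
  also have "\<dots> = 500 * \<bar>y\<bar> * (\<Sum>m. 1 / (1 + real (Suc m) * x)\<^sup>2)"
    by (intro suminf_mult sum_inverse_square_le x)
  also have "\<dots> \<le> 500 * \<bar>y\<bar> * (1 / x)"
    by (intro mult_left_mono sum_inverse_square_le x) auto
  finally show ?thesis using sums_unique[OF S] by simp
qed

section \<open>The dilogarithm Li_2(e^(-t)) as t tends to 0\<close>

definition dilog_exp :: "real \<Rightarrow> real" where
  "dilog_exp t = (\<Sum>m. exp (- (real (Suc m) * t)) / (real (Suc m))\<^sup>2)"

lemma sums_ln_one_minus_exp:
  assumes "t > 0"
  shows "(\<lambda>m. exp (- (real (Suc m) * t)) / real (Suc m)) sums (- ln (1 - exp (- t)))"
proof -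
  have "(\<lambda>n. - ((- (- exp (- t))) ^ n) / of_nat n) sums ln (1 + (- exp (- t)))"
    using assms by (intro ln_series') auto
  then have "(\<lambda>n. - (- ((- (- exp (- t))) ^ n) / of_nat n)) sums (- ln (1 + (- exp (- t))))"
    by (rule sums_minus)
  then have "(\<lambda>n. exp (- t) ^ n / real n) sums (- ln (1 - exp (- t)))" by simp
  then have "(\<lambda>n. exp (- t) ^ Suc n / real (Suc n)) sums (- ln (1 - exp (- t)))"
    by (subst sums_Suc_iff) simp
  then show ?thesis by (simp add: exp_of_nat_mult[symmetric] del: of_nat_Suc power_Suc)
qed

lemma summable_inverse_Suc_square: "summable (\<lambda>m. 1 / (real (Suc m))\<^sup>2)"
  using inverse_squares_sums by (simp add: sums_iff add.commute)

lemma uniform_limit_dilog_exp: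
  "uniform_limit {0..} (\<lambda>n t. \<Sum>m<n. exp (- (real (Suc m) * t)) / (real (Suc m))\<^sup>2) dilog_exp sequentially"
  unfolding dilog_exp_def
  by (rule Weierstrass_m_test[OF _ summable_inverse_Suc_square])
     (auto simp: divide_simps simp del: of_nat_Suc)

lemma continuous_on_dilog_exp: "continuous_on {0..} dilog_exp"
  by (rule uniform_limit_theorem[OF _ uniform_limit_dilog_exp])
     (auto intro!: continuous_intros always_eventually simp del: of_nat_Suc)

lemma dilog_exp_0: "dilog_exp 0 = pi\<^sup>2 / 6"
  using inverse_squares_sums by (simp add: dilog_exp_def sums_iff add.commute)

lemma has_derivative_dilog_exp:
  assumes "t > 0"
  shows "(dilog_exp has_real_derivative ln (1 - exp (- t))) (at t)"
proof -
  \<comment> \<open>The derived series diverges at 0, so it converges uniformly only away from 0;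
    any positive bound below t serves.\<close>
  define \<delta> where "\<delta> = t / 2"
  have \<delta>: "\<delta> > 0" "\<delta> < t" using assms by (auto simp: \<delta>_def)
  define g where "g m s = exp (- (real (Suc m) * s)) / (real (Suc m))\<^sup>2" for m s
  define g' where "g' m s = - exp (- (real (Suc m) * s)) / real (Suc m)" for m s
  have "((\<lambda>s. \<Sum>m. g m s) has_real_derivative (\<Sum>m. g' m t)) (at t)"
  proof (rule has_field_derivative_series'[where S = "{\<delta><..}"])
    show "(g n has_real_derivative g' n s) (at s within {\<delta><..})" for n s
      unfolding g_def g'_def
      by (auto intro!: derivative_eq_intros simp: power2_eq_square simp del: of_nat_Suc)
    show "uniformly_convergent_on {\<delta><..} (\<lambda>n s. \<Sum>i<n. g' i s)"
    proof (rule Weierstrass_m_test'[where M = "\<lambda>m. exp (- (real (Suc m) * \<delta>)) / real (Suc m)"])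
      show "summable (\<lambda>m. exp (- (real (Suc m) * \<delta>)) / real (Suc m))"
        using sums_ln_one_minus_exp[OF \<delta>(1)] by (simp add: sums_iff)
      show "norm (g' n s) \<le> exp (- (real (Suc n) * \<delta>)) / real (Suc n)" if "s \<in> {\<delta><..}" for n s
        using that by (auto simp: g'_def divide_simps simp del: of_nat_Suc)
    qed
    have "\<And>n. norm (g n t) \<le> 1 / (real (Suc n))\<^sup>2"
      using assms by (auto simp: g_def divide_simps simp del: of_nat_Suc)
    then show "summable (\<lambda>n. g n t)"
      by (intro summable_comparison_test'[OF summable_inverse_Suc_square, of 0]) auto
  qed (use \<delta> in \<open>auto simp: interior_open\<close>)
  moreover have "(\<Sum>m. g' m t) = ln (1 - exp (- t))"
    using sums_minus[OF sums_ln_one_minus_exp[OF assms]] by (simp add: g'_def sums_iff)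
  ultimately show ?thesis by (simp add: g_def dilog_exp_def[abs_def])
qed

text \<open>The term t ln t is chosen so that the derivative of the numerator is ln((1 - e^(-t))/t),
  which tends to 0; L'Hopital's rule does the rest.\<close>

lemma dilog_exp_asymp:
  "((\<lambda>t. (dilog_exp t - pi\<^sup>2 / 6 + t - t * ln t) / t) \<longlongrightarrow> 0) (at_right 0)"
proof (rule lhopital_right_0[where f' = "\<lambda>t. ln (1 - exp (- t)) - ln t" and g' = "\<lambda>_. 1"])
  have "(dilog_exp \<longlongrightarrow> dilog_exp 0) (at 0 within {0..})"
    using continuous_on_dilog_exp by (auto simp: continuous_on_def)
  then have "(dilog_exp \<longlongrightarrow> pi\<^sup>2 / 6) (at_right 0)"
    unfolding dilog_exp_0 by (rule tendsto_within_subset) auto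
  then have "((\<lambda>t. (dilog_exp t - pi\<^sup>2 / 6) + (t - t * ln t)) \<longlongrightarrow> (pi\<^sup>2 / 6 - pi\<^sup>2 / 6) + 0) (at_right 0)"
    by (intro tendsto_intros) (auto, real_asymp)
  then show "((\<lambda>t. dilog_exp t - pi\<^sup>2 / 6 + t - t * ln t) \<longlongrightarrow> 0) (at_right 0)"
    by (simp add: algebra_simps)
  show "((\<lambda>t::real. t) \<longlongrightarrow> 0) (at_right 0)" by real_asymp
  show "\<forall>\<^sub>F t::real in at_right 0. (1::real) \<noteq> 0" by simp
  have pos: "\<forall>\<^sub>F t::real in at_right 0. t > 0" by real_asymp
  then show "\<forall>\<^sub>F t::real in at_right 0. t \<noteq> 0" by eventually_elim auto
  from pos show "\<forall>\<^sub>F t in at_right 0. ((\<lambda>t. dilog_exp t - pi\<^sup>2 / 6 + t - t * ln t)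
      has_real_derivative ln (1 - exp (- t)) - ln t) (at t)"
  proof eventually_elim
    case (elim t)
    then show ?case by (auto intro!: derivative_eq_intros has_derivative_dilog_exp)
  qed
  show "\<forall>\<^sub>F t::real in at_right 0. ((\<lambda>t. t) has_real_derivative 1) (at t)" by simp
  show "((\<lambda>t::real. (ln (1 - exp (- t)) - ln t) / 1) \<longlongrightarrow> 0) (at_right 0)" by real_asymp
qed

section \<open>The partition function near 1 and Stirling's constant\<close>

definition stirling_defect :: "nat \<Rightarrow> real" where
  "stirling_defect n = - ln (fact n) + real n * ln (real n) - real n + ln (real n) / 2"

text \<open>The defect is compared with the logarithm of the partition function in two ways: this
  shows that it converges, and Wallis' product then gives the limit.\<close>

abbreviation log_partition_excess :: "real \<Rightarrow> real" where
  "log_partition_excess x \<equiv> log_partition (exp (- x)) - pi\<^sup>2 / (6 * x) - ln x / 2"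

text \<open>With f(t) = -ln(1 - e^(-t)), log P(e^(-x)) is the sum of f(kx) over k >= 1. The terms k
  <= n give -ln n! - n ln x + o(1). The tail k > n is replaced by its Euler-Maclaurin main part: the
  integral of f from nx on, divided by x, which is \<open>dilog_exp (n * x) / x\<close>, minus
  f(nx)/2. The error of this replacement is at most 1/n uniformly in x, so that x may tend to 0
  first and n grow afterwards.\<close>

lemma log_partition_stirling_defect:
  assumes n: "n > 0"
  shows "\<exists>e. (e \<longlongrightarrow> 0) (at_right 0) \<and>
    (\<forall>x>0. \<bar>log_partition_excess x - stirling_defect n - e x\<bar> \<le> 1 / real n)"
proof -
  \<comment> \<open>What vanishes as x tends to 0 for fixed n: the factors k <= n after removal of
    ln(kx), the remainder of the dilogarithm expansion, and the half-weighted boundary term.\<close>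
  define e where "e x =
      (\<Sum>k=1..n. - ln ((1 - exp (- (real k * x))) / (real k * x))) +
      real n * ((dilog_exp (real n * x) - pi\<^sup>2 / 6 + real n * x - real n * x * ln (real n * x)) / (real n * x)) +
      ln ((1 - exp (- (real n * x))) / (real n * x)) / 2" for x :: real
  have l1: "((\<lambda>x. ln ((1 - exp (- (c * x))) / (c * x))) \<longlongrightarrow> 0) (at_right 0)" if "c > 0" for c :: real
    using that by real_asymp
  have "filterlim (\<lambda>x. real n * x) (at_right 0) (at_right 0)" using n by real_asymp
  from filterlim_compose[OF dilog_exp_asymp this]
  have l2: "((\<lambda>x. (dilog_exp (real n * x) - pi\<^sup>2 / 6 + real n * x - real n * x * ln (real n * x)) / (real n * x)) \<longlongrightarrow> 0) (at_right 0)" .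
  have "(e \<longlongrightarrow> (\<Sum>k=1..n. - 0) + real n * 0 + 0 / 2) (at_right 0)"
    unfolding e_def using n by (intro tendsto_intros l1 l2) auto
  then have lim: "(e \<longlongrightarrow> 0) (at_right 0)" by simp
  have bound: "\<bar>log_partition_excess x - stirling_defect n - e x\<bar> \<le> 1 / real n"
    if x: "x > 0" for x :: real
  proof -
    define g where "g w = 1 / (exp w - 1) - 1 / w + 1 / 2" for w :: real
    \<comment> \<open>The m-th term of the Euler-Maclaurin remainder.\<close>
    define r where "r m = exp (- (real (Suc m) * (real n * x))) / real (Suc m) * g (real (Suc m) * x)" for m
    have nx: "real n * x > 0" using n x by simp
    have S1: "(\<lambda>m. exp (- (real (Suc m) * (real k * x))) / real (Suc m)) sums (- ln (1 - exp (- (real k * x))))"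
      if "k \<in> {1..n}" for k using that x by (intro sums_ln_one_minus_exp) auto
    have S2: "(\<lambda>m. exp (- (real (Suc m) * (real n * x))) / (real (Suc m))\<^sup>2) sums dilog_exp (real n * x)"
      unfolding dilog_exp_def
      by (intro summable_sums summable_comparison_test'[OF summable_inverse_Suc_square, of 0])
         (use nx in \<open>auto simp: divide_simps simp del: of_nat_Suc\<close>)
    have S3: "(\<lambda>m. log_term (exp (- x)) m) sums log_partition (exp (- x))"
      unfolding log_partition_def using x by (intro summable_sums log_partition_summable) auto
    have "(\<lambda>m. log_term (exp (- x)) m
        - (\<Sum>k=1..n. exp (- (real (Suc m) * (real k * x))) / real (Suc m))
        - exp (- (real (Suc m) * (real n * x))) / (real (Suc m))\<^sup>2 / x
        + exp (- (real (Suc m) * (real n * x))) / real (Suc m) / 2)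
      sums (log_partition (exp (- x)) - (\<Sum>k=1..n. - ln (1 - exp (- (real k * x))))
        - dilog_exp (real n * x) / x + - ln (1 - exp (- (real n * x))) / 2)"
      using n by (intro sums_add sums_diff sums_divide sums_sum S1 S2 S3) auto
    moreover have "log_term (exp (- x)) m
        - (\<Sum>k=1..n. exp (- (real (Suc m) * (real k * x))) / real (Suc m))
        - exp (- (real (Suc m) * (real n * x))) / (real (Suc m))\<^sup>2 / x
        + exp (- (real (Suc m) * (real n * x))) / real (Suc m) / 2 = r m" for m
    proof -
      define M where "M = real (Suc m)"
      define q where "q = exp (- (M * x))"
      have M: "M > 0" by (simp add: M_def)
      have q: "0 < q" "q < 1" using M x by (auto simp: q_def)
      have qk: "exp (- (M * (real k * x))) = q ^ k" for k
        by (simp add: q_def exp_of_nat_mult[symmetric] mult_ac)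
      have "exp (- x) ^ Suc m = q" by (simp add: q_def M_def exp_of_nat_mult[symmetric] del: power_Suc of_nat_Suc)
      moreover have "(\<Sum>k=1..n. q ^ k / M) = (q - q ^ Suc n) / (1 - q) / M"
        using q sum_gp[of q 1 n] n by (simp add: sum_divide_distrib[symmetric])
      moreover have "exp (M * x) = 1 / q" by (simp add: q_def exp_minus divide_simps)
      \<comment> \<open>The geometric sum over k <= n cancels q/(1-q) up to its multiple by q^n,
        which thus becomes a common factor.\<close>
      moreover have "q / (1 - q) / M - (q - q ^ Suc n) / (1 - q) / M - q ^ n / M\<^sup>2 / x + q ^ n / M / 2
        = q ^ n / M * (1 / (1 / q - 1) - 1 / (M * x) + 1 / 2)"
      proof -
        define t where "t = q / (1 - q)"
        have "1 / (1 / q - 1) = t" "(q - q ^ Suc n) / (1 - q) = t - q ^ n * t"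
          using q by (simp_all add: t_def divide_simps)
        then show ?thesis
          unfolding t_def[symmetric] using M x by (simp only:) (simp add: field_simps power2_eq_square)
      qed
      ultimately show ?thesis unfolding r_def g_def M_def[symmetric] qk by (simp only:)
    qed
    ultimately have Sr: "r sums (log_partition (exp (- x)) - (\<Sum>k=1..n. - ln (1 - exp (- (real k * x))))
        - dilog_exp (real n * x) / x + - ln (1 - exp (- (real n * x))) / 2)" by simp
    \<comment> \<open>The bound g(Mx) <= Mx/4 cancels the weight 1/M and leaves a geometric series
      with sum x/(e^(nx) - 1) <= 1/n.\<close>
    have r: "0 \<le> r m" "r m \<le> x * exp (- (real n * x)) ^ Suc m" for m
    proof -
      define M where "M = real (Suc m)"
      have M: "M > 0" by (simp add: M_def)
      have g: "0 \<le> g (M * x)" "g (M * x) \<le> M * x / 4" unfolding g_def using bose_real_bounds[of "M * x"] M x by auto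
      have "exp (- (M * (real n * x))) = exp (- (real n * x)) ^ Suc m"
        by (simp add: M_def exp_of_nat_mult[symmetric] del: power_Suc of_nat_Suc)
      show "0 \<le> r m"
        unfolding r_def M_def[symmetric] using g M by simp
      have "r m \<le> exp (- (M * (real n * x))) / M * (M * x / 4)"
        unfolding r_def M_def[symmetric] using g M by (intro mult_left_mono) auto
      also have "\<dots> = x / 4 * exp (- (M * (real n * x)))" using M by simp
      also have "\<dots> \<le> x * exp (- (M * (real n * x)))" using x by (intro mult_right_mono) auto
      finally show "r m \<le> x * exp (- (real n * x)) ^ Suc m"
        using \<open>exp (- (M * (real n * x))) = exp (- (real n * x)) ^ Suc m\<close> by simp
    qed
    have Sg: "(\<lambda>m. x * exp (- (real n * x)) ^ Suc m) sums (x * (exp (- (real n * x)) / (1 - exp (- (real n * x)))))"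
      using sums_mult[OF sums_mult[OF geometric_sums[of "exp (- (real n * x))"], of "exp (- (real n * x))"], of x] nx
      by simp
    have sr: "summable r" using Sr by (simp add: sums_iff)
    have "0 \<le> suminf r" by (intro suminf_nonneg sr r)
    moreover have "suminf r \<le> x * (exp (- (real n * x)) / (1 - exp (- (real n * x))))"
      using suminf_le[OF r(2) sr] Sg by (simp add: sums_iff)
    moreover have "x * (exp (- (real n * x)) / (1 - exp (- (real n * x)))) \<le> 1 / real n"
    proof -
      have "exp (- (real n * x)) / (1 - exp (- (real n * x))) = 1 / (exp (real n * x) - 1)"
        using nx by (simp add: exp_minus divide_simps)
      also have "\<dots> \<le> 1 / (real n * x)"
        using nx exp_ge_add_one_self[of "real n * x"] by (intro frac_le) linarith+
      finally have "x * (exp (- (real n * x)) / (1 - exp (- (real n * x)))) \<le> x * (1 / (real n * x))"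
        using x by (intro mult_left_mono) auto
      then show ?thesis using x by simp
    qed
    moreover have "log_partition_excess x - stirling_defect n - e x = suminf r"
    proof -
      have ln1: "ln ((1 - exp (- (real k * x))) / (real k * x)) = ln (1 - exp (- (real k * x))) - ln (real k) - ln x"
        if "k > 0" for k using that x by (simp add: ln_div ln_mult)
      have "(\<Sum>k=1..n. - ln ((1 - exp (- (real k * x))) / (real k * x)))
          = (\<Sum>k=1..n. - ln (1 - exp (- (real k * x))) + ln (real k) + ln x)"
        by (intro sum.cong) (auto simp: ln1)
      also have "\<dots> = (\<Sum>k=1..n. - ln (1 - exp (- (real k * x)))) + (\<Sum>k=1..n. ln (real k)) + real n * ln x"
        unfolding sum.distrib by simp
      also have "(\<Sum>k=1..n. ln (real k)) = ln (fact n)"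
        by (subst ln_prod[symmetric]) (auto simp: fact_prod)
      finally have sum_eq: "(\<Sum>k=1..n. - ln ((1 - exp (- (real k * x))) / (real k * x)))
         = (\<Sum>k=1..n. - ln (1 - exp (- (real k * x)))) + ln (fact n) + real n * ln x" .
      have "real n * ((dilog_exp (real n * x) - pi\<^sup>2 / 6 + real n * x - real n * x * ln (real n * x)) / (real n * x))
         = dilog_exp (real n * x) / x - pi\<^sup>2 / (6 * x) + real n - real n * (ln (real n) + ln x)"
        using n x by (simp add: ln_mult field_simps)
      then have "e x = (\<Sum>k=1..n. - ln (1 - exp (- (real k * x)))) + ln (fact n) + real n * ln x
         + (dilog_exp (real n * x) / x - pi\<^sup>2 / (6 * x) + real n - real n * (ln (real n) + ln x))
         + (ln (1 - exp (- (real n * x))) - ln (real n) - ln x) / 2"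
        unfolding e_def sum_eq ln1[OF n] by simp
      moreover have "suminf r = log_partition (exp (- x)) - (\<Sum>k=1..n. - ln (1 - exp (- (real k * x))))
        - dilog_exp (real n * x) / x + - ln (1 - exp (- (real n * x))) / 2"
        using Sr by (simp add: sums_iff)
      ultimately show ?thesis by (simp add: stirling_defect_def field_simps)
    qed
    ultimately show ?thesis by linarith
  qed
  from lim bound show ?thesis by blast
qed

text \<open>The factorial form makes the logarithm of Wallis' product comparable with the defects at
  n and 2n.\<close>

lemma Wallis_product_eq:
  "(\<Prod>k=1..n. (4 * real k ^ 2) / (4 * real k ^ 2 - 1)) = (4 ^ n * (fact n)\<^sup>2 / fact (2 * n))\<^sup>2 / (2 * real n + 1)"
proof (induction n)
  case (Suc n)
  have f: "(fact (2 * Suc n) :: real) = (2 * real n + 2) * (2 * real n + 1) * fact (2 * n)"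
    by (simp add: algebra_simps)
  have g: "(fact (Suc n) :: real) = (real n + 1) * fact n" by simp
  have nz: "2 * real n + 1 \<noteq> 0" "2 * real n + 3 \<noteq> 0" "(fact (2 * n) :: real) \<noteq> 0" "real n + 1 \<noteq> 0"
    by (auto simp: add_eq_0_iff_both_eq_0 intro: order.strict_implies_not_eq[symmetric])
  define a where "a = real n"
  define F where "F = (fact n :: real)"
  define F2 where "F2 = (fact (2 * n) :: real)"
  define P where "P = (4 ^ n :: real)"
  have "4 * (a + 1)\<^sup>2 - 1 = (2 * a + 1) * (2 * a + 3)" by (simp add: power2_eq_square algebra_simps)
  moreover have "(P * F\<^sup>2 / F2)\<^sup>2 / (2 * a + 1) * (4 * (a + 1)\<^sup>2 / ((2 * a + 1) * (2 * a + 3)))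
     = ((4 * P) * ((a + 1) * F)\<^sup>2 / ((2 * a + 2) * (2 * a + 1) * F2))\<^sup>2 / (2 * a + 3)"
    using nz unfolding a_def[symmetric] F2_def[symmetric] by (simp add: divide_simps) (simp add: power2_eq_square power4_eq_xxxx algebra_simps)
  ultimately have "(P * F\<^sup>2 / F2)\<^sup>2 / (2 * a + 1) * (4 * (a + 1)\<^sup>2 / (4 * (a + 1)\<^sup>2 - 1))
     = ((4 * P) * ((a + 1) * F)\<^sup>2 / ((2 * a + 2) * (2 * a + 1) * F2))\<^sup>2 / (2 * a + 3)" by simp
  moreover have "(\<Prod>k=1..Suc n. (4 * real k ^ 2) / (4 * real k ^ 2 - 1))
     = (P * F\<^sup>2 / F2)\<^sup>2 / (2 * a + 1) * (4 * (a + 1)\<^sup>2 / (4 * (a + 1)\<^sup>2 - 1))"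
    using Suc by (simp add: a_def P_def F_def F2_def add.commute)
  moreover have "2 * real (Suc n) + 1 = 2 * a + 3" by (simp add: a_def)
  ultimately show ?case
    unfolding f g by (simp only: a_def P_def F_def F2_def power_Suc)
qed auto

text \<open>For the same small x, the defects at n and at m lie within 1/n and 1/m, up to a
  vanishing error, of one and the same \<open>log_partition_excess x\<close>. So they form a Cauchy
  sequence, although no limit of the excess is known yet.\<close>

lemma convergent_stirling_defect: "convergent stirling_defect"
proof -
  have le: "\<bar>stirling_defect n - stirling_defect m\<bar> \<le> 1 / real n + 1 / real m" if n: "n > 0" and m: "m > 0" for n m
  proof (rule field_le_epsilon)
    fix \<epsilon> :: real assume \<epsilon>: "\<epsilon> > 0"
    obtain e where e: "(e \<longlongrightarrow> 0) (at_right 0)"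
     "\<And>x. x > 0 \<Longrightarrow> \<bar>log_partition_excess x - stirling_defect n - e x\<bar> \<le> 1 / real n"
      using log_partition_stirling_defect[OF n] by blast
    obtain e' where e': "(e' \<longlongrightarrow> 0) (at_right 0)"
     "\<And>x. x > 0 \<Longrightarrow> \<bar>log_partition_excess x - stirling_defect m - e' x\<bar> \<le> 1 / real m"
      using log_partition_stirling_defect[OF m] by blast
    have "\<forall>\<^sub>F x in at_right 0. \<bar>e x\<bar> < \<epsilon> / 2" "\<forall>\<^sub>F x in at_right 0. \<bar>e' x\<bar> < \<epsilon> / 2"
      using order_tendstoD(2)[OF tendsto_rabs_zero[OF e(1)], of "\<epsilon>/2"] order_tendstoD(2)[OF tendsto_rabs_zero[OF e'(1)], of "\<epsilon>/2"] \<epsilon> by auto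
    moreover have "\<forall>\<^sub>F x::real in at_right 0. x > 0" by real_asymp
    ultimately have "\<forall>\<^sub>F x in at_right 0. \<bar>e x\<bar> < \<epsilon> / 2 \<and> \<bar>e' x\<bar> < \<epsilon> / 2 \<and> x > 0"
      by eventually_elim auto
    then obtain x where "\<bar>e x\<bar> < \<epsilon> / 2" "\<bar>e' x\<bar> < \<epsilon> / 2" "x > 0"
      using eventually_happens'[OF trivial_limit_at_right_real] by blast
    with e(2)[of x] e'(2)[of x] show "\<bar>stirling_defect n - stirling_defect m\<bar> \<le> 1 / real n + 1 / real m + \<epsilon>"
      by linarith
  qed
  have "Cauchy stirling_defect"
  proof (rule metric_CauchyI)
    fix \<epsilon> :: real assume \<epsilon>: "\<epsilon> > 0"
    obtain M where M: "real M > 2 / \<epsilon>" using reals_Archimedean2 by blast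
    have M0: "M > 0" using M \<epsilon> by (metis divide_pos_pos of_nat_0_less_iff order.strict_trans zero_less_numeral)
    have inv: "1 / real n < \<epsilon> / 2" if "n \<ge> M" for n
    proof -
      have "real n > 2 / \<epsilon>" using that M by linarith
      then show ?thesis using \<epsilon> M0 that by (simp add: field_simps)
    qed
    have "dist (stirling_defect m) (stirling_defect n) < \<epsilon>" if "m \<ge> M" "n \<ge> M" for m n
      using le[of m n] inv[OF that(1)] inv[OF that(2)] M0 that by (auto simp: dist_real_def)
    then show "\<exists>M. \<forall>m\<ge>M. \<forall>n\<ge>M. dist (stirling_defect m) (stirling_defect n) < \<epsilon>" by blast
  qed
  then show ?thesis by (rule Cauchy_convergent)
qed

text \<open>If the limit is c, then twice (2 times the defect at n minus the defect at 2n) tends to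
  2c. By Wallis' product the same quantity tends to -ln(pi/2) - 2 ln 2 = -ln(2 pi).\<close>

lemma stirling_defect_limit: "stirling_defect \<longlonglongrightarrow> - ln (2 * pi) / 2"
proof -
  obtain c where c: "stirling_defect \<longlonglongrightarrow> c" using convergent_stirling_defect by (auto simp: convergent_def)
  have "(\<lambda>n. stirling_defect (2 * n)) \<longlonglongrightarrow> c"
    by (rule filterlim_compose[OF c]) real_asymp
  then have 1: "(\<lambda>n. 2 * (2 * stirling_defect n - stirling_defect (2 * n))) \<longlonglongrightarrow> 2 * (2 * c - c)"
    by (intro tendsto_intros c)
  have "(\<lambda>n. - ln (\<Prod>k=1..n. (4 * real k ^ 2) / (4 * real k ^ 2 - 1)) + (ln (real n / (2 * real n + 1)) - ln 2))
      \<longlonglongrightarrow> - ln (pi / 2) + (- ln 2 - ln 2)"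
  proof (intro tendsto_add tendsto_minus tendsto_ln wallis)
    show "(\<lambda>n. ln (real n / (2 * real n + 1)) - ln 2) \<longlonglongrightarrow> - ln 2 - ln 2"
      by (real_asymp simp: ln_div)
  qed auto
  moreover have "\<forall>\<^sub>F n in sequentially. - ln (\<Prod>k=1..n. (4 * real k ^ 2) / (4 * real k ^ 2 - 1)) + (ln (real n / (2 * real n + 1)) - ln 2)
     = 2 * (2 * stirling_defect n - stirling_defect (2 * n))"
    using eventually_gt_at_top[of 0]
  proof eventually_elim
    case (elim n)
    have "ln (\<Prod>k=1..n. (4 * real k ^ 2) / (4 * real k ^ 2 - 1))
      = 2 * (real n * ln 4 + 2 * ln (fact n) - ln (fact (2 * n))) - ln (2 * real n + 1)"
      unfolding Wallis_product_eq by (simp add: ln_div ln_mult ln_realpow add_pos_nonneg)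
    moreover have "ln (4::real) = 2 * ln 2" using ln_realpow[of "2::real" 2] by simp
    ultimately show ?case using elim
      by (simp add: stirling_defect_def ln_div ln_mult algebra_simps)
  qed
  ultimately have "(\<lambda>n. 2 * (2 * stirling_defect n - stirling_defect (2 * n))) \<longlonglongrightarrow> - ln (pi / 2) + (- ln 2 - ln 2)"
    by (rule Lim_transform_eventually)
  from LIMSEQ_unique[OF 1 this] have "c = - ln (2 * pi) / 2"
    by (simp add: ln_div ln_mult)
  with c show ?thesis by simp
qed

text \<open>On the real axis this has the precision that the modular transformation of the eta
  function would give, namely P(e^(-x)) ~ sqrt(x/(2 pi)) e^(pi^2/(6x)). Here n is fixed first, to
  bring the defect near its limit and make 1/n small; then x tends to 0.\<close>

lemma log_partition_asymp:
  "((\<lambda>x. log_partition_excess x) \<longlongrightarrow> - ln (2 * pi) / 2) (at_right (0::real))"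
proof (rule tendstoI)
  fix \<epsilon> :: real assume \<epsilon>: "\<epsilon> > 0"
  have "\<forall>\<^sub>F n in sequentially. dist (stirling_defect n) (- ln (2 * pi) / 2) < \<epsilon> / 3"
    by (rule tendstoD[OF stirling_defect_limit]) (use \<epsilon> in auto)
  moreover have "\<forall>\<^sub>F n in sequentially. 1 / real n < \<epsilon> / 3"
    using \<epsilon> by real_asymp
  moreover note eventually_gt_at_top[of "0::nat"]
  ultimately have "\<forall>\<^sub>F n in sequentially. dist (stirling_defect n) (- ln (2 * pi) / 2) < \<epsilon> / 3 \<and> 1 / real n < \<epsilon> / 3 \<and> n > 0"
    by eventually_elim auto
  then obtain n where n: "dist (stirling_defect n) (- ln (2 * pi) / 2) < \<epsilon> / 3" "1 / real n < \<epsilon> / 3" and n_pos: "n > 0"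
    using eventually_happens'[OF sequentially_bot] by blast
  obtain e where e: "(e \<longlongrightarrow> 0) (at_right 0)"
     "\<And>x. x > 0 \<Longrightarrow> \<bar>log_partition_excess x - stirling_defect n - e x\<bar> \<le> 1 / real n"
    using log_partition_stirling_defect[OF n_pos] by blast
  have "\<forall>\<^sub>F x in at_right 0. \<bar>e x\<bar> < \<epsilon> / 3"
    using order_tendstoD(2)[OF tendsto_rabs_zero[OF e(1)], of "\<epsilon>/3"] \<epsilon> by auto
  moreover have "\<forall>\<^sub>F x::real in at_right 0. x > 0" by real_asymp
  ultimately show "\<forall>\<^sub>F x in at_right 0. dist (log_partition_excess x) (- ln (2 * pi) / 2) < \<epsilon>"
  proof eventually_elim
    case (elim x)
    with e(2)[of x] n show ?case unfolding dist_real_def by linarith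
  qed
qed

section \<open>Partitions with bounded parts\<close>

text \<open>Partitions of n with parts at most M: either no part equals M+1, or one such part is
  removed. Under conjugation these are the partitions with at most M rows, the form in which weights
  present them.\<close>

fun bounded_partitions :: "nat \<Rightarrow> nat \<Rightarrow> nat" where
  "bounded_partitions 0 n = (if n = 0 then 1 else 0)"
| "bounded_partitions (Suc M) n =
     bounded_partitions M n + (if Suc M \<le> n then bounded_partitions (Suc M) (n - Suc M) else 0)"

declare bounded_partitions.simps(2) [simp del]

lemma bounded_partitions_Suc_less: "n < Suc M \<Longrightarrow> bounded_partitions (Suc M) n = bounded_partitions M n"
  by (subst bounded_partitions.simps(2)) simp

lemma bounded_partitions_Suc_ge:
  "Suc M \<le> n \<Longrightarrow> bounded_partitions (Suc M) n = bounded_partitions M n + bounded_partitions (Suc M) (n - Suc M)"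
  by (subst bounded_partitions.simps(2)) simp

definition partitions :: "nat \<Rightarrow> nat" where
  "partitions n = bounded_partitions n n"

lemma bounded_partitions_eq: "n \<le> M \<Longrightarrow> bounded_partitions M n = partitions n"
proof (induction M)
  case (Suc M)
  then show ?case by (cases "n = Suc M") (auto simp: partitions_def bounded_partitions_Suc_less)
qed (auto simp: partitions_def)

lemma bounded_partitions_mono: "M \<le> M' \<Longrightarrow> bounded_partitions M n \<le> bounded_partitions M' n"
proof (induction M' rule: dec_induct)
  case (step M')
  then show ?case by (subst bounded_partitions.simps(2)) simp
qed simp

lemma bounded_partitions_le: "bounded_partitions M n \<le> partitions n"
  using bounded_partitions_mono[of M "max M n" n] bounded_partitions_eq[of n "max M n"] by simp

lemma sums_shift:
  fixes f :: "nat \<Rightarrow> 'a::real_normed_vector"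
  assumes "f sums s"
  shows "(\<lambda>n. if k \<le> n then f (n - k) else 0) sums s"
proof -
  have "(\<lambda>n. (if k \<le> n + k then f (n + k - k) else 0)) sums s" using assms by simp
  then show ?thesis by (subst (asm) sums_zero_iff_shift) auto
qed

text \<open>Summed up to N, the recursion bounds the partial sum by a constant plus r^(M+1) times
  the same partial sum. As r^(M+1) < 1, the latter is absorbed.\<close>

lemma summable_bounded_partitions:
  fixes r :: real assumes r: "0 \<le> r" "r < 1"
  shows "summable (\<lambda>n. bounded_partitions M n * r ^ n)"
proof (induction M)
  case 0
  have "summable (\<lambda>n. (if n = 0 then 1 else 0 :: real))" by (rule summable_single)
  then show ?case by (rule summable_cong[THEN iffD1, rotated]) auto
next
  case (Suc M)
  define a b where "a n = bounded_partitions M n * r ^ n" and "b n = bounded_partitions (Suc M) n * r ^ n" for n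
  have rM: "r ^ Suc M < 1" using r by (simp add: power_less_one_iff del: power_Suc)
  have rec: "b n = a n + (if Suc M \<le> n then r ^ Suc M * b (n - Suc M) else 0)" for n
  proof (cases "Suc M \<le> n")
    case True
    then have "r ^ n = r ^ Suc M * r ^ (n - Suc M)" by (metis le_add_diff_inverse power_add)
    with True show ?thesis by (simp add: a_def b_def bounded_partitions_Suc_ge algebra_simps del: power_Suc)
  qed (auto simp: a_def b_def bounded_partitions_Suc_less)
  have b0: "b n \<ge> 0" for n using r by (simp add: b_def)
  have "(\<Sum>n<N. b n) \<le> suminf a / (1 - r ^ Suc M)" for N
  proof -
    have "(\<Sum>n<N. if Suc M \<le> n then r ^ Suc M * b (n - Suc M) else 0) = (\<Sum>n\<in>{n. n < N \<and> Suc M \<le> n}. r ^ Suc M * b (n - Suc M))"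
      by (subst sum.inter_filter[symmetric]) (auto intro!: sum.cong)
    also have "\<dots> = (\<Sum>n<N - Suc M. r ^ Suc M * b n)"
      by (rule sum.reindex_bij_witness[of _ "\<lambda>n. n + Suc M" "\<lambda>n. n - Suc M"]) auto
    also have "\<dots> \<le> (\<Sum>n<N. r ^ Suc M * b n)" using b0 r by (intro sum_mono2) auto
    finally have "(\<Sum>n<N. b n) \<le> (\<Sum>n<N. a n) + r ^ Suc M * (\<Sum>n<N. b n)"
      by (subst rec) (simp add: sum.distrib sum_distrib_left del: power_Suc)
    also have "(\<Sum>n<N. a n) \<le> suminf a"
      using Suc r by (intro sum_le_suminf) (auto simp: a_def)
    finally show ?thesis using rM by (simp add: field_simps del: power_Suc)
  qed
  then have "summable b" using b0 by (intro summableI_nonneg_bounded) auto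
  then show ?case by (simp only: b_def[abs_def])
qed

text \<open>The recursion becomes B' = B + w^(M+1) B' for the generating functions B and B' of M and
  M+1. It can be solved for B' because convergence is already known.\<close>

lemma bounded_partitions_sums:
  fixes w :: complex assumes "norm w < 1"
  shows "(\<lambda>n. of_nat (bounded_partitions M n) * w ^ n) sums (\<Prod>k=1..M. 1 / (1 - w ^ k))"
proof (induction M)
  case 0
  have "(\<lambda>n. of_nat (bounded_partitions 0 n) * w ^ n) = (\<lambda>n. if n = 0 then 1 else 0)" by auto
  then show ?case using sums_single[of 0 "\<lambda>_. 1::complex"] by simp
next
  case (Suc M)
  define b where "b n = of_nat (bounded_partitions (Suc M) n) * w ^ n" for n
  have "summable (\<lambda>n. norm (b n))"
    using summable_bounded_partitions[of "norm w" "Suc M"] assms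
    by (simp add: b_def norm_mult norm_power)
  then have "summable b" by (rule summable_norm_cancel)
  then have S: "b sums suminf b" by (rule summable_sums)
  have "(\<lambda>n. of_nat (bounded_partitions M n) * w ^ n + w ^ Suc M * (if Suc M \<le> n then b (n - Suc M) else 0))
     sums ((\<Prod>k=1..M. 1 / (1 - w ^ k)) + w ^ Suc M * suminf b)"
    by (intro sums_add Suc sums_mult sums_shift S)
  moreover have "of_nat (bounded_partitions M n) * w ^ n + w ^ Suc M * (if Suc M \<le> n then b (n - Suc M) else 0) = b n" for n
  proof (cases "Suc M \<le> n")
    case True
    then have "w ^ n = w ^ Suc M * w ^ (n - Suc M)" by (metis le_add_diff_inverse power_add)
    with True show ?thesis by (simp add: b_def bounded_partitions_Suc_ge algebra_simps del: power_Suc)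
  qed (auto simp: b_def bounded_partitions_Suc_less)
  ultimately have "b sums ((\<Prod>k=1..M. 1 / (1 - w ^ k)) + w ^ Suc M * suminf b)" by simp
  with S have "suminf b = (\<Prod>k=1..M. 1 / (1 - w ^ k)) + w ^ Suc M * suminf b" by (rule sums_unique2)
  then have "(\<Prod>k=1..M. 1 / (1 - w ^ k)) = suminf b * (1 - w ^ Suc M)" by (simp add: algebra_simps)
  then have "suminf b = (\<Prod>k=1..Suc M. 1 / (1 - w ^ k))"
    using one_minus_power_nz[OF assms, of M] by (simp del: power_Suc)
  with S show ?case by (simp only: b_def[symmetric])
qed

lemma Ln_one_minus_sums:
  assumes "norm (v::complex) < 1"
  shows "(\<lambda>m. v ^ Suc m / of_nat (Suc m)) sums (- Ln (1 - v))"
proof -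
  have "(\<lambda>n. - (- ((- (- v)) ^ n) / of_nat n)) sums (- Ln (1 + (- v)))"
    using assms by (intro sums_minus Ln_series') auto
  then have "(\<lambda>n. v ^ n / of_nat n) sums (- Ln (1 - v))" by simp
  then show ?thesis by (subst sums_Suc_iff) simp
qed

text \<open>For fixed m, the sum of (w^k)^(m+1) over k <= M is geometric in v = w^(m+1) and differs
  from v/(1-v) by v^M times that value. So the sum of the logarithms differs from
  \<open>log_partition w\<close> by at most |w|^M times a convergent series.\<close>

lemma prod_geometric_tendsto:
  fixes w :: complex assumes w: "norm w < 1"
  shows "(\<lambda>M. \<Prod>k=1..M. 1 / (1 - w ^ k)) \<longlonglongrightarrow> exp (log_partition w)"
proof -
  define L where "L M = (\<Sum>k=1..M. - Ln (1 - w ^ k))" for M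
  define t where "t m = log_term w m" for m
  have wk: "norm (w ^ k) < 1" if "k > 0" for k
    using w that by (simp add: norm_power power_less_one_iff)
  have "exp (L M) = (\<Prod>k=1..M. 1 / (1 - w ^ k))" for M
    unfolding L_def exp_sum[OF finite_atLeastAtMost]
  proof (intro prod.cong refl)
    fix k assume "k \<in> {1..M}"
    then have "1 - w ^ k \<noteq> 0" using wk[of k] by auto
    then show "exp (- Ln (1 - w ^ k)) = 1 / (1 - w ^ k)" by (simp add: exp_minus divide_simps)
  qed
  moreover have "L \<longlonglongrightarrow> log_partition w"
  proof (rule LIM_zero_cancel, rule Lim_null_comparison)
    have "norm (L M - log_partition w) \<le> norm w ^ M * (\<Sum>m. norm (t m))" for M
    proof -
      have S1: "(\<lambda>m. \<Sum>k=1..M. (w ^ k) ^ Suc m / of_nat (Suc m)) sums L M"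
        unfolding L_def by (intro sums_sum Ln_one_minus_sums wk) auto
      have S2: "t sums log_partition w"
        unfolding t_def log_partition_def by (intro summable_sums log_partition_summable w)
      have S: "(\<lambda>m. (\<Sum>k=1..M. (w ^ k) ^ Suc m / of_nat (Suc m)) - t m) sums (L M - log_partition w)"
        by (rule sums_diff[OF S1 S2])
      have "norm ((\<Sum>k=1..M. (w ^ k) ^ Suc m / of_nat (Suc m)) - t m) \<le> norm w ^ M * norm (t m)" for m
      proof -
        define v where "v = w ^ Suc m"
        have v: "1 - v \<noteq> 0" "norm v \<le> norm w"
          using one_minus_power_nz[OF w, of m] w power_decreasing[of 1 "Suc m" "norm w"] by (auto simp: v_def norm_mult norm_power)
        have "(\<Sum>k=1..M. (w ^ k) ^ Suc m) = (\<Sum>k=1..M. v ^ k)"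
          by (simp add: v_def power_mult[symmetric] mult.commute del: power_Suc)
        also have "\<dots> = (v - v ^ Suc M) / (1 - v)"
          using sum_gp[of v 1 M] v by (cases "M = 0") auto
        finally have "(\<Sum>k=1..M. (w ^ k) ^ Suc m / of_nat (Suc m)) - t m = - (v ^ M) * t m"
        proof -
          assume *: "(\<Sum>k=1..M. (w ^ k) ^ Suc m) = (v - v ^ Suc M) / (1 - v)"
          define V where "V = v / (1 - v)"
          have "(v - v ^ Suc M) / (1 - v) = V - v ^ M * V" using v by (simp add: V_def divide_simps)
          then show ?thesis
            unfolding sum_divide_distrib[symmetric] t_def v_def[symmetric] V_def[symmetric] *
            by (simp only:) (simp add: diff_divide_distrib)
        qed
        then have "norm ((\<Sum>k=1..M. (w ^ k) ^ Suc m / of_nat (Suc m)) - t m) = norm v ^ M * norm (t m)"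
          by (simp add: norm_mult norm_power)
        also have "\<dots> \<le> norm w ^ M * norm (t m)" using v by (intro mult_right_mono power_mono) auto
        finally show ?thesis .
      qed
      moreover have st: "summable (\<lambda>m. norm (t m))" unfolding t_def by (rule log_partition_abs_summable[OF w])
      ultimately have "norm (L M - log_partition w) \<le> (\<Sum>m. norm w ^ M * norm (t m))"
        unfolding sums_unique[OF S] by (intro norm_suminf_le summable_mult)
      then show ?thesis using suminf_mult[OF st] by simp
    qed
    then show "\<forall>\<^sub>F M in sequentially. norm (L M - log_partition w) \<le> norm w ^ M * (\<Sum>m. norm (t m))" by simp
    show "(\<lambda>M. norm w ^ M * (\<Sum>m. norm (t m))) \<longlonglongrightarrow> 0"
      by (intro tendsto_mult_left_zero LIMSEQ_power_zero) (use w in auto)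
  qed
  ultimately show ?thesis using tendsto_exp[of L] by simp
qed

text \<open>Up to index N the coefficients agree with those for parts at most N, so each partial sum
  is bounded by a finite product. These products converge and are therefore bounded.\<close>

lemma partitions_summable:
  fixes r :: real assumes r: "0 \<le> r" "r < 1"
  shows "summable (\<lambda>n. partitions n * r ^ n)"
proof -
  have n: "norm (complex_of_real r) < 1" using r by auto
  have "Bseq (\<lambda>M. \<Prod>k=1..M. 1 / (1 - complex_of_real r ^ k))"
    using prod_geometric_tendsto[OF n] by (intro convergent_imp_Bseq) (auto simp: convergent_def)
  then obtain B where B: "\<And>M. norm (\<Prod>k=1..M. 1 / (1 - complex_of_real r ^ k)) \<le> B" by (auto simp: Bseq_def)
  have "(\<Sum>n<N. partitions n * r ^ n) \<le> B" for N
  proof -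
    have s: "summable (\<lambda>n. bounded_partitions N n * r ^ n)" by (rule summable_bounded_partitions[OF r])
    have "(\<Sum>n<N. partitions n * r ^ n) = (\<Sum>n<N. bounded_partitions N n * r ^ n)"
      by (intro sum.cong) (auto simp: bounded_partitions_eq)
    also have "\<dots> \<le> (\<Sum>n. bounded_partitions N n * r ^ n)"
      using r by (intro sum_le_suminf s) auto
    also have "\<dots> \<le> norm (complex_of_real (\<Sum>n. bounded_partitions N n * r ^ n))" by simp
    also have "complex_of_real (\<Sum>n. bounded_partitions N n * r ^ n) = (\<Prod>k=1..N. 1 / (1 - complex_of_real r ^ k))"
      using bounded_partitions_sums[OF n, of N] sums_of_real[OF summable_sums[OF s], where 'a = complex] by (simp add: sums_unique2)
    finally show ?thesis using B[of N] by linarith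
  qed
  then show ?thesis using r by (intro summableI_nonneg_bounded) auto
qed

text \<open>Passage to the limit in the bound M on the parts, dominated by the series with
  coefficients \<open>partitions n\<close>.\<close>

lemma partitions_sums:
  fixes w :: complex assumes w: "norm w < 1"
  shows "(\<lambda>n. of_nat (partitions n) * w ^ n) sums exp (log_partition w)"
proof -
  have s: "summable (\<lambda>n. partitions n * norm w ^ n)" using w by (intro partitions_summable) auto
  have "(\<lambda>M. \<Sum>n. of_nat (bounded_partitions M n) * w ^ n) \<longlonglongrightarrow> (\<Sum>n. of_nat (partitions n) * w ^ n)"
  proof (rule tannerys_theorem[where M = "\<lambda>n. partitions n * norm w ^ n" , THEN conjunct2, THEN conjunct2])
    show "\<forall>\<^sub>F (n, M) in at_top \<times>\<^sub>F sequentially. norm (of_nat (bounded_partitions M n) * w ^ n) \<le> partitions n * norm w ^ n"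
      by (auto simp: norm_mult norm_power intro!: always_eventually mult_right_mono bounded_partitions_le)
    show "((\<lambda>M. of_nat (bounded_partitions M n) * w ^ n) \<longlongrightarrow> of_nat (partitions n) * w ^ n) sequentially" for n
      by (rule tendsto_eventually, rule eventually_mono[OF eventually_ge_at_top[of n]]) (simp add: bounded_partitions_eq)
  qed (use s in auto)
  moreover have "(\<Sum>n. of_nat (bounded_partitions M n) * w ^ n) = (\<Prod>k=1..M. 1 / (1 - w ^ k))" for M
    using bounded_partitions_sums[OF w, of M] by (simp add: sums_iff)
  ultimately have "(\<lambda>M. \<Prod>k=1..M. 1 / (1 - w ^ k)) \<longlonglongrightarrow> (\<Sum>n. of_nat (partitions n) * w ^ n)" by simp
  then have "(\<Sum>n. of_nat (partitions n) * w ^ n) = exp (log_partition w)"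
    using prod_geometric_tendsto[OF w] LIMSEQ_unique by blast
  moreover have "summable (\<lambda>n. of_nat (partitions n) * w ^ n)"
    by (rule summable_norm_cancel) (use s in \<open>simp add: norm_mult norm_power\<close>)
  ultimately show ?thesis by (simp add: sums_iff)
qed

section \<open>The circle method\<close>

text \<open>Two regimes. If x u^2 <= 1, the exponent is at least d u^2 and e^(-t) <= 1/(1+t)
  suffices. Otherwise it is at least d/x, so the exponential is O(x^3), and the constraint x^3 u^2
  <= pi^2 of the circle turns this into O(1/u^2); hence the cubic term of the exponential series. C
  is the sum of the two constants.\<close>

lemma exp_minus_le_lorentzian:
  obtains C :: real where "C > 0"
    "\<And>x u. 0 < x \<Longrightarrow> x \<le> 1 \<Longrightarrow> \<bar>x * sqrt x * u\<bar> \<le> pi \<Longrightarrow>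
       exp (- (2 / pi\<^sup>2 * u\<^sup>2 / (2 * (1 + 2 / pi\<^sup>2 * x * u\<^sup>2)))) \<le> C / (1 + u\<^sup>2)"
proof -
  define c :: real where "c = 2 / pi\<^sup>2"
  have c0: "c > 0" by (simp add: c_def)
  define d where "d = c / (2 * (1 + c))"
  have d0: "d > 0" "d \<le> 1" using c0 by (auto simp: d_def field_simps)
  define C where "C = 1 / d + 12 * pi\<^sup>2 / d ^ 3"
  have C0: "C > 0" using d0 by (simp add: C_def add_pos_nonneg)
  have le: "exp (- (c * u\<^sup>2 / (2 * (1 + c * x * u\<^sup>2)))) \<le> C / (1 + u\<^sup>2)"
    if x: "0 < x" "x \<le> 1" and u: "\<bar>x * sqrt x * u\<bar> \<le> pi" for x u :: real
  proof (cases "x * u\<^sup>2 \<le> 1")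
    case True
    define E where "E = c * u\<^sup>2 / (2 * (1 + c * x * u\<^sup>2))"
    have "c * (x * u\<^sup>2) \<le> c * 1" using True c0 by (intro mult_left_mono) auto
    then have "c * u\<^sup>2 / (2 * (1 + c)) \<le> E"
      unfolding E_def using c0 x by (intro divide_left_mono mult_pos_pos add_pos_nonneg) (auto simp: mult.assoc)
    then have E: "d * u\<^sup>2 \<le> E" by (simp add: d_def)
    have "0 < 1 + d * u\<^sup>2" using d0 by (simp add: add_pos_nonneg)
    moreover have "1 + d * u\<^sup>2 \<le> exp E" using E exp_ge_add_one_self[of E] by linarith
    ultimately have "exp (- E) \<le> 1 / (1 + d * u\<^sup>2)" by (simp add: exp_minus field_simps)
    also have "\<dots> \<le> 1 / (d * (1 + u\<^sup>2))"
      using d0 by (intro divide_left_mono mult_pos_pos add_pos_nonneg) (auto simp: algebra_simps)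
    also have "\<dots> = 1 / d / (1 + u\<^sup>2)" by simp
    also have "\<dots> \<le> C / (1 + u\<^sup>2)"
      using d0 by (intro divide_right_mono) (auto simp: C_def)
    finally show ?thesis by (simp add: E_def)
  next
    case False
    define E where "E = c * u\<^sup>2 / (2 * (1 + c * x * u\<^sup>2))"
    have u1: "u\<^sup>2 \<ge> 1"
      using False x mult_right_mono[of x 1 "u\<^sup>2"] by auto
    have "d / x = c * u\<^sup>2 / (2 * (x * u\<^sup>2 + c * x * u\<^sup>2))"
    proof -
      have "c * u\<^sup>2 / (2 * (x * u\<^sup>2 + c * x * u\<^sup>2)) = c * u\<^sup>2 / (2 * (1 + c) * x * u\<^sup>2)"
        by (simp add: algebra_simps)
      also have "\<dots> = c / (2 * (1 + c) * x)" using u1 by (cases "u = 0") auto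
      finally show ?thesis by (simp add: d_def)
    qed
    also have "\<dots> \<le> E"
      unfolding E_def using False c0 x u1 by (intro divide_left_mono mult_pos_pos add_pos_nonneg) auto
    finally have E: "d / x \<le> E" .
    have "(d / x) ^ 3 / 6 \<le> E ^ 3 / 6" using E d0 x by (intro divide_right_mono power_mono) auto
    also have "E ^ 3 / 6 \<le> exp E"
    proof -
      have E0: "0 \<le> E" using E d0 x by (meson divide_nonneg_pos less_imp_le order_trans)
      have "(\<Sum>n<4. E ^ n / fact n) \<le> exp E"
        unfolding exp_def using summable_exp[of E] E0
        by (simp add: divide_inverse mult.commute) (intro sum_le_suminf, auto)
      moreover have "E ^ 3 / 6 \<le> (\<Sum>n<4. E ^ n / fact n)"
        using E0 by (simp add: eval_nat_numeral)
      ultimately show ?thesis by linarith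
    qed
    finally have "exp (- E) \<le> 6 * x ^ 3 / d ^ 3"
      using d0 x by (simp add: exp_minus field_simps)
    also have "\<dots> \<le> 6 * (pi\<^sup>2 / u\<^sup>2) / d ^ 3"
    proof -
      have "(x * sqrt x * u)\<^sup>2 \<le> pi\<^sup>2" using u by (simp add: abs_le_square_iff[symmetric])
      also have "(x * sqrt x * u)\<^sup>2 = x ^ 3 * u\<^sup>2"
        using x by (simp add: power_mult_distrib power_numeral_reduce)
      finally have "x ^ 3 * u\<^sup>2 \<le> pi\<^sup>2" .
      moreover have "u\<^sup>2 > 0" using u1 by linarith
      ultimately have "x ^ 3 \<le> pi\<^sup>2 / u\<^sup>2" by (simp add: pos_le_divide_eq)
      then show ?thesis using d0 by (intro divide_right_mono mult_left_mono) auto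
    qed
    also have "\<dots> \<le> C / (1 + u\<^sup>2)"
    proof -
      have "u\<^sup>2 > 0" using u1 by linarith
      then have "1 / u\<^sup>2 \<le> 2 / (1 + u\<^sup>2)" using u1 by (simp add: field_simps)
      then have "6 * pi\<^sup>2 / d ^ 3 * (1 / u\<^sup>2) \<le> 6 * pi\<^sup>2 / d ^ 3 * (2 / (1 + u\<^sup>2))"
        using d0 by (intro mult_left_mono) auto
      also have "\<dots> = 12 * pi\<^sup>2 / d ^ 3 / (1 + u\<^sup>2)" by simp
      also have "\<dots> \<le> C / (1 + u\<^sup>2)" using d0 by (intro divide_right_mono) (auto simp: C_def)
      finally show ?thesis by (simp add: mult_ac)
    qed
    finally show ?thesis by (simp add: E_def)
  qed
  show ?thesis
    by (rule that[OF C0 le[unfolded c_def]])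
qed

text \<open>The bound of the m = 1 term is (1 - A^2/(A^2+D))/(2A) after 1 + |w| is lowered to 1. It
  decreases in A and increases in D, so A = 1 - e^(-x) may be replaced by x, and D by its lower
  bound from \<open>one_minus_cos_ge\<close>. The condition x <= 1/2 ensures 2 e^(-x) >= 1.\<close>

lemma Re_log_partition_decay:
  assumes x: "0 < x" "x \<le> 1 / 2" and y: "\<bar>y\<bar> \<le> pi"
  shows "Re (log_partition (exp (- Complex x y))) - log_partition (exp (- x))
           \<le> - (2 / pi\<^sup>2 * y\<^sup>2 / (2 * x * (x\<^sup>2 + 2 / pi\<^sup>2 * y\<^sup>2)))"
proof -
  define w where "w = exp (- Complex x y)"
  have nw: "norm w = exp (- x)" by (simp add: w_def)
  then have nw1: "norm w < 1" using x by simp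
  define A where "A = 1 - norm w"
  define D where "D = 2 * (norm w - Re w)"
  define D0 where "D0 = 2 / pi\<^sup>2 * y\<^sup>2"
  have A: "0 < A" "A \<le> x" using nw nw1 exp_ge_add_one_self[of "-x"] by (auto simp: A_def)
  have "Re w = exp (- x) * cos y" by (simp add: w_def Re_exp)
  then have D: "D = 2 * exp (- x) * (1 - cos y)" by (simp add: D_def nw algebra_simps)
  have "exp (- x) \<ge> 1 / 2" using exp_ge_add_one_self[of "-x"] x by linarith
  then have "D \<ge> 1 * (1 - cos y)" unfolding D by (intro mult_right_mono) auto
  also have "1 * (1 - cos y) \<ge> D0" using one_minus_cos_ge[OF y] by (simp add: D0_def)
  finally have DD: "D \<ge> D0" .
  have D00: "D0 \<ge> 0" by (simp add: D0_def)
  have "Re (log_partition w) - log_partition (norm w) \<le> Re (w / (1 - w)) - norm w / (1 - norm w)"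
    by (rule Re_log_partition_le[OF nw1])
  also have "\<dots> = - D * (1 + norm w) / (2 * A * (A\<^sup>2 + D))"
    unfolding A_def D_def by (rule Re_geometric_eq[OF nw1])
  also have "\<dots> \<le> - (D0 / (2 * x * (x\<^sup>2 + D0)))"
  proof -
    have x2: "x\<^sup>2 > 0" using x by simp
    have "D0 / (2 * x * (x\<^sup>2 + D0)) = (1 - x\<^sup>2 / (x\<^sup>2 + D0)) / (2 * x)"
    proof -
      have "x\<^sup>2 + D0 > 0" using x2 D00 by linarith
      then have "1 - x\<^sup>2 / (x\<^sup>2 + D0) = D0 / (x\<^sup>2 + D0)" by (simp add: field_simps)
      then show ?thesis by simp
    qed
    also have "\<dots> \<le> (1 - A\<^sup>2 / (A\<^sup>2 + D)) / (2 * A)"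
    proof (rule frac_le)
      have "A\<^sup>2 * (x\<^sup>2 + D0) \<le> x\<^sup>2 * (A\<^sup>2 + D)"
      proof -
        have "A\<^sup>2 * D0 \<le> x\<^sup>2 * D" using A DD D00 by (intro mult_mono power_mono) auto
        then show ?thesis by (simp add: algebra_simps)
      qed
      moreover have "A\<^sup>2 + D > 0" "x\<^sup>2 + D0 > 0" using A D00 DD x2 by (auto intro: add_pos_nonneg)
      ultimately have "A\<^sup>2 / (A\<^sup>2 + D) \<le> x\<^sup>2 / (x\<^sup>2 + D0)" by (simp add: field_simps)
      then show "1 - x\<^sup>2 / (x\<^sup>2 + D0) \<le> 1 - A\<^sup>2 / (A\<^sup>2 + D)" by linarith
      have "A\<^sup>2 \<le> A\<^sup>2 + D" "0 < A\<^sup>2 + D" using A D00 DD by (auto intro: add_pos_nonneg)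
      then show "0 \<le> 1 - A\<^sup>2 / (A\<^sup>2 + D)" by simp
    qed (use A x in auto)
    also have "\<dots> = D / (2 * A * (A\<^sup>2 + D))"
    proof -
      have "A\<^sup>2 + D > 0" using A D00 DD by (auto intro: add_pos_nonneg)
      then show ?thesis using A by (simp add: field_simps)
    qed
    also have "\<dots> \<le> D * (1 + norm w) / (2 * A * (A\<^sup>2 + D))"
      using A D00 DD by (intro divide_right_mono mult_nonneg_nonneg mult_left_mono[of 1 "1 + norm w" D, simplified]) auto
    finally show ?thesis by simp
  qed
  also have "norm w = exp (- x)" by (rule nw)
  finally show ?thesis by (simp add: D0_def w_def)
qed

text \<open>The term of second order in y of pi^2/(6z) is -pi^2 y^2/(6 x^3). So the peak has width
  x^(3/2), and it has a fixed shape in the variable u with y = x^(3/2) u.\<close>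

abbreviation peak :: "real \<Rightarrow> real \<Rightarrow> complex" where
  "peak x u \<equiv> exp (- Complex x (x * sqrt x * u))"

lemma log_partition_lorentzian_bound:
  obtains C :: real where "C > 0"
    "\<And>x u. 0 < x \<Longrightarrow> x \<le> 1 / 2 \<Longrightarrow> \<bar>x * sqrt x * u\<bar> \<le> pi \<Longrightarrow>
       exp (Re (log_partition (peak x u)) - log_partition (exp (- x))) \<le> C / (1 + u\<^sup>2)"
proof -
  obtain C :: real where C: "C > 0" "\<And>x u. 0 < x \<Longrightarrow> x \<le> 1 \<Longrightarrow> \<bar>x * sqrt x * u\<bar> \<le> pi \<Longrightarrow>
       exp (- (2 / pi\<^sup>2 * u\<^sup>2 / (2 * (1 + 2 / pi\<^sup>2 * x * u\<^sup>2)))) \<le> C / (1 + u\<^sup>2)"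
    using exp_minus_le_lorentzian by metis
  have "exp (Re (log_partition (peak x u)) - log_partition (exp (- x))) \<le> C / (1 + u\<^sup>2)"
    if x: "0 < x" "x \<le> 1 / 2" and u: "\<bar>x * sqrt x * u\<bar> \<le> pi" for x u :: real
  proof -
    define c where "c = 2 / pi\<^sup>2"
    have c: "c > 0" by (simp add: c_def)
    have y2: "(x * sqrt x * u)\<^sup>2 = x ^ 3 * u\<^sup>2"
      using x by (simp add: power_mult_distrib power_numeral_reduce)
    have p: "1 + c * x * u\<^sup>2 > 0" using c x by (intro add_pos_nonneg) auto
    have "c * (x ^ 3 * u\<^sup>2) / (2 * x * (x\<^sup>2 + c * (x ^ 3 * u\<^sup>2))) = x ^ 3 * (c * u\<^sup>2) / (x ^ 3 * (2 * (1 + c * x * u\<^sup>2)))"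
      by (simp add: algebra_simps power_numeral_reduce)
    also have "\<dots> = c * u\<^sup>2 / (2 * (1 + c * x * u\<^sup>2))" using x by simp
    finally have "Re (log_partition (peak x u)) - log_partition (exp (- x))
        \<le> - (c * u\<^sup>2 / (2 * (1 + c * x * u\<^sup>2)))"
      using Re_log_partition_decay[OF x u] unfolding y2 c_def[symmetric] by simp
    then have "exp (Re (log_partition (peak x u)) - log_partition (exp (- x)))
       \<le> exp (- (c * u\<^sup>2 / (2 * (1 + c * x * u\<^sup>2))))" by simp
    also have "\<dots> \<le> C / (1 + u\<^sup>2)" unfolding c_def using C(2)[of x u] x u by simp
    finally show ?thesis .
  qed
  with that C(1) show ?thesis by blast
qed

lemma gaussian_integral:
  fixes c :: real assumes "c > 0"
  shows "(\<integral>u. exp (- (c * u\<^sup>2)) \<partial>lborel) = sqrt (pi / c)"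
proof -
  define \<sigma> where "\<sigma> = sqrt (1 / (2 * c))"
  have \<sigma>: "\<sigma> > 0" "\<sigma>\<^sup>2 = 1 / (2 * c)" using assms by (auto simp: \<sigma>_def)
  have "exp (- (c * u\<^sup>2)) = sqrt (pi / c) * normal_density 0 \<sigma> u" for u
  proof -
    have "- (u - 0)\<^sup>2 / (2 * (1 / (2 * c))) = - (c * u\<^sup>2)" "2 * pi * (1 / (2 * c)) = pi / c" by simp_all
    then show ?thesis unfolding normal_density_def \<sigma>(2) using assms by simp
  qed
  then have "(\<integral>u. exp (- (c * u\<^sup>2)) \<partial>lborel) = (\<integral>u. sqrt (pi / c) * normal_density 0 \<sigma> u \<partial>lborel)" by simp
  also have "\<dots> = sqrt (pi / c) * (\<integral>u. normal_density 0 \<sigma> u \<partial>lborel)" by (rule integral_mult_right_zero)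
  finally show ?thesis using \<sigma> by simp
qed

section \<open>Cauchy's coefficient formula on a circle\<close>

lemma integral_iexp_period:
  "has_bochner_integral lborel (\<lambda>y. indicator {-pi..pi} y *\<^sub>R exp (\<i> * of_int j * of_real y))
     (if j = 0 then of_real (2 * pi) else 0 :: complex)"
proof (cases "j = 0")
  case True
  have "has_bochner_integral lborel (\<lambda>y. indicator {-pi..pi} y *\<^sub>R (1 :: complex)) (of_real pi - of_real (- pi))"
    by (rule has_bochner_integral_FTC_Icc) (auto intro!: derivative_eq_intros)
  then show ?thesis using True by simp
next
  case False
  define F where "F y = exp (\<i> * of_int j * of_real y) / (\<i> * of_int j)" for y :: real
  have "has_bochner_integral lborel (\<lambda>y. indicator {-pi..pi} y *\<^sub>R exp (\<i> * of_int j * of_real y)) (F pi - F (- pi))"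
    by (rule has_bochner_integral_FTC_Icc)
       (use False in \<open>auto simp: F_def intro!: derivative_eq_intros continuous_intros has_vector_derivative_real_field\<close>)
  moreover have "F pi = F (- pi)"
  proof -
    have "exp (\<i> * of_int j * of_real pi) = exp (\<i> * of_int j * of_real (- pi))"
      by (subst exp_eq) (auto intro!: exI[of _ j] simp: algebra_simps)
    then show ?thesis by (simp add: F_def)
  qed
  ultimately show ?thesis using False by simp
qed

text \<open>Orthogonality of the exponentials, integrated term by term. Nonnegative coefficients
  make the absolute convergence on the circle that of the series at its real point.\<close>

lemma cauchy_coefficient:
  fixes a :: "nat \<Rightarrow> real" and x :: real
  assumes a: "\<And>n. a n \<ge> 0" and s: "summable (\<lambda>n. a n * exp (- x) ^ n)"
  shows "has_bochner_integral lborel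
     (\<lambda>y. indicator {-pi..pi} y *\<^sub>R ((\<Sum>m. of_real (a m) * exp (- Complex x y) ^ m) * exp (\<i> * of_real (real n * y))))
     (complex_of_real (2 * pi * a n * exp (- (real n * x))))"
proof -
  define f where "f m y = indicator {-pi..pi} y *\<^sub>R (of_real (a m) * exp (- Complex x y) ^ m * exp (\<i> * of_real (real n * y)))" for m y
  have f_eq: "f m y = of_real (a m * exp (- x) ^ m) * (indicator {-pi..pi} y *\<^sub>R exp (\<i> * of_int (int n - int m) * of_real y))" for m y
  proof -
    have "exp (- Complex x y) ^ m * exp (\<i> * of_real (real n * y)) = exp (of_nat m * (- Complex x y) + \<i> * of_real (real n * y))"
      by (simp only: exp_add exp_of_nat_mult)
    also have "of_nat m * (- Complex x y) + \<i> * of_real (real n * y) = of_real (real m * (- x)) + \<i> * of_int (int n - int m) * of_real y"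
      by (simp add: complex_eq_iff algebra_simps)
    also have "exp \<dots> = of_real (exp (- x) ^ m) * exp (\<i> * of_int (int n - int m) * of_real y)"
      unfolding exp_add exp_of_real[symmetric] by (simp only: exp_of_nat_mult exp_of_real)
    finally show ?thesis by (simp add: f_def mult.assoc scaleR_conv_of_real)
  qed
  have norm_f: "norm (f m y) = a m * exp (- x) ^ m * indicator {-pi..pi} y" for m y
    unfolding f_eq using a[of m] by (simp add: norm_mult norm_power norm_exp_eq_Re)
  have I: "has_bochner_integral lborel (f m) (of_real (a m * exp (- x) ^ m) * (if int n - int m = 0 then of_real (2 * pi) else 0))" for m
    unfolding f_eq[abs_def] by (intro has_bochner_integral_mult_right integral_iexp_period)
  have int: "integrable lborel (f m)" for m using I by (rule integrable.intros)
  have nint: "(\<integral>y. norm (f m y) \<partial>lborel) = a m * exp (- x) ^ m * (2 * pi)" for m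
    unfolding norm_f by simp
  have AE: "AE y in lborel. summable (\<lambda>m. norm (f m y))"
    unfolding norm_f by (intro AE_I2 summable_mult2 s)
  have sn: "summable (\<lambda>m. \<integral>y. norm (f m y) \<partial>lborel)"
    unfolding nint by (intro summable_mult2 s)
  have "(\<lambda>m. integral\<^sup>L lborel (f m)) = (\<lambda>m. if m = n then complex_of_real (2 * pi * a n * exp (- (real n * x))) else 0)"
  proof (rule ext)
    fix m
    show "integral\<^sup>L lborel (f m) = (if m = n then complex_of_real (2 * pi * a n * exp (- (real n * x))) else 0)"
      using has_bochner_integral_integral_eq[OF I[of m]] by (simp add: exp_of_nat_mult[symmetric] mult.commute)
  qed
  then have "(\<lambda>m. if m = n then complex_of_real (2 * pi * a n * exp (- (real n * x))) else 0) sums (\<integral>y. (\<Sum>m. f m y) \<partial>lborel)"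
    using sums_integral[OF int AE sn] by (simp only:)
  then have "(\<integral>y. (\<Sum>m. f m y) \<partial>lborel) = complex_of_real (2 * pi * a n * exp (- (real n * x)))"
    using sums_single[of n "\<lambda>_. complex_of_real (2 * pi * a n * exp (- (real n * x)))"] sums_unique2 by blast
  moreover have "integrable lborel (\<lambda>y. \<Sum>m. f m y)" by (rule integrable_suminf[OF int AE sn])
  moreover have "(\<Sum>m. f m y) = indicator {-pi..pi} y *\<^sub>R ((\<Sum>m. of_real (a m) * exp (- Complex x y) ^ m) * exp (\<i> * of_real (real n * y)))" for y
  proof -
    have "summable (\<lambda>m. of_real (a m) * exp (- Complex x y) ^ m)"
      by (rule summable_norm_cancel) (use s a in \<open>simp add: norm_mult norm_power\<close>)
    then show ?thesis
      unfolding f_def by (subst suminf_mult2) (auto simp: summable_mult2 suminf_scaleR_right)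
  qed
  ultimately show ?thesis by (simp add: has_bochner_integral_iff)
qed

text \<open>The second factor removes the phase linear in y. It equals e^(iny) exactly when n = k
  pi^2/(6 x^2), the saddle point equation.\<close>

lemma log_partition_ratio_tendsto:
  fixes u :: real and k :: nat
  shows "((\<lambda>x. exp (of_nat k * (log_partition (peak x u) - of_real (log_partition (exp (- x)))))
            * exp (\<i> * of_real (real k * pi\<^sup>2 / (6 * x\<^sup>2) * (x * sqrt x * u))))
         \<longlongrightarrow> of_real (exp (- (real k * pi\<^sup>2 / 6 * u\<^sup>2)))) (at_right 0)"
proof -
  define y where "y x = x * sqrt x * u" for x
  define z where "z x = Complex x (y x)" for x
  define \<delta> where "\<delta> x = log_partition (exp (- z x)) - log_partition (exp (- of_real x))
           - of_real (pi\<^sup>2 / 6) * (1 / z x - 1 / of_real x)" for x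
  have pos: "\<forall>\<^sub>F x::real in at_right 0. x > 0" by real_asymp
  have "((\<lambda>x::real. sqrt x * \<bar>u\<bar>) \<longlongrightarrow> 0) (at_right 0)" by real_asymp
  then have small: "\<forall>\<^sub>F x::real in at_right 0. sqrt x * \<bar>u\<bar> < 1" by (rule order_tendstoD) auto
  have "\<forall>\<^sub>F x in at_right 0. norm (\<delta> x) \<le> 500 * (sqrt x * \<bar>u\<bar>)"
    using pos small
  proof eventually_elim
    case (elim x)
    have "\<bar>y x\<bar> = x * (sqrt x * \<bar>u\<bar>)" using elim by (simp add: y_def abs_mult)
    moreover have "x * (sqrt x * \<bar>u\<bar>) \<le> x * 1" using elim by (intro mult_left_mono) auto
    ultimately have "norm (\<delta> x) \<le> 500 * \<bar>y x\<bar> / x"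
      unfolding \<delta>_def z_def using elim by (intro log_partition_expansion) auto
    with \<open>\<bar>y x\<bar> = _\<close> elim show ?case by simp
  qed
  moreover have "((\<lambda>x::real. 500 * (sqrt x * \<bar>u\<bar>)) \<longlongrightarrow> 0) (at_right 0)" by real_asymp
  ultimately have \<delta>: "(\<delta> \<longlongrightarrow> 0) (at_right 0)" by (rule Lim_null_comparison)
  have s0: "((\<lambda>x. complex_of_real (sqrt x * u)) \<longlongrightarrow> of_real 0) (at_right 0)"
    by (intro tendsto_of_real) real_asymp
  have "((\<lambda>x. of_nat k * (of_real (pi\<^sup>2 / 6) * (- (of_real u)\<^sup>2 / (1 + \<i> * of_real (sqrt x * u))) + \<delta> x))
      \<longlongrightarrow> of_nat k * (of_real (pi\<^sup>2 / 6) * (- (of_real u)\<^sup>2 / (1 + \<i> * of_real 0)) + 0)) (at_right 0)"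
    by (intro tendsto_intros s0 \<delta>) auto
  then have T: "((\<lambda>x. exp (of_nat k * (of_real (pi\<^sup>2 / 6) * (- (of_real u)\<^sup>2 / (1 + \<i> * of_real (sqrt x * u))) + \<delta> x)))
      \<longlongrightarrow> exp (of_nat k * (of_real (pi\<^sup>2 / 6) * (- (of_real u)\<^sup>2 / (1 + \<i> * of_real 0)) + 0))) (at_right 0)"
    by (rule tendsto_exp)
  have eq: "exp (of_nat k * (of_real (pi\<^sup>2 / 6) * (- (complex_of_real u)\<^sup>2 / (1 + \<i> * of_real 0)) + 0)) = of_real (exp (- (real k * pi\<^sup>2 / 6 * u\<^sup>2)))"
    by (simp add: exp_of_real[symmetric] mult.assoc)
  have ev: "\<forall>\<^sub>F x in at_right 0. exp (of_nat k * (of_real (pi\<^sup>2 / 6) * (- (of_real u)\<^sup>2 / (1 + \<i> * of_real (sqrt x * u))) + \<delta> x))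
     = exp (of_nat k * (log_partition (exp (- z x)) - of_real (log_partition (exp (- x)))))
            * exp (\<i> * of_real (real k * pi\<^sup>2 / (6 * x\<^sup>2) * y x))"
    using pos
  proof eventually_elim
    case (elim x)
    define s where "s = complex_of_real (sqrt x)"
    have s2: "complex_of_real x = s\<^sup>2" using elim by (simp add: s_def of_real_power[symmetric] del: of_real_power)
    have s0: "s \<noteq> 0" using elim by (simp add: s_def)
    have zx: "z x = s\<^sup>2 * (1 + \<i> * (s * of_real u))"
      using elim by (simp add: z_def y_def s2[symmetric] complex_eq_iff s_def)
    have "Re (1 + \<i> * (s * of_real u)) = 1" by (simp add: s_def)
    then have nz: "1 + \<i> * (s * of_real u) \<noteq> 0" by (metis zero_complex.sel(1) zero_neq_one)
    define q where "q = s * of_real u"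
    have lp: "complex_of_real (log_partition (exp (- x))) = log_partition (exp (- of_real x))"
      using elim log_partition_of_real[of "exp (- x)"] by (simp add: exp_of_real[symmetric])
    \<comment> \<open>An exact identity: for z = x(1+iq) with q = sqrt x u, the difference 1/z - 1/x
      minus its linear part is -u^2/(1+iq), which tends to -u^2.\<close>
    have key: "- (of_real u)\<^sup>2 / (1 + \<i> * q) = 1 / z x - 1 / s\<^sup>2 + \<i> * q / s\<^sup>2"
    proof -
      have "1 / z x - 1 / s\<^sup>2 + \<i> * q / s\<^sup>2 = (1 / (1 + \<i> * q) - 1 + \<i> * q) / s\<^sup>2"
        unfolding zx q_def[symmetric] by (simp add: add_divide_distrib diff_divide_distrib mult.commute)
      also have "1 / (1 + \<i> * q) - 1 + \<i> * q = (\<i> * q)\<^sup>2 / (1 + \<i> * q)"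
        using nz by (simp add: q_def field_simps power2_eq_square)
      also have "(\<i> * q)\<^sup>2 / (1 + \<i> * q) / s\<^sup>2 = - (of_real u)\<^sup>2 / (1 + \<i> * q)"
      proof -
        have "(\<i> * q)\<^sup>2 = - (s\<^sup>2 * (of_real u)\<^sup>2)" by (simp add: q_def power_mult_distrib)
        then show ?thesis using s0 by simp
      qed
      finally show ?thesis by simp
    qed
    have ph: "\<i> * of_real (real k * pi\<^sup>2 / (6 * x\<^sup>2) * y x) = of_nat k * (of_real (pi\<^sup>2 / 6) * (\<i> * q / s\<^sup>2))"
    proof -
      have "real k * pi\<^sup>2 / (6 * x\<^sup>2) * y x = real k * (pi\<^sup>2 / 6 * (sqrt x * u / x))"
        using elim by (simp add: y_def power2_eq_square)
      then show ?thesis by (simp add: q_def s_def s2[symmetric]) (simp add: s_def s2 mult_ac)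
    qed
    have "of_real (sqrt x * u) = q" by (simp add: q_def s_def)
    then have "of_nat k * (of_real (pi\<^sup>2 / 6) * (- (of_real u)\<^sup>2 / (1 + \<i> * of_real (sqrt x * u))) + \<delta> x)
      = of_nat k * (log_partition (exp (- z x)) - of_real (log_partition (exp (- x))))
            + \<i> * of_real (real k * pi\<^sup>2 / (6 * x\<^sup>2) * y x)"
      unfolding ph lp \<delta>_def by (simp only: key s2) (simp add: algebra_simps)
    then show ?case by (simp add: exp_add)
  qed
  from Lim_transform_eventually[OF T ev] show ?thesis unfolding eq z_def y_def .
qed

text \<open>A series that grows only like a power of 1/x varies on the scale x and does not notice
  an angle of order x^(3/2). The phase costs n|y|, which half of the exponential decay turns into
  2|y|/x; the price is H(x/2) instead of H(x), a bounded factor by the power law.\<close>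

lemma powser_ratio_tendsto:
  fixes h :: "nat \<Rightarrow> real" and \<beta> \<kappa> u :: real
  assumes h: "\<And>n. h n \<ge> 0" and s: "\<And>r. 0 \<le> r \<Longrightarrow> r < 1 \<Longrightarrow> summable (\<lambda>n. h n * r ^ n)"
    and lim: "((\<lambda>x. (\<Sum>n. h n * exp (- x) ^ n) * x powr \<beta>) \<longlongrightarrow> \<kappa>) (at_right 0)" and \<kappa>: "\<kappa> > 0"
  shows "((\<lambda>x. (\<Sum>n. of_real (h n) * peak x u ^ n) / of_real (\<Sum>n. h n * exp (- x) ^ n)) \<longlongrightarrow> 1) (at_right 0)"
proof -
  define H where "H x = (\<Sum>n. h n * exp (- x) ^ n)" for x
  define Z where "Z x = (\<Sum>n. of_real (h n) * peak x u ^ n)" for x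
  have sx: "summable (\<lambda>n. h n * exp (- x) ^ n)" if "x > 0" for x using that by (intro s) auto
  have bound: "norm (Z x - of_real (H x)) \<le> 2 * sqrt x * \<bar>u\<bar> * H (x / 2)" if x: "x > 0" for x
  proof -
    define y where "y = x * sqrt x * u"
    define d where "d n = of_real (h n) * (exp (- Complex x y) ^ n - of_real (exp (- x) ^ n))" for n
    have sZ: "summable (\<lambda>n. of_real (h n) * exp (- Complex x y) ^ n)"
      by (rule summable_norm_cancel) (use sx[OF x] h in \<open>simp add: norm_mult norm_power\<close>)
    have "(\<lambda>n. of_real (h n) * exp (- Complex x y) ^ n - of_real (h n * exp (- x) ^ n)) sums (Z x - of_real (H x))"
      unfolding Z_def H_def y_def[symmetric] by (intro sums_diff sums_of_real summable_sums sZ sx x)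
    then have S: "d sums (Z x - of_real (H x))" by (simp add: d_def[abs_def] right_diff_distrib)
    have "norm (d n) \<le> 2 * \<bar>y\<bar> / x * (h n * exp (- (x / 2)) ^ n)" for n
    proof -
      have "exp (- Complex x y) ^ n = exp (of_real (- (real n * x)) + \<i> * of_real (- (real n * y)))"
        unfolding exp_of_nat_mult[symmetric] by (rule arg_cong[of _ _ exp]) (simp add: complex_eq_iff)
      also have "\<dots> = of_real (exp (- x) ^ n) * exp (\<i> * of_real (- (real n * y)))"
        unfolding exp_add exp_of_real by (simp add: exp_of_nat_mult[symmetric])
      finally have "d n = of_real (h n * exp (- x) ^ n) * (exp (\<i> * of_real (- (real n * y))) - 1)"
        by (simp add: d_def algebra_simps)
      then have "norm (d n) = h n * exp (- x) ^ n * norm (exp (\<i> * of_real (- (real n * y))) - 1)"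
        using h[of n] by (simp only: norm_mult norm_of_real) simp
      also have "\<dots> \<le> h n * exp (- x) ^ n * \<bar>- (real n * y)\<bar>"
        using h[of n] iexp_approx1[of "- (real n * y)" 0] by (intro mult_left_mono) auto
      also have "\<dots> = h n * \<bar>y\<bar> * (real n * exp (- x) ^ n)" by (simp add: abs_mult)
      also have "\<dots> \<le> h n * \<bar>y\<bar> * (2 / x * exp (- (x / 2)) ^ n)"
      \<comment> \<open>From t <= e^t at t = nx/2.\<close>
      proof (rule mult_left_mono)
        have "real n * x / 2 * exp (- (real n * x)) \<le> exp (real n * x / 2) * exp (- (real n * x))"
          using exp_ge_add_one_self[of "real n * x / 2"] by (intro mult_right_mono) (linarith, simp)
        also have "\<dots> = exp (- (x / 2)) ^ n" by (simp add: exp_of_nat_mult[symmetric] exp_add[symmetric])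
        finally show "real n * exp (- x) ^ n \<le> 2 / x * exp (- (x / 2)) ^ n"
          using x by (simp add: exp_of_nat_mult[symmetric] field_simps)
      qed (use h in auto)
      finally show ?thesis by (simp add: mult_ac)
    qed
    moreover have s2: "summable (\<lambda>n. h n * exp (- (x / 2)) ^ n)" using x by (intro sx) auto
    ultimately have "norm (Z x - of_real (H x)) \<le> (\<Sum>n. 2 * \<bar>y\<bar> / x * (h n * exp (- (x / 2)) ^ n))"
      unfolding sums_unique[OF S] by (intro norm_suminf_le summable_mult)
    also have "\<dots> = 2 * \<bar>y\<bar> / x * H (x / 2)" unfolding H_def by (rule suminf_mult[OF s2])
    also have "2 * \<bar>y\<bar> / x = 2 * sqrt x * \<bar>u\<bar>" using x by (simp add: y_def abs_mult)
    finally show ?thesis .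
  qed
  have pos: "\<forall>\<^sub>F x::real in at_right 0. x > 0" by real_asymp
  have half: "filterlim (\<lambda>x::real. x / 2) (at_right 0) (at_right 0)" by real_asymp
  have L2: "((\<lambda>x. H (x / 2) * (x / 2) powr \<beta>) \<longlongrightarrow> \<kappa>) (at_right 0)"
    using filterlim_compose[OF lim half] by (simp add: H_def)
  have L: "((\<lambda>x. H x * x powr \<beta>) \<longlongrightarrow> \<kappa>) (at_right 0)" using lim by (simp add: H_def)
  have "((\<lambda>x. 2 * sqrt x * \<bar>u\<bar> * 2 powr \<beta> * ((H (x / 2) * (x / 2) powr \<beta>) / (H x * x powr \<beta>))) \<longlongrightarrow> 2 * 0 * \<bar>u\<bar> * 2 powr \<beta> * (\<kappa> / \<kappa>)) (at_right 0)"
    using \<kappa> by (intro tendsto_intros L L2) (auto, real_asymp)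
  then have T: "((\<lambda>x. 2 * sqrt x * \<bar>u\<bar> * 2 powr \<beta> * ((H (x / 2) * (x / 2) powr \<beta>) / (H x * x powr \<beta>))) \<longlongrightarrow> 0) (at_right 0)" by simp
  have "\<forall>\<^sub>F x in at_right 0. H x * x powr \<beta> > 0" using order_tendstoD(1)[OF L \<kappa>] .
  then have Hpos: "\<forall>\<^sub>F x in at_right 0. H x > 0"
    by eventually_elim (auto simp: zero_less_mult_iff)
  have "\<forall>\<^sub>F x in at_right 0. norm (Z x / of_real (H x) - 1) \<le> 2 * sqrt x * \<bar>u\<bar> * 2 powr \<beta> * ((H (x / 2) * (x / 2) powr \<beta>) / (H x * x powr \<beta>))"
    using pos Hpos
  proof eventually_elim
    case (elim x)
    have "Z x / of_real (H x) - 1 = (Z x - of_real (H x)) / of_real (H x)" using elim by (simp add: field_simps)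
    then have "norm (Z x / of_real (H x) - 1) = norm (Z x - of_real (H x)) / H x" using elim by (simp add: norm_divide)
    also have "\<dots> \<le> 2 * sqrt x * \<bar>u\<bar> * H (x / 2) / H x" using elim by (intro divide_right_mono bound) auto
    also have "\<dots> = 2 * sqrt x * \<bar>u\<bar> * 2 powr \<beta> * ((H (x / 2) * (x / 2) powr \<beta>) / (H x * x powr \<beta>))"
      using elim by (simp add: powr_divide)
    finally show ?case .
  qed
  from Lim_null_comparison[OF this T] have "((\<lambda>x. Z x / of_real (H x)) \<longlongrightarrow> 1) (at_right 0)"
    by (rule LIM_zero_cancel)
  then show ?thesis by (simp add: Z_def H_def)
qed

lemma integrable_lorentzian: "integrable lborel (\<lambda>u::real. C / (1 + u\<^sup>2))"
proof -
  have "integrable lborel (\<lambda>u::real. inverse (1 + u\<^sup>2))"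
    using integrable_inverse_1_plus_square by (simp add: set_integrable_def)
  then show ?thesis by (simp add: divide_inverse)
qed

text \<open>Generating functions P^k times a series of power growth x^(-\<beta>) at w = e^(-x). The
  second factor does not move the saddle point; it only contributes its size there. The three counts
  are instances with k = 1 or 2.\<close>

locale circle_method =
  fixes k :: nat and a h :: "nat \<Rightarrow> real" and \<beta> \<kappa> :: real
  assumes k_pos: "k > 0" and a_nonneg: "\<And>n. a n \<ge> 0" and h_nonneg: "\<And>n. h n \<ge> 0"
    and h_summable: "\<And>r. 0 \<le> r \<Longrightarrow> r < 1 \<Longrightarrow> summable (\<lambda>n. h n * r ^ n)"
    and h_asymp: "((\<lambda>x. (\<Sum>n. h n * exp (- x) ^ n) * x powr \<beta>) \<longlongrightarrow> \<kappa>) (at_right 0)"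
    and \<kappa>_pos: "\<kappa> > 0"
    and a_sums: "\<And>w :: complex. norm w < 1 \<Longrightarrow>
      (\<lambda>n. of_real (a n) * w ^ n) sums (exp (of_nat k * log_partition w) * (\<Sum>n. of_real (h n) * w ^ n))"
begin

text \<open>The minimum of n x + k pi^2/(6x) in x.\<close>

definition saddle :: "nat \<Rightarrow> real" where
  "saddle n = pi * sqrt (real k / (6 * real n))"

definition H :: "real \<Rightarrow> real" where "H x = (\<Sum>n. h n * exp (- x) ^ n)"

definition F :: "real \<Rightarrow> real" where "F x = exp (real k * log_partition (exp (- x))) * H x"

text \<open>Cauchy's integrand in the variable u, divided by its value F(x) on the real axis, so
  that it converges to a Gaussian.\<close>

definition integrand :: "nat \<Rightarrow> real \<Rightarrow> real \<Rightarrow> complex" where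
  "integrand n x u = indicator {-pi..pi} (x * sqrt x * u) *\<^sub>R
    (exp (of_nat k * (log_partition (peak x u) - of_real (log_partition (exp (- x)))))
     * ((\<Sum>n. of_real (h n) * peak x u ^ n) / of_real (H x))
     * exp (\<i> * of_real (real n * (x * sqrt x * u))))"

lemma saddle_pos: "n > 0 \<Longrightarrow> saddle n > 0"
  using k_pos by (simp add: saddle_def)

lemma saddle_eq: "n > 0 \<Longrightarrow> real k * pi\<^sup>2 / (6 * (saddle n)\<^sup>2) = real n"
  using k_pos by (simp add: saddle_def power_mult_distrib)

lemma filterlim_saddle: "filterlim saddle (at_right 0) sequentially"
  unfolding saddle_def using k_pos by real_asymp

lemma H_summable: "x > 0 \<Longrightarrow> summable (\<lambda>n. h n * exp (- x) ^ n)"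
  by (intro h_summable) auto

lemma F_sums: assumes "x > 0" shows "(\<lambda>n. a n * exp (- x) ^ n) sums F x"
proof -
  have "(\<Sum>n. complex_of_real (h n) * of_real (exp (- x)) ^ n) = of_real (H x)"
    unfolding H_def using suminf_of_real[OF H_summable[OF assms], where 'a = complex] by simp
  moreover have "log_partition (complex_of_real (exp (- x))) = of_real (log_partition (exp (- x)))"
    using assms by (intro log_partition_of_real) auto
  ultimately have "(\<lambda>n. of_real (a n) * complex_of_real (exp (- x)) ^ n) sums of_real (F x)"
    using a_sums[of "of_real (exp (- x))"] assms by (simp add: F_def exp_of_real[symmetric])
  then have "(\<lambda>n. complex_of_real (a n * exp (- x) ^ n)) sums of_real (F x)" by simp
  then show ?thesis by (simp only: sums_of_real_iff)
qed

lemma integrand_integral: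
  assumes x: "x > 0" and Hx: "H x > 0"
  shows "has_bochner_integral lborel (integrand n x)
    (complex_of_real (2 * pi * a n * exp (- (real n * x)) / (x * sqrt x * F x)))"
proof -
  define c where "c = x * sqrt x"
  have c: "c > 0" using x by (simp add: c_def)
  have Fx: "F x > 0" using Hx by (simp add: F_def)
  define f where "f y = indicator {-pi..pi} y *\<^sub>R ((\<Sum>m. of_real (a m) * exp (- Complex x y) ^ m) * exp (\<i> * of_real (real n * y)))" for y
  have I: "has_bochner_integral lborel f (complex_of_real (2 * pi * a n * exp (- (real n * x))))"
    unfolding f_def by (rule cauchy_coefficient) (use a_nonneg F_sums[OF x] in \<open>auto simp: sums_iff\<close>)
  have int: "integrable lborel (\<lambda>u. f (0 + c * u))"
    using lborel_integrable_real_affine[of f c 0] I c by (auto simp: has_bochner_integral_iff)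
  have "complex_of_real (2 * pi * a n * exp (- (real n * x))) = \<bar>c\<bar> *\<^sub>R (\<integral>u. f (0 + c * u) \<partial>lborel)"
    using lborel_integral_real_affine[of c f 0] I c by (auto simp: has_bochner_integral_iff)
  with int have "has_bochner_integral lborel (\<lambda>u. f (c * u)) (complex_of_real (2 * pi * a n * exp (- (real n * x)) / c))"
    using c by (auto simp: has_bochner_integral_iff scaleR_conv_of_real field_simps)
  then have "has_bochner_integral lborel (\<lambda>u. f (c * u) / of_real (F x)) (complex_of_real (2 * pi * a n * exp (- (real n * x)) / c) / of_real (F x))"
    by (rule has_bochner_integral_divide_zero)
  moreover have "f (c * u) / of_real (F x) = integrand n x u" for u
  proof -
    have "(\<Sum>m. of_real (a m) * exp (- Complex x (c * u)) ^ m) = exp (of_nat k * log_partition (exp (- Complex x (c * u)))) *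
        (\<Sum>n. of_real (h n) * exp (- Complex x (c * u)) ^ n)"
      using a_sums[of "exp (- Complex x (c * u))"] x by (simp add: sums_iff)
    moreover have "of_real (F x) = exp (of_nat k * of_real (log_partition (exp (- x)))) * complex_of_real (H x)"
      by (simp add: F_def exp_of_real[symmetric])
    ultimately show ?thesis
      unfolding f_def integrand_def c_def[symmetric] right_diff_distrib exp_diff
      by (simp add: scaleR_conv_of_real)
  qed
  ultimately show ?thesis using Fx by (simp add: c_def)
qed

lemma H_pos: "\<forall>\<^sub>F x in at_right 0. H x > 0"
proof -
  have "\<forall>\<^sub>F x in at_right 0. H x * x powr \<beta> > 0"
    using order_tendstoD(1)[OF h_asymp \<kappa>_pos] by (simp add: H_def)
  then show ?thesis by eventually_elim (auto simp: zero_less_mult_iff)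
qed

lemma norm_integrand_le:
  assumes C: "\<And>x u. 0 < x \<Longrightarrow> x \<le> 1 / 2 \<Longrightarrow> \<bar>x * sqrt x * u\<bar> \<le> pi \<Longrightarrow>
       exp (Re (log_partition (peak x u)) - log_partition (exp (- x))) \<le> C / (1 + u\<^sup>2)"
    and C0: "C > 0" and x: "0 < x" "x \<le> 1 / 2" and Hx: "H x > 0"
  shows "norm (integrand n x u) \<le> C / (1 + u\<^sup>2)"
proof (cases "\<bar>x * sqrt x * u\<bar> \<le> pi")
  case True
  define y where "y = x * sqrt x * u"
  define t where "t = Re (log_partition (exp (- Complex x y))) - log_partition (exp (- x))"
  have "0 \<le> 2 / pi\<^sup>2 * y\<^sup>2 / (2 * x * (x\<^sup>2 + 2 / pi\<^sup>2 * y\<^sup>2))" using x by simp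
  then have t: "t \<le> 0" using Re_log_partition_decay[OF x, of y] True by (simp add: t_def y_def)
  have 1: "norm (exp (of_nat k * (log_partition (exp (- Complex x y)) - of_real (log_partition (exp (- x)))))) \<le> C / (1 + u\<^sup>2)"
  proof -
    \<comment> \<open>As t <= 0, the k-th power only improves the bound, and one majorant serves for
      every k.\<close>
    have "real k * t \<le> 1 * t" using t k_pos by (intro mult_right_mono_neg) auto
    then have "exp (real k * t) \<le> exp t" by simp
    also have "\<dots> \<le> C / (1 + u\<^sup>2)" unfolding t_def y_def by (rule C[OF x True])
    finally show ?thesis by (simp add: norm_exp_eq_Re t_def)
  qed
  have 2: "norm ((\<Sum>n. of_real (h n) * exp (- Complex x y) ^ n) / complex_of_real (H x)) \<le> 1"
  proof -
    have "norm (\<Sum>n. of_real (h n) * exp (- Complex x y) ^ n) \<le> H x"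
      unfolding H_def by (rule norm_suminf_le) (use h_nonneg H_summable x in \<open>auto simp: norm_mult norm_power\<close>)
    then show ?thesis using Hx by (simp add: norm_divide)
  qed
  have 3: "norm (indicator {-pi..pi} y :: real) \<le> 1" by (simp add: indicator_def)
  have "norm (integrand n x u) \<le> 1 * (C / (1 + u\<^sup>2) * 1 * 1)"
    unfolding integrand_def y_def[symmetric] norm_scaleR norm_mult
    using 1 2 3 C0 by (intro mult_mono) (auto intro!: mult_nonneg_nonneg)
  then show ?thesis by simp
next
  case False
  then have "indicator {-pi..pi} (x * sqrt x * u) = (0::real)" by (auto simp: indicator_def)
  then show ?thesis using C0 by (simp add: integrand_def)
qed

lemma integrand_tendsto:
  "(\<lambda>n. integrand n (saddle n) u) \<longlonglongrightarrow> of_real (exp (- (real k * pi\<^sup>2 / 6 * u\<^sup>2)))"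
proof -
  have "((\<lambda>x::real. x * sqrt x * u) \<longlongrightarrow> 0) (at_right 0)" by real_asymp
  then have "((\<lambda>x::real. \<bar>x * sqrt x * u\<bar>) \<longlongrightarrow> 0) (at_right 0)" by (rule tendsto_rabs_zero)
  then have "\<forall>\<^sub>F x::real in at_right 0. \<bar>x * sqrt x * u\<bar> < pi" by (rule order_tendstoD) auto
  then have "\<forall>\<^sub>F x::real in at_right 0. indicator {-pi..pi} (x * sqrt x * u) = (1::real)"
    by eventually_elim (auto simp: indicator_def)
  then have 1: "((\<lambda>x::real. indicator {-pi..pi} (x * sqrt x * u) :: real) \<longlongrightarrow> 1) (at_right 0)"
    by (rule tendsto_eventually)
  have 2: "((\<lambda>x. (\<Sum>n. of_real (h n) * peak x u ^ n) / complex_of_real (H x)) \<longlongrightarrow> 1) (at_right 0)"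
    unfolding H_def by (rule powser_ratio_tendsto[OF h_nonneg h_summable h_asymp \<kappa>_pos])
  define J where "J x = indicator {-pi..pi} (x * sqrt x * u) *\<^sub>R
    ((exp (of_nat k * (log_partition (peak x u) - of_real (log_partition (exp (- x)))))
       * exp (\<i> * of_real (real k * pi\<^sup>2 / (6 * x\<^sup>2) * (x * sqrt x * u))))
     * ((\<Sum>n. of_real (h n) * peak x u ^ n) / of_real (H x)))" for x
  have "(J \<longlongrightarrow> 1 *\<^sub>R (of_real (exp (- (real k * pi\<^sup>2 / 6 * u\<^sup>2))) * 1)) (at_right 0)"
    unfolding J_def by (intro tendsto_scaleR tendsto_mult 1 2 log_partition_ratio_tendsto)
  then have "(J \<longlongrightarrow> of_real (exp (- (real k * pi\<^sup>2 / 6 * u\<^sup>2)))) (at_right 0)" by simp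
  from filterlim_compose[OF this filterlim_saddle]
  have "(\<lambda>n. J (saddle n)) \<longlonglongrightarrow> of_real (exp (- (real k * pi\<^sup>2 / 6 * u\<^sup>2)))" .
  moreover have "\<forall>\<^sub>F n in sequentially. J (saddle n) = integrand n (saddle n) u"
    using eventually_gt_at_top[of 0]
  proof eventually_elim
    case (elim n)
    show ?case unfolding J_def integrand_def saddle_eq[OF elim] by (simp add: mult_ac)
  qed
  ultimately show ?thesis by (rule Lim_transform_eventually)
qed

text \<open>Dominated convergence; the limit is the integral of exp(-k pi^2 u^2/6).\<close>

lemma saddle_point_ratio:
  "(\<lambda>n. 2 * pi * a n * exp (- (real n * saddle n)) / (saddle n * sqrt (saddle n) * F (saddle n))) \<longlonglongrightarrow> sqrt (6 / (real k * pi))"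
proof -
  obtain C :: real where C0: "C > 0" and C: "\<And>x u. 0 < x \<Longrightarrow> x \<le> 1 / 2 \<Longrightarrow> \<bar>x * sqrt x * u\<bar> \<le> pi \<Longrightarrow>
       exp (Re (log_partition (peak x u)) - log_partition (exp (- x))) \<le> C / (1 + u\<^sup>2)"
    using log_partition_lorentzian_bound by metis
  have "\<forall>\<^sub>F x::real in at_right 0. 0 < x \<and> x \<le> 1 / 2" by (auto simp: eventually_at_right_field intro!: exI[of _ "1/2"])
  with H_pos have "\<forall>\<^sub>F x in at_right 0. 0 < x \<and> x \<le> 1 / 2 \<and> H x > 0" by eventually_elim auto
  from eventually_compose_filterlim[OF this filterlim_saddle]
  obtain N where N: "\<And>n. n \<ge> N \<Longrightarrow> 0 < saddle n \<and> saddle n \<le> 1 / 2 \<and> H (saddle n) > 0"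
    by (auto simp: eventually_sequentially)
  \<comment> \<open>Shifted by N, so that the majorant holds for every index of the
    sequence.\<close>
  define s where "s i = integrand (i + N) (saddle (i + N))" for i
  define g where "g u = complex_of_real (exp (- (real k * pi\<^sup>2 / 6 * u\<^sup>2)))" for u
  have I: "has_bochner_integral lborel (s i) (complex_of_real (2 * pi * a (i + N) * exp (- (real (i + N) * saddle (i + N)))
      / (saddle (i + N) * sqrt (saddle (i + N)) * F (saddle (i + N)))))" for i
    unfolding s_def using N[of "i + N"] by (intro integrand_integral) auto
  have "(\<lambda>i. integral\<^sup>L lborel (s i)) \<longlonglongrightarrow> integral\<^sup>L lborel g"
  proof (rule integral_dominated_convergence[where w = "\<lambda>u. C / (1 + u\<^sup>2)"])
    show "g \<in> borel_measurable lborel" by (simp add: g_def[abs_def])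
    show "s i \<in> borel_measurable lborel" for i
      using I[of i] by (auto simp: has_bochner_integral_iff)
    show "integrable lborel (\<lambda>u. C / (1 + u\<^sup>2))" by (rule integrable_lorentzian)
    have "(\<lambda>i. s i u) \<longlonglongrightarrow> g u" for u
      unfolding s_def g_def by (rule LIMSEQ_ignore_initial_segment[OF integrand_tendsto])
    then show "AE u in lborel. (\<lambda>i. s i u) \<longlonglongrightarrow> g u" by simp
    have "norm (s i u) \<le> C / (1 + u\<^sup>2)" for i u
      unfolding s_def using N[of "i + N"] by (intro norm_integrand_le[OF C C0]) auto
    then show "AE u in lborel. norm (s i u) \<le> C / (1 + u\<^sup>2)" for i by simp
  qed
  moreover have "integral\<^sup>L lborel g = of_real (sqrt (6 / (real k * pi)))"
  proof -
    have "integral\<^sup>L lborel g = of_real (\<integral>u. exp (- (real k * pi\<^sup>2 / 6 * u\<^sup>2)) \<partial>lborel)"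
      unfolding g_def by (rule integral_complex_of_real)
    also have "(\<integral>u. exp (- (real k * pi\<^sup>2 / 6 * u\<^sup>2)) \<partial>lborel) = sqrt (pi / (real k * pi\<^sup>2 / 6))"
      using k_pos by (intro gaussian_integral) auto
    also have "pi / (real k * pi\<^sup>2 / 6) = 6 / (real k * pi)" using k_pos by (simp add: field_simps power2_eq_square)
    finally show ?thesis .
  qed
  ultimately have "(\<lambda>i. complex_of_real (2 * pi * a (i + N) * exp (- (real (i + N) * saddle (i + N)))
      / (saddle (i + N) * sqrt (saddle (i + N)) * F (saddle (i + N))))) \<longlonglongrightarrow> of_real (sqrt (6 / (real k * pi)))"
    using has_bochner_integral_integral_eq[OF I] by simp
  then have "(\<lambda>i. 2 * pi * a (i + N) * exp (- (real (i + N) * saddle (i + N)))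
      / (saddle (i + N) * sqrt (saddle (i + N)) * F (saddle (i + N)))) \<longlonglongrightarrow> sqrt (6 / (real k * pi))"
    by (simp only: tendsto_of_real_iff)
  then show ?thesis by (rule LIMSEQ_offset)
qed

text \<open>In the exponent of the saddle, k/2 comes from the factor sqrt x in each P,
  \<open>- \<beta>\<close> from H, and 3/2 from the width of the peak. At the saddle n x equals k
  pi^2/(6x), so the two exponents add up to k pi^2/(3x). The constant collects the Gaussian
  integral, the 2 pi of Cauchy's formula and the factors (2 pi)^(-1/2) of P.\<close>

theorem coefficient_asymp:
  "(\<lambda>n. a n / (saddle n powr (real k / 2 - \<beta> + 3 / 2) * exp (real k * pi\<^sup>2 / (3 * saddle n))))
     \<longlonglongrightarrow> sqrt (6 / (real k * pi)) / (2 * pi) * exp (- (real k * ln (2 * pi) / 2)) * \<kappa>"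
proof -
  define R where "R x = log_partition_excess x" for x
  have R: "(\<lambda>n. R (saddle n)) \<longlonglongrightarrow> - ln (2 * pi) / 2"
    unfolding R_def by (rule filterlim_compose[OF log_partition_asymp filterlim_saddle])
  have HH: "(\<lambda>n. H (saddle n) * saddle n powr \<beta>) \<longlonglongrightarrow> \<kappa>"
    unfolding H_def by (rule filterlim_compose[OF h_asymp filterlim_saddle])
  have "(\<lambda>n. (2 * pi * a n * exp (- (real n * saddle n)) / (saddle n * sqrt (saddle n) * F (saddle n))) / (2 * pi)
       * exp (real k * R (saddle n)) * (H (saddle n) * saddle n powr \<beta>))
    \<longlonglongrightarrow> sqrt (6 / (real k * pi)) / (2 * pi) * exp (real k * (- ln (2 * pi) / 2)) * \<kappa>"
    by (intro tendsto_intros saddle_point_ratio R HH) auto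
  moreover have "\<forall>\<^sub>F n in sequentially. (2 * pi * a n * exp (- (real n * saddle n)) / (saddle n * sqrt (saddle n) * F (saddle n))) / (2 * pi)
       * exp (real k * R (saddle n)) * (H (saddle n) * saddle n powr \<beta>)
     = a n / (saddle n powr (real k / 2 - \<beta> + 3 / 2) * exp (real k * pi\<^sup>2 / (3 * saddle n)))"
    using eventually_compose_filterlim[OF H_pos filterlim_saddle] eventually_gt_at_top[of 0]
  proof eventually_elim
    case (elim n)
    define x where "x = saddle n"
    have x: "x > 0" using elim saddle_pos by (simp add: x_def)
    have Hx: "H x > 0" using elim by (simp add: x_def)
    have nx: "real n * x = real k * pi\<^sup>2 / (6 * x)"
      using saddle_eq[of n] elim x by (simp add: x_def field_simps power2_eq_square)
    have lp: "real k * log_partition (exp (- x)) = real k * R x + real k * pi\<^sup>2 / (6 * x) + real k / 2 * ln x"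
      by (simp add: R_def algebra_simps add_divide_distrib)
    have F: "F x = exp (real k * R x) * exp (real k * pi\<^sup>2 / (6 * x)) * x powr (real k / 2) * H x"
      unfolding F_def lp exp_add using x by (simp add: powr_def mult.commute)
    have E: "exp (real k * pi\<^sup>2 / (3 * x)) = exp (real k * pi\<^sup>2 / (6 * x)) * exp (real k * pi\<^sup>2 / (6 * x))"
      by (simp add: exp_add[symmetric])
    have S: "x * sqrt x = x powr (3 / 2)"
    proof -
      have "x powr (3 / 2) = x powr (1 + 1 / 2)" by simp
      also have "\<dots> = x * sqrt x" using x by (simp only: powr_add powr_half_sqrt powr_one less_imp_le)
      finally show ?thesis by simp
    qed
    have P: "x powr (real k / 2 - \<beta> + 3 / 2) = x powr (real k / 2) / x powr \<beta> * x powr (3 / 2)"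
      by (simp add: powr_add powr_diff)
    show ?case unfolding x_def[symmetric] nx F E S P exp_minus using x Hx
      by (simp add: field_simps)
  qed
  ultimately show ?thesis
    by (simp add: Lim_transform_eventually)
qed

end

section \<open>The three counting sequences\<close>

definition conv :: "(nat \<Rightarrow> real) \<Rightarrow> (nat \<Rightarrow> real) \<Rightarrow> nat \<Rightarrow> real" where
  "conv f g n = (\<Sum>i\<le>n. f i * g (n - i))"

abbreviation cumulative :: "(nat \<Rightarrow> real) \<Rightarrow> nat \<Rightarrow> real" where
  "cumulative \<equiv> conv (\<lambda>_. 1)"

definition subexponential :: "(nat \<Rightarrow> real) \<Rightarrow> bool" where
  "subexponential f \<longleftrightarrow> (\<forall>n. f n \<ge> 0) \<and> (\<forall>r. 0 \<le> r \<longrightarrow> r < 1 \<longrightarrow> summable (\<lambda>n. f n * r ^ n))"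

lemma subexponential_nonneg: "subexponential f \<Longrightarrow> f n \<ge> 0"
  by (simp add: subexponential_def)

lemma subexponential_summable: "subexponential f \<Longrightarrow> 0 \<le> r \<Longrightarrow> r < 1 \<Longrightarrow> summable (\<lambda>n. f n * r ^ n)"
  by (simp add: subexponential_def)

lemma subexponential_norm_summable:
  fixes w :: "'a::{real_normed_field,banach}"
  assumes "subexponential f" "norm w < 1"
  shows "summable (\<lambda>n. norm (of_real (f n) * w ^ n))"
  using subexponential_summable[OF assms(1), of "norm w"] assms subexponential_nonneg[OF assms(1)]
  by (simp add: norm_mult norm_power)

lemma conv_sums:
  fixes w :: "'a::{real_normed_field,banach}"
  assumes f: "subexponential f" and g: "subexponential g" and w: "norm w < 1"
  shows "(\<lambda>n. of_real (conv f g n) * w ^ n) sums ((\<Sum>n. of_real (f n) * w ^ n) * (\<Sum>n. of_real (g n) * w ^ n))"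
proof -
  have "(\<Sum>i\<le>n. (of_real (f i) * w ^ i) * (of_real (g (n - i)) * w ^ (n - i))) = of_real (conv f g n) * w ^ n" for n
  proof -
    have "(of_real (f i) * w ^ i) * (of_real (g (n - i)) * w ^ (n - i)) = of_real (f i * g (n - i)) * w ^ n" if "i \<le> n" for i
    proof -
      have "w ^ n = w ^ i * w ^ (n - i)" using that by (simp add: power_add[symmetric])
      then show ?thesis by simp
    qed
    then show ?thesis unfolding conv_def of_real_sum sum_distrib_right by (intro sum.cong refl) simp
  qed
  then show ?thesis
    using Cauchy_product_sums[OF subexponential_norm_summable[OF f w] subexponential_norm_summable[OF g w]] by simp
qed

lemma subexponential_conv:
  assumes f: "subexponential f" and g: "subexponential g"
  shows "subexponential (conv f g)"
  unfolding subexponential_def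
proof safe
  show "conv f g n \<ge> 0" for n
    unfolding conv_def by (intro sum_nonneg mult_nonneg_nonneg subexponential_nonneg f g)
  fix r :: real assume "0 \<le> r" "r < 1"
  then show "summable (\<lambda>n. conv f g n * r ^ n)"
    using conv_sums[OF f g, of r] by (simp add: sums_iff)
qed

lemma subexponential_one: "subexponential (\<lambda>_. 1)"
  by (auto simp: subexponential_def)

lemma subexponential_partitions: "subexponential partitions"
  by (auto simp: subexponential_def partitions_summable)

section \<open>The theta series\<close>

definition square_count :: "nat \<Rightarrow> nat" where
  "square_count m = card {j :: int. j\<^sup>2 = int m}"

lemma square_count_square: "square_count (n\<^sup>2) = (if n = 0 then 1 else 2)"
proof -
  have "j\<^sup>2 = int (n\<^sup>2) \<longleftrightarrow> j = int n \<or> j = - int n" for j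
    by (simp add: power2_eq_iff)
  then have "{j :: int. j\<^sup>2 = int (n\<^sup>2)} = {int n, - int n}" by auto
  then show ?thesis by (simp add: square_count_def card_insert_if)
qed

lemma square_count_nonsquare:
  assumes "m \<notin> range (\<lambda>n. n\<^sup>2)" shows "square_count m = 0"
proof -
  have False if "j\<^sup>2 = int m" for j :: int
  proof -
    have "int ((nat \<bar>j\<bar>)\<^sup>2) = int m" using that by simp
    then have "m = (nat \<bar>j\<bar>)\<^sup>2" by (simp only: of_nat_eq_iff)
    with assms show False by blast
  qed
  then show ?thesis unfolding square_count_def by (metis (mono_tags, lifting) card.empty empty_Collect_eq)
qed

lemma square_count_le: "square_count m \<le> 2"
  using square_count_square square_count_nonsquare by (cases "m \<in> range (\<lambda>n. n\<^sup>2)") (auto simp: square_count_square)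

lemma subexponential_square_count: "subexponential square_count"
  unfolding subexponential_def
proof safe
  fix r :: real assume r: "0 \<le> r" "r < 1"
  show "summable (\<lambda>n. square_count n * r ^ n)"
  proof (rule summable_comparison_test'[of "\<lambda>n. 2 * r ^ n" 0])
    show "summable (\<lambda>n. 2 * r ^ n)" using r by (intro summable_mult summable_geometric) auto
    show "norm (square_count n * r ^ n) \<le> 2 * r ^ n" for n
      using square_count_le[of n] r by (simp add: mult_right_mono)
  qed
qed auto

lemma gaussian_half_integral:
  assumes x: "x > 0"
  shows "has_bochner_integral lborel (\<lambda>t. indicator {0..} t *\<^sub>R exp (- (x * t\<^sup>2))) (sqrt (pi / x) / 2)"
proof -
  have "has_bochner_integral lborel (\<lambda>t. indicator {0..} (0 + sqrt x * t) *\<^sub>R exp (- (0 + sqrt x * t)\<^sup>2)) (sqrt pi / 2 /\<^sub>R \<bar>sqrt x\<bar>)"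
    using gaussian_moment_0 x by (subst lborel_has_bochner_integral_real_affine_iff[symmetric]) auto
  moreover have "indicator {0..} (0 + sqrt x * t) *\<^sub>R exp (- (0 + sqrt x * t)\<^sup>2) = indicator {0..} t *\<^sub>R exp (- (x * t\<^sup>2))" for t
    using x by (auto simp: indicator_def power_mult_distrib zero_le_mult_iff)
  ultimately show ?thesis using x by (simp add: real_sqrt_divide field_simps)
qed

text \<open>Integral test: for a decreasing function the sum exceeds the integral by an amount
  between 0 and its value at 0, here 1.\<close>

lemma gaussian_sum_bounds:
  assumes x: "x > 0"
  obtains S where "(\<lambda>n. exp (- (x * (real n)\<^sup>2))) sums S" "sqrt (pi / x) / 2 \<le> S" "S \<le> sqrt (pi / x) / 2 + 1"
proof -
  define f where "f t = exp (- (x * t\<^sup>2))" for t :: real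
  interpret antimono_fun_sum_integral_diff f
  proof
    show "f s \<ge> f t" if "0 \<le> s" "s \<le> t" for s t
      using that x by (simp add: f_def power_mono mult_left_mono)
  qed (auto simp: f_def intro!: continuous_intros)
  have g: "integrable lborel (\<lambda>t. indicator {0..} t *\<^sub>R f t)" "(\<integral>t. indicator {0..} t *\<^sub>R f t \<partial>lborel) = sqrt (pi / x) / 2"
    using gaussian_half_integral[OF x] by (auto simp: f_def has_bochner_integral_iff)
  have "(\<lambda>n. \<integral>t. indicator {..real n} t *\<^sub>R (indicator {0..} t *\<^sub>R f t) \<partial>lborel) \<longlonglongrightarrow> sqrt (pi / x) / 2"
    unfolding g(2)[symmetric]
    by (rule filterlim_compose[OF tendsto_integral_at_top filterlim_real_sequentially]) (use g in auto)
  moreover have "(\<integral>t. indicator {..real n} t *\<^sub>R (indicator {0..} t *\<^sub>R f t) \<partial>lborel) = integral {0..real n} f" for n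
  proof -
    have "set_integrable lborel {0..real n} f"
      unfolding set_integrable_def f_def by (rule borel_integrable_compact) (auto intro!: continuous_intros)
    then have "(LINT t:{0..real n}|lborel. f t) = integral {0..real n} f" by (rule set_borel_integral_eq_integral)
    moreover have eq: "indicator {..real n} t *\<^sub>R (indicator {0..} t *\<^sub>R f t) = indicator {0..real n} t *\<^sub>R f t" for t
      by (auto simp: indicator_def)
    ultimately show ?thesis by (simp only: set_lebesgue_integral_def eq)
  qed
  ultimately have I: "(\<lambda>n. integral {0..real n} f) \<longlonglongrightarrow> sqrt (pi / x) / 2" by simp
  obtain L where L: "sum_integral_diff_series \<longlonglongrightarrow> L"
    using sum_integral_diff_series_convergent by (auto simp: convergent_def)
  have L0: "0 \<le> L" by (rule LIMSEQ_le_const[OF L]) (use sum_integral_diff_series_nonneg in auto)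
  have "sum_integral_diff_series n \<le> 1" for n
    using sum_integral_diff_series_antimono[of 0 n] by (simp add: sum_integral_diff_series_def f_def)
  then have L1: "L \<le> 1" by (intro LIMSEQ_le_const2[OF L]) auto
  have "(\<lambda>n. sum_integral_diff_series n + integral {0..real n} f) \<longlonglongrightarrow> L + sqrt (pi / x) / 2"
    by (intro tendsto_intros L I)
  then have "(\<lambda>n. \<Sum>k\<le>n. f (real k)) \<longlonglongrightarrow> L + sqrt (pi / x) / 2" by (simp add: sum_integral_diff_series_def)
  then have "(\<lambda>n. f (real n)) sums (L + sqrt (pi / x) / 2)" by (simp add: sums_def_le)
  then show ?thesis using L0 L1 by (intro that[of "L + sqrt (pi / x) / 2"]) (auto simp: f_def)
qed

lemma theta_asymp:
  "((\<lambda>x. (\<Sum>n. square_count n * exp (- x) ^ n) * sqrt x) \<longlongrightarrow> sqrt pi) (at_right 0)"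
proof (rule tendsto_sandwich)
  have pos: "\<forall>\<^sub>F x::real in at_right 0. x > 0" by real_asymp
  have sqrt_0: "((\<lambda>x::real. sqrt x) \<longlongrightarrow> 0) (at_right 0)" by real_asymp
  have bound: "sqrt (pi / x) - 1 \<le> (\<Sum>n. square_count n * exp (- x) ^ n) \<and>
        (\<Sum>n. square_count n * exp (- x) ^ n) \<le> sqrt (pi / x) + 1" if x: "x > 0" for x
  proof -
    obtain S where S: "(\<lambda>n. exp (- (x * (real n)\<^sup>2))) sums S" "sqrt (pi / x) / 2 \<le> S" "S \<le> sqrt (pi / x) / 2 + 1"
      using gaussian_sum_bounds[OF x] .
    \<comment> \<open>The roots n and -n coincide for n = 0, so that term is counted once; the full
      series is 2S - 1.\<close>
    have "(\<lambda>n. 2 * exp (- (x * (real n)\<^sup>2)) - (if n = 0 then 1 else 0)) sums (2 * S - 1)"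
      by (intro sums_diff sums_mult S sums_single)
    moreover have "2 * exp (- (x * (real n)\<^sup>2)) - (if n = 0 then 1 else 0) = square_count (n\<^sup>2) * exp (- x) ^ (n\<^sup>2)" for n
      by (simp add: square_count_square exp_of_nat_mult[symmetric] mult.commute)
    ultimately have "(\<lambda>n. square_count (n\<^sup>2) * exp (- x) ^ (n\<^sup>2)) sums (2 * S - 1)" by simp
    then have "(\<lambda>n. square_count n * exp (- x) ^ n) sums (2 * S - 1)"
      by (subst (asm) sums_mono_reindex) (auto simp: strict_mono_def power_strict_mono square_count_nonsquare)
    then show ?thesis using S by (simp add: sums_iff)
  qed
  show "\<forall>\<^sub>F x in at_right 0. (sqrt (pi / x) - 1) * sqrt x \<le> (\<Sum>n. square_count n * exp (- x) ^ n) * sqrt x"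
    using pos by eventually_elim (intro mult_right_mono, use bound in auto)
  show "\<forall>\<^sub>F x in at_right 0. (\<Sum>n. square_count n * exp (- x) ^ n) * sqrt x \<le> (sqrt (pi / x) + 1) * sqrt x"
    using pos by eventually_elim (intro mult_right_mono, use bound in auto)
  show "((\<lambda>x. (sqrt (pi / x) - 1) * sqrt x) \<longlongrightarrow> sqrt pi) (at_right 0)"
  proof -
    have "((\<lambda>x. sqrt pi - sqrt x) \<longlongrightarrow> sqrt pi - 0) (at_right 0)" by (intro tendsto_diff sqrt_0 tendsto_const)
    then have "((\<lambda>x. sqrt pi - sqrt x) \<longlongrightarrow> sqrt pi) (at_right 0)" by simp
    then show ?thesis
      by (rule Lim_transform_eventually, intro eventually_mono[OF pos]) (simp add: real_sqrt_divide left_diff_distrib)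
  qed
  show "((\<lambda>x. (sqrt (pi / x) + 1) * sqrt x) \<longlongrightarrow> sqrt pi) (at_right 0)"
  proof -
    have "((\<lambda>x. sqrt pi + sqrt x) \<longlongrightarrow> sqrt pi + 0) (at_right 0)" by (intro tendsto_add sqrt_0 tendsto_const)
    then have "((\<lambda>x. sqrt pi + sqrt x) \<longlongrightarrow> sqrt pi) (at_right 0)" by simp
    then show ?thesis
      by (rule Lim_transform_eventually, intro eventually_mono[OF pos]) (simp add: real_sqrt_divide distrib_right)
  qed
qed

text \<open>Rounding is harmless because the growth is exponential only in the square root, and sqrt
  \<Lambda> minus the root of its integer part tends to 0.\<close>

lemma asymp_equiv_floor:
  fixes A :: "nat \<Rightarrow> real" and b c C :: real
  assumes C: "C > 0" and lim: "(\<lambda>n. A n / (real n powr b * exp (c * sqrt (real n)))) \<longlonglongrightarrow> C"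
  shows "(\<lambda>\<Lambda>. A (nat \<lfloor>\<Lambda>\<rfloor>)) \<sim>[at_top] (\<lambda>\<Lambda>. C * \<Lambda> powr b * exp (c * sqrt \<Lambda>))"
proof (rule asymp_equivI')
  define m where "m \<Lambda> = real (nat \<lfloor>\<Lambda>\<rfloor>)" for \<Lambda> :: real
  have m: "filterlim (\<lambda>\<Lambda>::real. nat \<lfloor>\<Lambda>\<rfloor>) at_top at_top"
    by (rule filterlim_compose[OF filterlim_nat_sequentially filterlim_floor_sequentially])
  have b: "\<Lambda> - 1 \<le> m \<Lambda> \<and> m \<Lambda> \<le> \<Lambda> \<and> m \<Lambda> > 0" if "\<Lambda> > 1" for \<Lambda> :: real
    using that by (simp add: m_def)
  have 1: "((\<lambda>\<Lambda>. m \<Lambda> / \<Lambda>) \<longlongrightarrow> 1) at_top"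
  proof (rule tendsto_sandwich)
    show "\<forall>\<^sub>F \<Lambda> in at_top. (\<Lambda> - 1) / \<Lambda> \<le> m \<Lambda> / \<Lambda>" "\<forall>\<^sub>F \<Lambda> in at_top. m \<Lambda> / \<Lambda> \<le> 1"
      by (rule eventually_mono[OF eventually_gt_at_top[of 1]], use b in \<open>force simp: divide_right_mono\<close>)+
    show "((\<lambda>\<Lambda>::real. (\<Lambda> - 1) / \<Lambda>) \<longlongrightarrow> 1) at_top" by real_asymp
  qed auto
  have 2: "((\<lambda>\<Lambda>. sqrt (m \<Lambda>) - sqrt \<Lambda>) \<longlongrightarrow> 0) at_top"
  proof (rule tendsto_sandwich)
    show "\<forall>\<^sub>F \<Lambda> in at_top. sqrt (\<Lambda> - 1) - sqrt \<Lambda> \<le> sqrt (m \<Lambda>) - sqrt \<Lambda>" "\<forall>\<^sub>F \<Lambda> in at_top. sqrt (m \<Lambda>) - sqrt \<Lambda> \<le> 0"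
      by (rule eventually_mono[OF eventually_gt_at_top[of 1]], use b in force)+
    show "((\<lambda>\<Lambda>::real. sqrt (\<Lambda> - 1) - sqrt \<Lambda>) \<longlongrightarrow> 0) at_top" by real_asymp
  qed auto
  have 0: "((\<lambda>\<Lambda>. A (nat \<lfloor>\<Lambda>\<rfloor>) / (m \<Lambda> powr b * exp (c * sqrt (m \<Lambda>)))) \<longlongrightarrow> C) at_top"
    unfolding m_def by (rule filterlim_compose[OF lim m])
  have "((\<lambda>\<Lambda>. A (nat \<lfloor>\<Lambda>\<rfloor>) / (m \<Lambda> powr b * exp (c * sqrt (m \<Lambda>))) / C * (m \<Lambda> / \<Lambda>) powr b * exp (c * (sqrt (m \<Lambda>) - sqrt \<Lambda>))) \<longlongrightarrow> C / C * 1 powr b * exp (c * 0)) at_top"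
    using C by (intro tendsto_mult tendsto_divide tendsto_powr tendsto_exp tendsto_const 0 1 2) auto
  moreover have "\<forall>\<^sub>F \<Lambda> in at_top. A (nat \<lfloor>\<Lambda>\<rfloor>) / (m \<Lambda> powr b * exp (c * sqrt (m \<Lambda>))) / C * (m \<Lambda> / \<Lambda>) powr b * exp (c * (sqrt (m \<Lambda>) - sqrt \<Lambda>))
     = A (nat \<lfloor>\<Lambda>\<rfloor>) / (C * \<Lambda> powr b * exp (c * sqrt \<Lambda>))"
    using eventually_gt_at_top[of 1]
  proof eventually_elim
    case (elim \<Lambda>)
    have "m \<Lambda> > 0" "\<Lambda> > 0" using b[OF elim] elim by auto
    then show ?case using C by (simp add: powr_divide right_diff_distrib exp_diff field_simps)
  qed
  ultimately have "((\<lambda>\<Lambda>. A (nat \<lfloor>\<Lambda>\<rfloor>) / (C * \<Lambda> powr b * exp (c * sqrt \<Lambda>))) \<longlongrightarrow> C / C * 1 powr b * exp (c * 0)) at_top"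
    by (rule Lim_transform_eventually)
  then show "((\<lambda>\<Lambda>. A (nat \<lfloor>\<Lambda>\<rfloor>) / (C * \<Lambda> powr b * exp (c * sqrt \<Lambda>))) \<longlongrightarrow> 1) at_top"
    using C by simp
qed

context circle_method
begin

text \<open>Insertion of saddle = q / sqrt n with q = pi sqrt(k/6): a power e of the saddle becomes
  a power -e/2 of n, and k pi^2/(3q) = pi sqrt(2k/3).\<close>

lemma coefficient_asymp_floor:
  fixes C e c :: real
  defines "e \<equiv> real k / 2 - \<beta> + 3 / 2"
  assumes C: "C = sqrt (6 / (real k * pi)) / (2 * pi) * exp (- (real k * ln (2 * pi) / 2)) * \<kappa> * (pi * sqrt (real k / 6)) powr e"
    and c: "c = pi * sqrt (2 * real k / 3)" and b: "b = - e / 2"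
  shows "(\<lambda>\<Lambda>. a (nat \<lfloor>\<Lambda>\<rfloor>)) \<sim>[at_top] (\<lambda>\<Lambda>. C * \<Lambda> powr b * exp (c * sqrt \<Lambda>))"
proof (rule asymp_equiv_floor)
  show "C > 0" unfolding C using k_pos \<kappa>_pos by (intro mult_pos_pos divide_pos_pos) auto
  have "(\<lambda>n. a n / (saddle n powr e * exp (real k * pi\<^sup>2 / (3 * saddle n))) * (pi * sqrt (real k / 6)) powr e) \<longlonglongrightarrow> C"
    unfolding C e_def by (intro tendsto_mult coefficient_asymp tendsto_const)
  moreover have "\<forall>\<^sub>F n in sequentially. a n / (saddle n powr e * exp (real k * pi\<^sup>2 / (3 * saddle n))) * (pi * sqrt (real k / 6)) powr e
     = a n / (real n powr b * exp (c * sqrt (real n)))"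
    using eventually_gt_at_top[of 0]
  proof eventually_elim
    case (elim n)
    define q where "q = pi * sqrt (real k / 6)"
    have q: "q > 0" using k_pos by (simp add: q_def)
    have s: "saddle n = q / sqrt (real n)"
      by (simp add: saddle_def q_def real_sqrt_divide real_sqrt_mult)
    have "sqrt (real n) powr e = real n powr (e / 2)"
      using elim by (simp add: powr_half_sqrt[symmetric] powr_powr)
    then have "saddle n powr e = q powr e * real n powr b"
      unfolding s b using q by (simp add: powr_divide powr_minus_divide)
    moreover have "real k * pi\<^sup>2 / (3 * saddle n) = c * sqrt (real n)"
    proof -
      have "real k * pi\<^sup>2 / (3 * saddle n) = real k * pi\<^sup>2 / (3 * q) * sqrt (real n)"
        unfolding s using q elim by simp
      also have "real k * pi\<^sup>2 / (3 * q) = c"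
      proof -
        have "c * (3 * q) = 3 * pi\<^sup>2 * sqrt (2 * real k / 3 * (real k / 6))"
          unfolding real_sqrt_mult[of "2 * real k / 3" "real k / 6"] by (simp add: c q_def power2_eq_square)
        also have "2 * real k / 3 * (real k / 6) = (real k / 3)\<^sup>2" by (simp add: power2_eq_square)
        also have "sqrt ((real k / 3)\<^sup>2) = real k / 3" by simp
        finally have "real k * pi\<^sup>2 = c * (3 * q)" by simp
        then show ?thesis using q by simp
      qed
      finally show ?thesis .
    qed
    ultimately show ?case using q by (simp add: q_def[symmetric])
  qed
  ultimately show "(\<lambda>n. a n / (real n powr b * exp (c * sqrt (real n)))) \<longlonglongrightarrow> C"
    by (rule Lim_transform_eventually)
qed

end

section \<open>Asymptotics of the three cumulative counts\<close>

lemma suminf_partitions: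
  fixes w :: complex assumes "norm w < 1"
  shows "(\<Sum>n. of_real (real (partitions n)) * w ^ n) = exp (log_partition w)"
  using partitions_sums[OF assms] by (simp add: sums_iff)

lemma exp_twice: "exp (of_nat 2 * z) = exp z * exp (z :: complex)"
  by (simp only: of_nat_numeral mult_2 exp_add)

lemma geometric_asymp: "((\<lambda>x::real. (\<Sum>n. 1 * exp (- x) ^ n) * x powr 1) \<longlongrightarrow> 1) (at_right 0)"
proof -
  have "((\<lambda>x::real. 1 / (1 - exp (- x)) * x) \<longlongrightarrow> 1) (at_right 0)" by real_asymp
  moreover have "\<forall>\<^sub>F x::real in at_right 0. x > 0" by real_asymp
  then have "\<forall>\<^sub>F x::real in at_right 0. 1 / (1 - exp (- x)) * x = (\<Sum>n. 1 * exp (- x) ^ n) * x powr 1"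
    by eventually_elim (simp add: suminf_geometric)
  ultimately show ?thesis by (rule Lim_transform_eventually)
qed

text \<open>Cumulative sums multiply the generating function by 1/(1-w), which is ~ 1/x. So k = 1,
  \<beta> = 1, the saddle has exponent 1 and \<Lambda> the exponent -1/2.\<close>

lemma partitions_count_asymp:
  "(\<lambda>\<Lambda>. cumulative partitions (nat \<lfloor>\<Lambda>\<rfloor>)) \<sim>[at_top]
     (\<lambda>\<Lambda>. 1 / (2 * pi * sqrt 2) * \<Lambda> powr (- 1 / 2) * exp (pi * sqrt (2 * \<Lambda> / 3)))"
proof -
  interpret circle_method 1 "cumulative partitions" "\<lambda>_. 1" 1 1
  proof
    show "(\<lambda>n. complex_of_real (cumulative partitions n) * w ^ n) sums
         (exp (of_nat 1 * log_partition w) * (\<Sum>n. of_real 1 * w ^ n))" if "norm w < 1" for w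
      using conv_sums[OF subexponential_one subexponential_partitions that] suminf_partitions[OF that]
      by (simp add: mult.commute)
    show "cumulative partitions n \<ge> 0" for n
      by (intro subexponential_nonneg subexponential_conv subexponential_one subexponential_partitions)
    show "summable (\<lambda>n. 1 * r ^ n)" if "0 \<le> r" "r < 1" for r :: real
      using that by simp
  qed (use geometric_asymp in auto)
  have C: "1 / (2 * pi * sqrt 2) = sqrt (6 / (real 1 * pi)) / (2 * pi) * exp (- (real 1 * ln (2 * pi) / 2)) * 1 * (pi * sqrt (real 1 / 6)) powr (real 1 / 2 - 1 + 3 / 2)"
  proof -
    have "exp (- (real 1 * ln (2 * pi) / 2)) = 1 / sqrt (2 * pi)"
    proof -
      have "exp (ln (2 * pi) / 2) = exp (ln (sqrt (2 * pi)))" by (subst ln_sqrt) auto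
      then show ?thesis by (simp add: exp_minus inverse_eq_divide)
    qed
    moreover have "(pi * sqrt (real 1 / 6)) powr (real 1 / 2 - 1 + 3 / 2) = pi / sqrt 6"
      by (simp add: real_sqrt_divide)
    ultimately show ?thesis by (simp add: real_sqrt_divide real_sqrt_mult)
  qed
  have "(\<lambda>\<Lambda>. cumulative partitions (nat \<lfloor>\<Lambda>\<rfloor>)) \<sim>[at_top]
     (\<lambda>\<Lambda>. 1 / (2 * pi * sqrt 2) * \<Lambda> powr (- 1 / 2) * exp (pi * sqrt (2 * real 1 / 3) * sqrt \<Lambda>))"
    by (rule coefficient_asymp_floor[OF C refl]) simp
  then show ?thesis by (simp add: real_sqrt_mult[symmetric] mult.assoc)
qed

text \<open>Here k = 2 and \<beta> = 1, so the saddle has exponent 3/2 and \<Lambda> the exponent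
  -3/4.\<close>

lemma bipartitions_count_asymp:
  "(\<lambda>\<Lambda>. cumulative (conv partitions partitions) (nat \<lfloor>\<Lambda>\<rfloor>)) \<sim>[at_top]
     (\<lambda>\<Lambda>. 1 / (4 * pi * 3 powr (1 / 4)) * \<Lambda> powr (- 3 / 4) * exp (2 * pi * sqrt (\<Lambda> / 3)))"
proof -
  note se = subexponential_one subexponential_partitions subexponential_conv
  interpret circle_method 2 "cumulative (conv partitions partitions)" "\<lambda>_. 1" 1 1
  proof
    show "(\<lambda>n. complex_of_real (cumulative (conv partitions partitions) n) * w ^ n) sums
         (exp (of_nat 2 * log_partition w) * (\<Sum>n. of_real 1 * w ^ n))" if w: "norm w < 1" for w
      using conv_sums[OF se(1) se(3)[OF se(2) se(2)] w] conv_sums[OF se(2) se(2) w] suminf_partitions[OF w]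
      unfolding exp_twice by (simp add: sums_iff mult.commute)
    show "cumulative (conv partitions partitions) n \<ge> 0" for n
      by (intro subexponential_nonneg se)
    show "summable (\<lambda>n. 1 * r ^ n)" if "0 \<le> r" "r < 1" for r :: real
      using that by simp
  qed (use geometric_asymp in auto)
  have C: "1 / (4 * pi * 3 powr (1 / 4)) = sqrt (6 / (real 2 * pi)) / (2 * pi) * exp (- (real 2 * ln (2 * pi) / 2)) * 1 * (pi * sqrt (real 2 / 6)) powr (real 2 / 2 - 1 + 3 / 2)"
    (is "?l = ?r")
  proof -
    have "ln (4::real) = 2 * ln 2" using ln_realpow[of "2::real" 2] by simp
    moreover have "?r = sqrt (3 / pi) / (2 * pi) * exp (- ln (2 * pi)) * (pi * sqrt (1 / 3)) powr (3 / 2)" by simp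
    \<comment> \<open>The fractional powers of 3 and pi are compared through logarithms.\<close>
    ultimately have "ln ?l = ln ?r"
      by (simp add: ln_mult ln_div ln_powr ln_sqrt add_divide_distrib diff_divide_distrib)
    moreover have "?l > 0" "?r > 0" by (auto intro!: mult_pos_pos divide_pos_pos)
    ultimately show ?thesis by (simp only: ln_inj_iff)
  qed
  have s: "pi * sqrt (2 * real 2 / 3) * sqrt \<Lambda> = 2 * pi * sqrt (\<Lambda> / 3)" for \<Lambda>
    by (simp add: real_sqrt_divide)
  have "(\<lambda>\<Lambda>. cumulative (conv partitions partitions) (nat \<lfloor>\<Lambda>\<rfloor>)) \<sim>[at_top]
     (\<lambda>\<Lambda>. 1 / (4 * pi * 3 powr (1 / 4)) * \<Lambda> powr (- 3 / 4) * exp (pi * sqrt (2 * real 2 / 3) * sqrt \<Lambda>))"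
    by (rule coefficient_asymp_floor[OF C refl]) simp
  then show ?thesis unfolding s .
qed

text \<open>The theta series joins 1/(1-w) in the factor of power growth, which becomes ~ sqrt pi
  x^(-3/2). So \<beta> = 3/2, and the exponent of \<Lambda> rises from -3/4 to -1/2.\<close>

lemma theta_bipartitions_count_asymp:
  "(\<lambda>\<Lambda>. cumulative (conv square_count (conv partitions partitions)) (nat \<lfloor>\<Lambda>\<rfloor>)) \<sim>[at_top]
     (\<lambda>\<Lambda>. 1 / (4 * pi) * \<Lambda> powr (- 1 / 2) * exp (2 * pi * sqrt (\<Lambda> / 3)))"
proof -
  note se = subexponential_one subexponential_partitions subexponential_square_count subexponential_conv
  note se2 = se(4)[OF se(2) se(2)]
  interpret circle_method 2 "cumulative (conv square_count (conv partitions partitions))"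
    "cumulative square_count" "3 / 2" "sqrt pi"
  proof
    show "(\<lambda>n. complex_of_real (cumulative (conv square_count (conv partitions partitions)) n) * w ^ n) sums
         (exp (of_nat 2 * log_partition w) * (\<Sum>n. of_real (cumulative square_count n) * w ^ n))" if w: "norm w < 1" for w
      using conv_sums[OF se(1) se(4)[OF se(3) se2] w] conv_sums[OF se(3) se2 w] conv_sums[OF se(2) se(2) w]
        conv_sums[OF se(1) se(3) w] suminf_partitions[OF w]
      unfolding exp_twice by (simp add: sums_iff mult_ac)
    have "((\<lambda>x::real. ((\<Sum>n. 1 * exp (- x) ^ n) * x powr 1) * ((\<Sum>n. square_count n * exp (- x) ^ n) * sqrt x)) \<longlongrightarrow> 1 * sqrt pi) (at_right 0)"
      by (intro tendsto_mult geometric_asymp theta_asymp)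
    moreover have "\<forall>\<^sub>F x::real in at_right 0. x > 0" by real_asymp
    then have "\<forall>\<^sub>F x::real in at_right 0. ((\<Sum>n. 1 * exp (- x) ^ n) * x powr 1) * ((\<Sum>n. square_count n * exp (- x) ^ n) * sqrt x)
        = (\<Sum>n. cumulative square_count n * exp (- x) ^ n) * x powr (3 / 2)"
    proof eventually_elim
      case (elim x)
      have "x powr (3 / 2) = x powr (1 + 1 / 2)" by simp
      also have "\<dots> = x powr 1 * sqrt x" using elim by (simp only: powr_add powr_half_sqrt less_imp_le)
      finally show ?case
        using conv_sums[OF se(1) se(3), of "exp (- x)"] elim by (simp add: sums_iff mult_ac)
    qed
    ultimately have "((\<lambda>x. (\<Sum>n. cumulative square_count n * exp (- x) ^ n) * x powr (3 / 2)) \<longlongrightarrow> 1 * sqrt pi) (at_right 0)"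
      by (rule Lim_transform_eventually)
    then show "((\<lambda>x. (\<Sum>n. cumulative square_count n * exp (- x) ^ n) * x powr (3 / 2)) \<longlongrightarrow> sqrt pi) (at_right 0)"
      by simp
    show "cumulative (conv square_count (conv partitions partitions)) n \<ge> 0" for n
      by (rule subexponential_nonneg[OF se(4)[OF se(1) se(4)[OF se(3) se2]]])
    show "cumulative square_count n \<ge> 0" for n
      by (rule subexponential_nonneg[OF se(4)[OF se(1) se(3)]])
    show "summable (\<lambda>n. cumulative square_count n * r ^ n)" if "0 \<le> r" "r < 1" for r
      by (rule subexponential_summable[OF se(4)[OF se(1) se(3)] that])
  qed auto
  have C: "1 / (4 * pi) = sqrt (6 / (real 2 * pi)) / (2 * pi) * exp (- (real 2 * ln (2 * pi) / 2)) * sqrt pi * (pi * sqrt (real 2 / 6)) powr (real 2 / 2 - 3 / 2 + 3 / 2)"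
  proof -
    have "sqrt (6 / (real 2 * pi)) = sqrt 3 / sqrt pi" by (simp add: real_sqrt_divide[symmetric])
    moreover have "exp (- (real 2 * ln (2 * pi) / 2)) = 1 / (2 * pi)" by (simp add: exp_minus inverse_eq_divide)
    moreover have "(pi * sqrt (real 2 / 6)) powr (real 2 / 2 - 3 / 2 + 3 / 2) = pi / sqrt 3"
      by (simp add: real_sqrt_divide)
    moreover have "sqrt 3 / sqrt pi / (2 * pi) * (1 / (2 * pi)) * sqrt pi * (pi / sqrt 3) = 1 / (4 * pi)" by simp
    ultimately show ?thesis by (simp only:)
  qed
  have s: "pi * sqrt (2 * real 2 / 3) * sqrt \<Lambda> = 2 * pi * sqrt (\<Lambda> / 3)" for \<Lambda>
    by (simp add: real_sqrt_divide)
  have "(\<lambda>\<Lambda>. cumulative (conv square_count (conv partitions partitions)) (nat \<lfloor>\<Lambda>\<rfloor>)) \<sim>[at_top]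
     (\<lambda>\<Lambda>. 1 / (4 * pi) * \<Lambda> powr (- 1 / 2) * exp (pi * sqrt (2 * real 2 / 3) * sqrt \<Lambda>))"
    by (rule coefficient_asymp_floor[OF C refl]) simp
  then show ?thesis unfolding s .
qed

section \<open>Weights as partitions\<close>

text \<open>Young diagrams with m boxes and at most r rows, padded by zeros. They are extensional
  like the weights, so that level sets of a dual can be equal to such a set and not merely in
  bijection with it.\<close>

definition young :: "nat \<Rightarrow> nat \<Rightarrow> (nat \<Rightarrow> int) set" where
  "young r m = {l \<in> {1..r} \<rightarrow>\<^sub>E UNIV. (\<forall>i\<in>{1..r}. 0 \<le> l i) \<and> antimono_on {1..r} l \<and> (\<Sum>i=1..r. l i) = int m}"

lemma young_Suc_zero_bij:
  "bij_betw (\<lambda>l. restrict l {1..r}) {l \<in> young (Suc r) m. l (Suc r) = 0} (young r m)"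
proof (rule bij_betw_byWitness[where f' = "\<lambda>l. l(Suc r := 0)"])
  show "\<forall>l\<in>{l \<in> young (Suc r) m. l (Suc r) = 0}. (restrict l {1..r})(Suc r := 0) = l"
    by (auto simp: young_def fun_eq_iff PiE_def extensional_def)
  show "\<forall>l\<in>young r m. restrict (l(Suc r := 0)) {1..r} = l"
    by (auto simp: young_def fun_eq_iff PiE_def extensional_def)
  show "(\<lambda>l. restrict l {1..r}) ` {l \<in> young (Suc r) m. l (Suc r) = 0} \<subseteq> young r m"
    by (auto simp: young_def monotone_on_def)
  show "(\<lambda>l. l(Suc r := 0)) ` young r m \<subseteq> {l \<in> young (Suc r) m. l (Suc r) = 0}"
    by (auto simp: young_def monotone_on_def PiE_def extensional_def)
qed

text \<open>If the last row is not empty, the first column has full length r+1 and can be removed.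
  This is the conjugate of removing a part r+1.\<close>

lemma young_Suc_pos_bij:
  assumes "Suc r \<le> m"
  shows "bij_betw (\<lambda>l. \<lambda>i\<in>{1..Suc r}. l i - 1) {l \<in> young (Suc r) m. l (Suc r) \<noteq> 0} (young (Suc r) (m - Suc r))"
proof (rule bij_betw_byWitness[where f' = "\<lambda>l. \<lambda>i\<in>{1..Suc r}. l i + 1"])
  show "\<forall>l\<in>{l \<in> young (Suc r) m. l (Suc r) \<noteq> 0}. (\<lambda>i\<in>{1..Suc r}. (\<lambda>i\<in>{1..Suc r}. l i - 1) i + 1) = l"
    by (auto simp: young_def fun_eq_iff PiE_def extensional_def)
  show "\<forall>l\<in>young (Suc r) (m - Suc r). (\<lambda>i\<in>{1..Suc r}. (\<lambda>i\<in>{1..Suc r}. l i + 1) i - 1) = l"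
    by (auto simp: young_def fun_eq_iff PiE_def extensional_def)
  show "(\<lambda>l. \<lambda>i\<in>{1..Suc r}. l i - 1) ` {l \<in> young (Suc r) m. l (Suc r) \<noteq> 0} \<subseteq> young (Suc r) (m - Suc r)"
  proof (rule image_subsetI)
    fix l assume l: "l \<in> {l \<in> young (Suc r) m. l (Suc r) \<noteq> 0}"
    have "0 \<le> l i - 1" if i: "i \<in> {1..Suc r}" for i
    proof -
      have "l (Suc r) \<le> l i" "0 \<le> l (Suc r)" using l i by (auto simp: young_def monotone_on_def)
      with l show ?thesis by auto
    qed
    moreover have "(\<Sum>i=1..Suc r. l i - 1) = int (m - Suc r)"
      using l assms by (simp only: sum_subtractf) (simp add: young_def of_nat_diff)
    moreover have "antimono_on {1..Suc r} (\<lambda>i\<in>{1..Suc r}. l i - 1)"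
    proof (rule monotone_onI)
      fix x y assume xy: "x \<in> {1..Suc r}" "y \<in> {1..Suc r}" "x \<le> y"
      then have "l y \<le> l x" using l by (auto simp: young_def monotone_on_def)
      with xy show "(\<lambda>i\<in>{1..Suc r}. l i - 1) y \<le> (\<lambda>i\<in>{1..Suc r}. l i - 1) x" by simp
    qed
    ultimately show "(\<lambda>i\<in>{1..Suc r}. l i - 1) \<in> young (Suc r) (m - Suc r)"
      by (auto simp: young_def)
  qed
  show "(\<lambda>l. \<lambda>i\<in>{1..Suc r}. l i + 1) ` young (Suc r) (m - Suc r) \<subseteq> {l \<in> young (Suc r) m. l (Suc r) \<noteq> 0}"
  proof (rule image_subsetI)
    fix l assume l: "l \<in> young (Suc r) (m - Suc r)"
    have "(\<Sum>i=1..Suc r. l i + 1) = int m"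
      using l assms by (simp only: sum.distrib) (simp add: young_def of_nat_diff)
    moreover have "l (Suc r) \<ge> 0" using l by (auto simp: young_def)
    then have "l (Suc r) + 1 \<noteq> 0" by linarith
    ultimately show "(\<lambda>i\<in>{1..Suc r}. l i + 1) \<in> {l \<in> young (Suc r) m. l (Suc r) \<noteq> 0}"
      using l by (auto simp: young_def monotone_on_def)
  qed
qed

lemma young_Suc_pos_empty:
  assumes "\<not> Suc r \<le> m"
  shows "{l \<in> young (Suc r) m. l (Suc r) \<noteq> 0} = {}"
proof -
  have False if l: "l \<in> young (Suc r) m" "l (Suc r) \<noteq> 0" for l
  proof -
    have "1 \<le> l i" if i: "i \<in> {1..Suc r}" for i
    proof -
      have "l (Suc r) \<le> l i" "0 \<le> l (Suc r)" using l i by (auto simp: young_def monotone_on_def)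
      with l show ?thesis by auto
    qed
    then have "(\<Sum>i=1..Suc r. 1) \<le> (\<Sum>i=1..Suc r. l i)" by (intro sum_mono) auto
    with l assms show False by (simp add: young_def)
  qed
  then show ?thesis by auto
qed

lemma finite_card_young: "finite (young r m) \<and> card (young r m) = bounded_partitions r m"
proof (induction r arbitrary: m)
  case 0
  have "young 0 m = (if m = 0 then {\<lambda>_. undefined} else {})" by (auto simp: young_def monotone_on_def)
  then show ?case by simp
next
  case (Suc r)
  note IH = Suc
  show ?case
  proof (induction m rule: less_induct)
    case (less m)
    have split: "young (Suc r) m = {l \<in> young (Suc r) m. l (Suc r) = 0} \<union> {l \<in> young (Suc r) m. l (Suc r) \<noteq> 0}" by auto
    have disj: "{l \<in> young (Suc r) m. l (Suc r) = 0} \<inter> {l \<in> young (Suc r) m. l (Suc r) \<noteq> 0} = {}" by auto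
    have A: "finite {l \<in> young (Suc r) m. l (Suc r) = 0}"
       "card {l \<in> young (Suc r) m. l (Suc r) = 0} = bounded_partitions r m"
      using IH[of m] bij_betw_finite[OF young_Suc_zero_bij[of r m]] bij_betw_same_card[OF young_Suc_zero_bij[of r m]] by auto
    show ?case
    proof (cases "Suc r \<le> m")
      case True
      have B: "finite {l \<in> young (Suc r) m. l (Suc r) \<noteq> 0}"
         "card {l \<in> young (Suc r) m. l (Suc r) \<noteq> 0} = bounded_partitions (Suc r) (m - Suc r)"
        using less[of "m - Suc r"] True bij_betw_finite[OF young_Suc_pos_bij[OF True]] bij_betw_same_card[OF young_Suc_pos_bij[OF True]] by auto
      show ?thesis
        by (subst (1 2) split) (use A B True disj in \<open>simp add: card_Un_disjoint bounded_partitions_Suc_ge\<close>)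
    next
      case False
      show ?thesis
      proof -
        have "young (Suc r) m = {l \<in> young (Suc r) m. l (Suc r) = 0}" using young_Suc_pos_empty[OF False] by auto
        then show ?thesis using A False by (simp add: bounded_partitions_Suc_less)
      qed
    qed
  qed
qed

lemmas finite_young = finite_card_young[THEN conjunct1]
  and card_young = finite_card_young[THEN conjunct2]

text \<open>Witnessed by the partition into ones. Positivity makes every natural number an atom of
  the limit measure.\<close>

lemma partitions_pos: "partitions n > 0"
proof (cases "n = 0")
  case False
  have "bounded_partitions 1 m > 0" for m
  proof (induction m)
    case 0
    then show ?case using bounded_partitions_Suc_less[of 0 0] by simp
  next
    case (Suc m)
    then show ?case using bounded_partitions_Suc_ge[of 0 "Suc m"] by simp
  qed
  then show ?thesis using bounded_partitions_le[of 1 n] by (metis less_le_trans)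
qed (simp add: partitions_def)

text \<open>For large N, \<open>c\<close> is close to the integer-valued \<open>sz\<close> as long
  as \<open>sz\<close> stays bounded, and \<open>tight\<close> provides such a bound. Since
  \<Lambda> is not an integer, the condition c <= \<Lambda> is then the same as \<open>sz\<close>
  being at most the integer part of \<Lambda>, so the counts agree exactly.\<close>

lemma counting_limit:
  fixes D :: "nat \<Rightarrow> 'b set" and c :: "nat \<Rightarrow> 'b \<Rightarrow> real" and sz :: "nat \<Rightarrow> 'b \<Rightarrow> nat" and a :: "nat \<Rightarrow> nat"
  assumes count: "\<And>m. \<forall>\<^sub>F N in F. finite {l \<in> D N. sz N l = m} \<and> card {l \<in> D N. sz N l = m} = a m"
    and tight: "\<And>\<Lambda>. \<exists>K. \<forall>\<^sub>F N in F. \<forall>l\<in>D N. c N l \<le> \<Lambda> \<longrightarrow> sz N l \<le> K"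
    and close: "\<And>K \<epsilon>. \<epsilon> > 0 \<Longrightarrow> \<forall>\<^sub>F N in F. \<forall>l\<in>D N. sz N l \<le> K \<longrightarrow> \<bar>c N l - real (sz N l)\<bar> \<le> \<epsilon>"
    and \<Lambda>: "\<Lambda> \<ge> 0" "\<And>n :: nat. \<Lambda> \<noteq> real n"
  shows "\<forall>\<^sub>F N in F. finite {l \<in> D N. c N l \<le> \<Lambda>} \<and> card {l \<in> D N. c N l \<le> \<Lambda>} = (\<Sum>m\<le>nat \<lfloor>\<Lambda>\<rfloor>. a m)"
proof -
  define n where "n = nat \<lfloor>\<Lambda>\<rfloor>"
  have "real n \<le> \<Lambda>" "\<Lambda> < real n + 1" using \<Lambda>(1) by (auto simp: n_def)
  with \<Lambda>(2)[of n] have n: "real n < \<Lambda>" "\<Lambda> < real n + 1" by auto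
  \<comment> \<open>Half the distance from \<Lambda> to the nearest integer.\<close>
  define \<epsilon> where "\<epsilon> = min (\<Lambda> - real n) (real n + 1 - \<Lambda>) / 2"
  have \<epsilon>: "\<epsilon> > 0" "real n + \<epsilon> \<le> \<Lambda>" "\<Lambda> + \<epsilon> < real n + 1" using n by (auto simp: \<epsilon>_def min_def field_simps)
  obtain K where K: "\<forall>\<^sub>F N in F. \<forall>l\<in>D N. c N l \<le> \<Lambda> \<longrightarrow> sz N l \<le> K" using tight by blast
  have "\<forall>\<^sub>F N in F. \<forall>m\<in>{..n}. finite {l \<in> D N. sz N l = m} \<and> card {l \<in> D N. sz N l = m} = a m"
    by (intro eventually_ball_finite) (use count in auto)
  then show ?thesis
    \<comment> \<open>One direction knows sz <= K, the other sz <= n; the maximum covers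
      both.\<close>
    using K close[OF \<epsilon>(1), of "max K n"]
  proof eventually_elim
    case (elim N)
    have "c N l \<le> \<Lambda> \<longleftrightarrow> sz N l \<le> n" if l: "l \<in> D N" for l
    proof
      assume c: "c N l \<le> \<Lambda>"
      then have "\<bar>c N l - real (sz N l)\<bar> \<le> \<epsilon>" using elim l by auto
      then have "real (sz N l) < real n + 1" using c \<epsilon> by linarith
      then show "sz N l \<le> n" by linarith
    next
      assume s: "sz N l \<le> n"
      then have "\<bar>c N l - real (sz N l)\<bar> \<le> \<epsilon>" using elim l by auto
      moreover have "real (sz N l) \<le> real n" using s by simp
      ultimately show "c N l \<le> \<Lambda>" using \<epsilon> by linarith
    qed
    then have eq: "{l \<in> D N. c N l \<le> \<Lambda>} = (\<Union>m\<in>{..n}. {l \<in> D N. sz N l = m})" by auto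
    have "card (\<Union>m\<in>{..n}. {l \<in> D N. sz N l = m}) = (\<Sum>m\<in>{..n}. card {l \<in> D N. sz N l = m})"
      by (rule card_UN_disjoint) (use elim in auto)
    then show ?case unfolding eq n_def[symmetric] using elim by auto
  qed
qed

text \<open>Chebyshev's sum inequality for the increasing indices and the nonincreasing entries. In
  the induction the new entry is at most the mean of the earlier ones.\<close>

lemma antimono_weighted_sum_le:
  fixes l :: "nat \<Rightarrow> real"
  assumes "antimono_on {1..r} l"
  shows "2 * (\<Sum>i=1..r. real i * l i) \<le> (real r + 1) * (\<Sum>i=1..r. l i)"
  using assms
proof (induction r)
  case (Suc r)
  have "(\<Sum>i=1..r. l (Suc r)) \<le> (\<Sum>i=1..r. l i)"
    using Suc.prems by (intro sum_mono) (auto simp: monotone_on_def)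
  then have "real r * l (Suc r) \<le> (\<Sum>i=1..r. l i)" by simp
  moreover have "antimono_on {1..r} l" using Suc.prems by (auto simp: monotone_on_def)
  ultimately show ?case using Suc.IH by (simp add: algebra_simps)
qed simp

text \<open>The coefficients x - 2i have mean x - r - 1 and decrease with i like the entries, so
  replacing them by their mean can only lower the sum.\<close>

lemma casimir_sum_lower:
  fixes l :: "nat \<Rightarrow> real" and x :: real
  assumes "antimono_on {1..r} l"
  shows "(\<Sum>i=1..r. l i * (x - 2 * real i)) \<ge> (x - real r - 1) * (\<Sum>i=1..r. l i)"
proof -
  have "(\<Sum>i=1..r. l i * (x - 2 * real i)) = x * (\<Sum>i=1..r. l i) - 2 * (\<Sum>i=1..r. real i * l i)"
    by (simp add: right_diff_distrib sum_subtractf sum_distrib_left mult_ac)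
  then show ?thesis using antimono_weighted_sum_le[OF assms] by (simp add: algebra_simps)
qed

text \<open>If row i is not empty, then rows 1 to i contain at least i boxes. So both i and the
  entry are at most S, and the bracket is at most 3S + 2, independently of r.\<close>

lemma casimir_sum_close:
  fixes l :: "nat \<Rightarrow> int" and d :: real
  assumes l: "\<And>i. i \<in> {1..r} \<Longrightarrow> 0 \<le> l i" "antimono_on {1..r} l" and d: "\<bar>d\<bar> \<le> 2"
  defines "S \<equiv> real_of_int (\<Sum>i=1..r. l i)"
  shows "\<bar>\<Sum>i=1..r. real_of_int (l i) * (real_of_int (l i) + d - 2 * real i)\<bar> \<le> S * (3 * S + 2)"
proof -
  have "\<bar>real_of_int (l i) * (real_of_int (l i) + d - 2 * real i)\<bar> \<le> real_of_int (l i) * (3 * S + 2)" if i: "i \<in> {1..r}" for i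
  proof (cases "l i = 0")
    case False
    then have li: "l i \<ge> 1" using l(1)[OF i] by linarith
    have "l i \<le> (\<Sum>i=1..r. l i)" using l i by (intro member_le_sum) auto
    then have 1: "real_of_int (l i) \<le> S" unfolding S_def by (simp only: of_int_le_iff)
    have "1 \<le> l j" if "j \<in> {1..i}" for j
    proof -
      have "l i \<le> l j" using l(2) i that by (auto simp: monotone_on_def)
      with li show ?thesis by linarith
    qed
    then have "(\<Sum>j=1..i. 1) \<le> (\<Sum>j=1..i. l j)" by (intro sum_mono) auto
    also have "\<dots> \<le> (\<Sum>j=1..r. l j)" using l i by (intro sum_mono2) auto
    finally have "real_of_int (int i) \<le> S" unfolding S_def by (subst of_int_le_iff) simp
    then have 2: "real i \<le> S" by simp
    have "\<bar>real_of_int (l i) + d - 2 * real i\<bar> \<le> 3 * S + 2" using 1 2 d li by linarith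
    then show ?thesis unfolding abs_mult using li by (intro mult_mono) auto
  qed simp
  then have "\<bar>\<Sum>i=1..r. real_of_int (l i) * (real_of_int (l i) + d - 2 * real i)\<bar> \<le> (\<Sum>i=1..r. real_of_int (l i) * (3 * S + 2))"
    by (intro order_trans[OF sum_abs] sum_mono) auto
  also have "\<dots> = S * (3 * S + 2)" by (simp add: S_def sum_distrib_right)
  finally show ?thesis .
qed

lemma eventually_size_at_top:
  assumes "\<And>N. N \<ge> N0 \<Longrightarrow> admissible \<tau> N \<Longrightarrow> P N"
  shows "\<forall>\<^sub>F N in size_at_top \<tau>. P N"
  unfolding size_at_top_def eventually_inf_principal
  using eventually_ge_at_top[of N0] by (rule eventually_mono) (use assms in auto)

lemma eventually_size_small:
  assumes "\<epsilon> > 0"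
  shows "\<forall>\<^sub>F N in size_at_top \<tau>. B / real N \<le> \<epsilon>"
proof -
  have "(\<lambda>N. B / real N) \<longlonglongrightarrow> 0" by real_asymp
  then have "\<forall>\<^sub>F N in sequentially. B / real N < \<epsilon>" using assms by (rule order_tendstoD)
  then show ?thesis unfolding size_at_top_def eventually_inf_principal
    by eventually_elim simp
qed

text \<open>The last entry of a weight of type D may be negative; its sign affects neither the
  Casimir number, since its linear coefficient \<open>N - 2 * r\<close> vanishes, nor the absolute sum.\<close>

definition orthosymplectic_sum :: "nat \<Rightarrow> nat \<Rightarrow> real \<Rightarrow> (nat \<Rightarrow> int) \<Rightarrow> real" where
  "orthosymplectic_sum r N d l = (\<Sum>i=1..r. real_of_int (l i) * (real_of_int (l i) + real N + d - 2 * real i)) / real N"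

definition abs_sum :: "nat \<Rightarrow> (nat \<Rightarrow> int) \<Rightarrow> int" where
  "abs_sum r l = (\<Sum>i=1..r. \<bar>l i\<bar>)"

text \<open>The first bound controls the size by the Casimir number, the second says that they agree
  up to O(1/N). The mean coefficient N + d - r - 1 is about N/2 when r is about N/2; asking only for
  N/4 leaves room for small N.\<close>

lemma orthosymplectic_sum_bounds:
  assumes l: "\<And>i. i \<in> {1..r} \<Longrightarrow> 0 \<le> l i" "antimono_on {1..r} l"
    and d: "\<bar>d\<bar> \<le> 2" and N: "N \<ge> 1" "4 * (real N + d - real r - 1) \<ge> real N"
  defines "S \<equiv> real_of_int (abs_sum r l)"
  shows "orthosymplectic_sum r N d l \<ge> S / 4"
    and "\<bar>orthosymplectic_sum r N d l - S\<bar> \<le> S * (3 * S + 2) / real N"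
proof -
  have S: "S = (\<Sum>i=1..r. real_of_int (l i))" using l by (simp add: S_def abs_sum_def)
  have S0: "S \<ge> 0" unfolding S using l by (intro sum_nonneg) auto
  have mono: "antimono_on {1..r} (\<lambda>i. real_of_int (l i))" using l by (auto simp: monotone_on_def)
  have "real N / 4 * S \<le> (real N + d - real r - 1) * S" using N S0 by (intro mult_right_mono) auto
  also have "\<dots> \<le> (\<Sum>i=1..r. real_of_int (l i) * (real N + d - 2 * real i))"
    unfolding S by (rule casimir_sum_lower[OF mono])
  also have "\<dots> \<le> (\<Sum>i=1..r. real_of_int (l i) * (real_of_int (l i) + real N + d - 2 * real i))"
    using l by (intro sum_mono mult_left_mono) auto
  finally show "orthosymplectic_sum r N d l \<ge> S / 4"
    using N by (simp add: orthosymplectic_sum_def field_simps)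
  have "orthosymplectic_sum r N d l - S = (\<Sum>i=1..r. real_of_int (l i) * (real_of_int (l i) + d - 2 * real i)) / real N"
  proof -
    have "(\<Sum>i=1..r. real_of_int (l i) * (real_of_int (l i) + real N + d - 2 * real i))
      = (\<Sum>i=1..r. real_of_int (l i) * (real_of_int (l i) + d - 2 * real i)) + real N * S"
      unfolding S by (simp add: sum_distrib_left sum.distrib[symmetric] algebra_simps)
    then show ?thesis using N by (simp add: orthosymplectic_sum_def field_simps)
  qed
  moreover have "S = real_of_int (\<Sum>i=1..r. l i)" by (simp add: S)
  ultimately show "\<bar>orthosymplectic_sum r N d l - S\<bar> \<le> S * (3 * S + 2) / real N"
    using casimir_sum_close[of r l d] l d by (simp add: divide_right_mono)
qed

definition abs_weight :: "nat \<Rightarrow> (nat \<Rightarrow> int) \<Rightarrow> nat" where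
  "abs_weight r l = nat (abs_sum r l)"

lemma abs_weight_real: "real (abs_weight r l) = real_of_int (abs_sum r l)"
  by (simp add: abs_weight_def abs_sum_def sum_nonneg)

lemma abs_sum_abs: "abs_sum r (\<lambda>i. \<bar>l i\<bar>) = abs_sum r l"
  by (simp add: abs_sum_def)

section \<open>Types B, C and D\<close>

lemma unitary_dual_BCD_abs:
  assumes "\<tau> \<in> {TypeB, TypeC, TypeD}" "l \<in> unitary_dual \<tau> N"
  shows "antimono_on {1..weight_length \<tau> N} (\<lambda>i. \<bar>l i\<bar>)"
proof (cases "\<tau> = TypeD")
  case True
  define r where "r = weight_length \<tau> N"
  have l: "0 \<le> l i" "\<bar>l r\<bar> \<le> l i" if "i \<in> {1..<r}" for i
    using assms(2) True that by (auto simp: Let_def r_def)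
  have mono: "l j \<le> l i" if "i \<in> {1..<r}" "j \<in> {1..<r}" "i \<le> j" for i j
    using assms(2) True that by (auto simp: Let_def r_def monotone_on_def)
  show ?thesis unfolding r_def[symmetric]
  proof (rule monotone_onI)
    fix i j assume ij: "i \<in> {1..r}" "j \<in> {1..r}" "i \<le> j"
    consider "i = r" "j = r" | "i \<in> {1..<r}" "j = r" | "i \<in> {1..<r}" "j \<in> {1..<r}"
      using ij by force
    then show "\<bar>l j\<bar> \<le> \<bar>l i\<bar>" using l[of i] l[of j] mono[of i j] ij(3) by cases auto
  qed
next
  case False
  then have l: "\<forall>i\<in>{1..weight_length \<tau> N}. 0 \<le> l i" "antimono_on {1..weight_length \<tau> N} l"
    using assms by (auto simp: Let_def)
  then show ?thesis unfolding monotone_on_def by simp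
qed

lemma casimir_BCD:
  assumes "\<tau> \<in> {TypeB, TypeC, TypeD}" "l \<in> unitary_dual \<tau> N" "admissible \<tau> N"
  shows "casimir \<tau> N l = orthosymplectic_sum (weight_length \<tau> N) N (if \<tau> = TypeC then 2 else 0) (\<lambda>i. \<bar>l i\<bar>)"
proof -
  have "casimir \<tau> N l = (\<Sum>i=1..weight_length \<tau> N. real_of_int (l i) * (real_of_int (l i) + real N + (if \<tau> = TypeC then 2 else 0) - 2 * real i)) / real N"
    using assms(1) by auto
  also have "(\<Sum>i=1..weight_length \<tau> N. real_of_int (l i) * (real_of_int (l i) + real N + (if \<tau> = TypeC then 2 else 0) - 2 * real i))
    = (\<Sum>i=1..weight_length \<tau> N. real_of_int \<bar>l i\<bar> * (real_of_int \<bar>l i\<bar> + real N + (if \<tau> = TypeC then 2 else 0) - 2 * real i))"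
  proof (rule sum.cong[OF refl])
    fix i assume i: "i \<in> {1..weight_length \<tau> N}"
    show "real_of_int (l i) * (real_of_int (l i) + real N + (if \<tau> = TypeC then 2 else 0) - 2 * real i)
      = real_of_int \<bar>l i\<bar> * (real_of_int \<bar>l i\<bar> + real N + (if \<tau> = TypeC then 2 else 0) - 2 * real i)"
    proof (cases "\<tau> = TypeD \<and> i = weight_length \<tau> N")
      case True
      then have "real N - 2 * real i = 0" using assms(3) by (auto elim!: evenE)
      then have "real_of_int x + real N + (if \<tau> = TypeC then 2 else 0) - 2 * real i = real_of_int x" for x
        using True by auto
      then show ?thesis by (simp only:)
    next
      case False
      then have "l i \<ge> 0" using assms i by (auto simp: Let_def)
      then show ?thesis by simp
    qed
  qed
  finally show ?thesis by (simp add: orthosymplectic_sum_def)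
qed

text \<open>With fewer boxes than rows the last entry vanishes. For type D this removes the choice
  of its sign, and all three types have the same level sets.\<close>

lemma unitary_dual_BCD_level:
  assumes "\<tau> \<in> {TypeB, TypeC, TypeD}" "m < weight_length \<tau> N"
  shows "{l \<in> unitary_dual \<tau> N. abs_weight (weight_length \<tau> N) l = m} = young (weight_length \<tau> N) m"
proof -
  define r where "r = weight_length \<tau> N"
  have W: "weights \<tau> N = {1..r} \<rightarrow>\<^sub>E UNIV" by (simp add: weights_def r_def)
  have abs_weight_eq: "abs_weight r l = m \<longleftrightarrow> (\<Sum>i=1..r. l i) = int m" if "\<forall>i\<in>{1..r}. 0 \<le> l i" for l
  proof -
    have "abs_sum r l = (\<Sum>i=1..r. l i)" "0 \<le> (\<Sum>i=1..r. l i)" using that by (auto simp: abs_sum_def intro!: sum_nonneg)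
    then show ?thesis by (auto simp: abs_weight_def)
  qed
  show ?thesis
  proof (cases "\<tau> = TypeD")
    case False
    then have "unitary_dual \<tau> N = {l \<in> {1..r} \<rightarrow>\<^sub>E UNIV. (\<forall>i\<in>{1..r}. 0 \<le> l i) \<and> antimono_on {1..r} l}"
      unfolding W[symmetric] using assms(1) by (auto simp: r_def Let_def)
    then show ?thesis unfolding r_def[symmetric] using abs_weight_eq by (auto simp: young_def)
  next
    case True
    have dual: "unitary_dual \<tau> N = {l \<in> {1..r} \<rightarrow>\<^sub>E UNIV. (\<forall>i\<in>{1..<r}. 0 \<le> l i) \<and> antimono_on {1..<r} l \<and> (\<forall>i\<in>{1..<r}. \<bar>l r\<bar> \<le> l i)}"
      unfolding W[symmetric] using True by (simp add: r_def Let_def)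
    \<comment> \<open>Otherwise all r entries would have absolute value at least 1, and the size
      would reach r > m.\<close>
    have zero: "l r = 0" if l: "\<forall>i\<in>{1..<r}. \<bar>l r\<bar> \<le> l i" "abs_weight r l = m" for l :: "nat \<Rightarrow> int"
    proof (rule ccontr)
      assume nz: "l r \<noteq> 0"
      have "1 \<le> \<bar>l i\<bar>" if "i \<in> {1..r}" for i
      proof (cases "i = r")
        case False
        then have "\<bar>l r\<bar> \<le> l i" using l that by auto
        with nz show ?thesis by linarith
      qed (use nz in auto)
      then have "(\<Sum>i=1..r. 1) \<le> abs_sum r l" unfolding abs_sum_def by (intro sum_mono) auto
      then have "r \<le> abs_weight r l" by (simp add: abs_weight_def)
      with l assms(2) show False by (simp add: r_def)
    qed
    have equiv: "(\<forall>i\<in>{1..<r}. 0 \<le> l i) \<and> antimono_on {1..<r} l \<and> (\<forall>i\<in>{1..<r}. \<bar>l r\<bar> \<le> l i)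
        \<longleftrightarrow> (\<forall>i\<in>{1..r}. 0 \<le> l i) \<and> antimono_on {1..r} l" if "l r = 0" for l :: "nat \<Rightarrow> int"
    proof
      assume *: "(\<forall>i\<in>{1..<r}. 0 \<le> l i) \<and> antimono_on {1..<r} l \<and> (\<forall>i\<in>{1..<r}. \<bar>l r\<bar> \<le> l i)"
      have nonneg: "0 \<le> l i" if "i \<in> {1..r}" for i
        using * that \<open>l r = 0\<close> by (cases "i = r") auto
      have "antimono_on {1..r} l"
      proof (rule monotone_onI)
        fix i j assume ij: "i \<in> {1..r}" "j \<in> {1..r}" "i \<le> j"
        show "l j \<le> l i"
        proof (cases "j = r")
          case True
          then show ?thesis using nonneg[of i] ij \<open>l r = 0\<close> by simp
        next
          case False
          then have "i \<in> {1..<r}" "j \<in> {1..<r}" using ij by auto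
          then show ?thesis using * ij by (auto simp: monotone_on_def)
        qed
      qed
      with nonneg show "(\<forall>i\<in>{1..r}. 0 \<le> l i) \<and> antimono_on {1..r} l" by blast
    next
      assume *: "(\<forall>i\<in>{1..r}. 0 \<le> l i) \<and> antimono_on {1..r} l"
      then have "antimono_on {1..<r} l" by (auto simp: monotone_on_def)
      with * that show "(\<forall>i\<in>{1..<r}. 0 \<le> l i) \<and> antimono_on {1..<r} l \<and> (\<forall>i\<in>{1..<r}. \<bar>l r\<bar> \<le> l i)" by auto
    qed
    have zero': "l r = 0" if "\<forall>i\<in>{1..r}. 0 \<le> l i" "antimono_on {1..r} l" "(\<Sum>i=1..r. l i) = int m" for l
    proof (rule ccontr)
      assume nz: "l r \<noteq> 0"
      have "1 \<le> l i" if i: "i \<in> {1..r}" for i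
      proof -
        have "l r \<le> l i" "0 \<le> l r" using i that \<open>antimono_on {1..r} l\<close> \<open>\<forall>i\<in>{1..r}. 0 \<le> l i\<close> by (auto simp: monotone_on_def)
        with nz show ?thesis by linarith
      qed
      then have "(\<Sum>i=1..r. 1) \<le> (\<Sum>i=1..r. l i)" by (intro sum_mono) auto
      with that assms(2) show False by (simp add: r_def)
    qed
    show ?thesis unfolding r_def[symmetric]
    proof (rule set_eqI, rule iffI)
      fix l assume "l \<in> {l \<in> unitary_dual \<tau> N. abs_weight r l = m}"
      with zero[of l] equiv[of l] abs_weight_eq[of l] show "l \<in> young r m"
        unfolding dual young_def by blast
    next
      fix l assume "l \<in> young r m"
      with zero'[of l] equiv[of l] abs_weight_eq[of l] show "l \<in> {l \<in> unitary_dual \<tau> N. abs_weight r l = m}"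
        unfolding dual young_def by blast
    qed
  qed
qed

lemma BCD_admissible_bound:
  assumes "\<tau> \<in> {TypeB, TypeC, TypeD}" "admissible \<tau> N" "N \<ge> 4"
  shows "4 * (real N + (if \<tau> = TypeC then 2 else 0) - real (weight_length \<tau> N) - 1) \<ge> real N"
  using assms by (auto elim!: evenE oddE)

abbreviation casimir_le :: "classical_type \<Rightarrow> nat \<Rightarrow> real \<Rightarrow> (nat \<Rightarrow> int) set" where
  "casimir_le \<tau> N \<Lambda> \<equiv> {l \<in> unitary_dual \<tau> N. casimir \<tau> N l \<le> \<Lambda>}"

text \<open>The form of \<open>counting_limit\<close> for types whose size is at most 4 times the
  Casimir number. The threshold 2m + 4 guarantees at least m rows, for type A at either end, so that
  the level counts no longer depend on N.\<close>

lemma counting_of_bounds: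
  fixes sz :: "nat \<Rightarrow> (nat \<Rightarrow> int) \<Rightarrow> nat" and A B \<Lambda> :: real
  assumes count: "\<And>m N. 2 * m + 4 \<le> N \<Longrightarrow> admissible \<tau> N \<Longrightarrow>
        finite {l \<in> unitary_dual \<tau> N. sz N l = m} \<and> card {l \<in> unitary_dual \<tau> N. sz N l = m} = a m"
    and lower: "\<And>N l. 4 \<le> N \<Longrightarrow> admissible \<tau> N \<Longrightarrow> l \<in> unitary_dual \<tau> N \<Longrightarrow> real (sz N l) / 4 \<le> casimir \<tau> N l"
    and close: "\<And>N l. 4 \<le> N \<Longrightarrow> admissible \<tau> N \<Longrightarrow> l \<in> unitary_dual \<tau> N \<Longrightarrow>
        \<bar>casimir \<tau> N l - real (sz N l)\<bar> \<le> real (sz N l) * (A * real (sz N l) + B) / real N"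
    and AB: "A \<ge> 0" "B \<ge> 0" and \<Lambda>: "\<Lambda> \<ge> 0" "\<And>n :: nat. \<Lambda> \<noteq> real n"
  shows "\<forall>\<^sub>F N in size_at_top \<tau>. finite (casimir_le \<tau> N \<Lambda>) \<and>
      card (casimir_le \<tau> N \<Lambda>) = (\<Sum>m\<le>nat \<lfloor>\<Lambda>\<rfloor>. a m)"
    and "\<forall>\<^sub>F N in size_at_top \<tau>. \<forall>l\<in>unitary_dual \<tau> N. 0 \<le> casimir \<tau> N l"
proof -
  show "\<forall>\<^sub>F N in size_at_top \<tau>. \<forall>l\<in>unitary_dual \<tau> N. 0 \<le> casimir \<tau> N l"
  proof (rule eventually_size_at_top[of 4], rule ballI)
    fix N l assume "4 \<le> N" "admissible \<tau> N" "l \<in> unitary_dual \<tau> N"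
    moreover have "0 \<le> real (sz N l) / 4" by simp
    ultimately show "0 \<le> casimir \<tau> N l" using lower[of N l] by linarith
  qed
  show "\<forall>\<^sub>F N in size_at_top \<tau>. finite (casimir_le \<tau> N \<Lambda>) \<and>
      card (casimir_le \<tau> N \<Lambda>) = (\<Sum>m\<le>nat \<lfloor>\<Lambda>\<rfloor>. a m)"
  proof (rule counting_limit[OF _ _ _ \<Lambda>, where sz = sz])
    show "\<forall>\<^sub>F N in size_at_top \<tau>. finite {l \<in> unitary_dual \<tau> N. sz N l = m} \<and>
        card {l \<in> unitary_dual \<tau> N. sz N l = m} = a m" for m
      by (rule eventually_size_at_top[of "2 * m + 4"]) (rule count)
    show "\<exists>K. \<forall>\<^sub>F N in size_at_top \<tau>. \<forall>l\<in>unitary_dual \<tau> N. casimir \<tau> N l \<le> \<Lambda> \<longrightarrow> sz N l \<le> K" for \<Lambda>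
    proof (rule exI, rule eventually_size_at_top[of 4], intro ballI impI)
      fix N l assume *: "4 \<le> N" "admissible \<tau> N" "l \<in> unitary_dual \<tau> N" "casimir \<tau> N l \<le> \<Lambda>"
      have "real (sz N l) \<le> 4 * \<Lambda>" using lower[OF *(1-3)] *(4) by linarith
      then show "sz N l \<le> nat \<lceil>4 * \<Lambda>\<rceil>" by linarith
    qed
    fix K :: nat and \<epsilon> :: real assume "\<epsilon> > 0"
    have "\<forall>\<^sub>F N in size_at_top \<tau>. admissible \<tau> N \<and> 4 \<le> N" by (rule eventually_size_at_top[of 4]) auto
    with eventually_size_small[OF \<open>\<epsilon> > 0\<close>, where B = "real K * (A * real K + B)"]
    show "\<forall>\<^sub>F N in size_at_top \<tau>. \<forall>l\<in>unitary_dual \<tau> N. sz N l \<le> K \<longrightarrow> \<bar>casimir \<tau> N l - real (sz N l)\<bar> \<le> \<epsilon>"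
    proof eventually_elim
      case (elim N)
      show ?case
      proof (intro ballI impI)
        fix l assume l: "l \<in> unitary_dual \<tau> N" "sz N l \<le> K"
        have "\<bar>casimir \<tau> N l - real (sz N l)\<bar> \<le> real (sz N l) * (A * real (sz N l) + B) / real N"
          using close l elim by blast
        also have "\<dots> \<le> real K * (A * real K + B) / real N"
          using l AB by (intro divide_right_mono mult_mono add_mono) auto
        finally show "\<bar>casimir \<tau> N l - real (sz N l)\<bar> \<le> \<epsilon>" using elim by linarith
      qed
    qed
  qed
qed

lemma counting_BCD:
  assumes \<tau>: "\<tau> \<in> {TypeB, TypeC, TypeD}" and \<Lambda>: "\<Lambda> \<ge> 0" "\<And>n :: nat. \<Lambda> \<noteq> real n"
  shows "\<forall>\<^sub>F N in size_at_top \<tau>. finite (casimir_le \<tau> N \<Lambda>) \<and>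
      card (casimir_le \<tau> N \<Lambda>) = (\<Sum>m\<le>nat \<lfloor>\<Lambda>\<rfloor>. partitions m)"
    and "\<forall>\<^sub>F N in size_at_top \<tau>. \<forall>l\<in>unitary_dual \<tau> N. 0 \<le> casimir \<tau> N l"
proof -
  define sz where "sz N = abs_weight (weight_length \<tau> N)" for N
  have bounds: "real (sz N l) / 4 \<le> casimir \<tau> N l"
    "\<bar>casimir \<tau> N l - real (sz N l)\<bar> \<le> real (sz N l) * (3 * real (sz N l) + 2) / real N"
    if "4 \<le> N" "admissible \<tau> N" "l \<in> unitary_dual \<tau> N" for N l
    using orthosymplectic_sum_bounds[of "weight_length \<tau> N" "\<lambda>i. \<bar>l i\<bar>" "if \<tau> = TypeC then 2 else 0" N]
      unitary_dual_BCD_abs[OF \<tau> that(3)] BCD_admissible_bound[OF \<tau> that(2,1)] casimir_BCD[OF \<tau> that(3,2)] that(1)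
    by (simp_all add: abs_sum_abs abs_weight_real sz_def)
  have count: "finite {l \<in> unitary_dual \<tau> N. sz N l = m} \<and> card {l \<in> unitary_dual \<tau> N. sz N l = m} = partitions m"
    if "2 * m + 4 \<le> N" "admissible \<tau> N" for m N
  proof -
    have m: "m < weight_length \<tau> N" using \<tau> that by auto
    show ?thesis
      unfolding sz_def unitary_dual_BCD_level[OF \<tau> m] using m by (simp add: finite_young card_young bounded_partitions_eq)
  qed
  note counting = counting_of_bounds[OF count bounds _ _ \<Lambda>]
  show "\<forall>\<^sub>F N in size_at_top \<tau>. finite (casimir_le \<tau> N \<Lambda>) \<and>
      card (casimir_le \<tau> N \<Lambda>) = (\<Sum>m\<le>nat \<lfloor>\<Lambda>\<rfloor>. partitions m)"
    by (rule counting(1)) auto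
  show "\<forall>\<^sub>F N in size_at_top \<tau>. \<forall>l\<in>unitary_dual \<tau> N. 0 \<le> casimir \<tau> N l"
    by (rule counting(2)) auto
qed

section \<open>Type A: a partition at each end\<close>

definition mid :: "nat \<Rightarrow> nat" where
  "mid N = (N + 1) div 2"

text \<open>A weight with small Casimir number is constant except near its ends, and the middle
  entry is that constant. Deviations from it are invariant under adding a constant to the
  weight.\<close>

definition upper_part :: "nat \<Rightarrow> (nat \<Rightarrow> int) \<Rightarrow> nat \<Rightarrow> int" where
  "upper_part N l i = l i - l (mid N)"

definition lower_part :: "nat \<Rightarrow> (nat \<Rightarrow> int) \<Rightarrow> nat \<Rightarrow> int" where
  "lower_part N l j = l (mid N) - l (N + 1 - j)"

definition spread :: "nat \<Rightarrow> (nat \<Rightarrow> int) \<Rightarrow> nat" where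
  "spread N l = nat (\<Sum>i=1..N. \<bar>l i - l (mid N)\<bar>)"

lemma sum_mid_split:
  fixes f :: "nat \<Rightarrow> 'a::comm_monoid_add"
  shows "(\<Sum>i=1..N. f i) = (\<Sum>i=1..mid N. f i) + (\<Sum>j=1..N - mid N. f (N + 1 - j))"
proof -
  have "{1..N} = {1..mid N} \<union> {mid N + 1..N}" "{1..mid N} \<inter> {mid N + 1..N} = {}" by (auto simp: mid_def)
  then have "(\<Sum>i=1..N. f i) = (\<Sum>i=1..mid N. f i) + (\<Sum>i=mid N + 1..N. f i)" by (simp add: sum.union_disjoint)
  also have "(\<Sum>i=mid N + 1..N. f i) = (\<Sum>j=1..N - mid N. f (N + 1 - j))"
    by (rule sum.reindex_bij_witness[of _ "\<lambda>j. N + 1 - j" "\<lambda>i. N + 1 - i"]) auto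
  finally show ?thesis .
qed

lemma upper_part_props:
  assumes "antimono_on {1..N} l"
  shows "\<And>i. i \<in> {1..mid N} \<Longrightarrow> 0 \<le> upper_part N l i" "antimono_on {1..mid N} (upper_part N l)"
  using assms by (auto simp: upper_part_def monotone_on_def mid_def)

lemma lower_part_props:
  assumes "antimono_on {1..N} l"
  shows "\<And>i. i \<in> {1..N - mid N} \<Longrightarrow> 0 \<le> lower_part N l i" "antimono_on {1..N - mid N} (lower_part N l)"
proof -
  have m: "l k \<le> l j" if "j \<in> {1..N}" "k \<in> {1..N}" "j \<le> k" for j k
    using assms that by (auto simp: monotone_on_def)
  show "0 \<le> lower_part N l i" if "i \<in> {1..N - mid N}" for i
    using m[of "mid N" "N + 1 - i"] that by (auto simp: lower_part_def mid_def)
  show "antimono_on {1..N - mid N} (lower_part N l)"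
  proof (rule monotone_onI)
    fix i j assume "i \<in> {1..N - mid N}" "j \<in> {1..N - mid N}" "i \<le> j"
    then show "lower_part N l j \<le> lower_part N l i"
      using m[of "N + 1 - j" "N + 1 - i"] by (auto simp: lower_part_def)
  qed
qed

lemma spread_eq:
  assumes "antimono_on {1..N} l"
  shows "int (spread N l) = abs_sum (mid N) (upper_part N l) + abs_sum (N - mid N) (lower_part N l)"
proof -
  have "int (spread N l) = (\<Sum>i=1..N. \<bar>l i - l (mid N)\<bar>)" by (simp add: spread_def sum_nonneg)
  also have "\<dots> = (\<Sum>i=1..mid N. \<bar>l i - l (mid N)\<bar>) + (\<Sum>j=1..N - mid N. \<bar>l (N + 1 - j) - l (mid N)\<bar>)"
    by (rule sum_mid_split)
  finally show ?thesis by (simp add: abs_sum_def upper_part_def lower_part_def abs_minus_commute)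
qed

text \<open>The coefficients N + 1 - 2i sum to 0, so a shift adds only terms that complete the
  square of the sum of the entries, and the subtracted square absorbs them. Hence deviations from
  the middle entry may replace the entries themselves.\<close>

lemma casimir_A_shift:
  assumes N: "N \<ge> 1"
  shows "casimir TypeA N l = 1 / real N * (\<Sum>i=1..N. real_of_int (l i - n) * (real_of_int (l i - n) + real N + 1 - 2 * real i))
     - 1 / (real N)\<^sup>2 * (\<Sum>i=1..N. real_of_int (l i - n))\<^sup>2"
proof -
  define E where "E = (\<Sum>i=1..N. real_of_int (l i - n))"
  have s1: "(\<Sum>i=1..N. real_of_int (l i)) = real N * real_of_int n + E"
    by (simp add: E_def sum_subtractf)
  have z: "(\<Sum>i=1..N. real N + 1 - 2 * real i) = 0"
  proof -
    have "(\<Sum>i=1..N. real i) = real N * (real N + 1) / 2" by (induction N) (auto simp: field_simps)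
    moreover have "(\<Sum>i=1..N. real N + 1 - 2 * real i) = real N * (real N + 1) - 2 * (\<Sum>i=1..N. real i)"
      unfolding sum_subtractf sum_distrib_left[symmetric] by simp
    ultimately show ?thesis by simp
  qed
  have "(\<Sum>i=1..N. real_of_int (l i) * (real_of_int (l i) + real N + 1 - 2 * real i))
      = (\<Sum>i=1..N. real_of_int (l i - n) * (real_of_int (l i - n) + real N + 1 - 2 * real i)
           + 2 * real_of_int n * real_of_int (l i - n) + (real_of_int n)\<^sup>2 + real_of_int n * (real N + 1 - 2 * real i))"
    by (intro sum.cong) (auto simp: algebra_simps power2_eq_square)
  also have "\<dots> = (\<Sum>i=1..N. real_of_int (l i - n) * (real_of_int (l i - n) + real N + 1 - 2 * real i))
      + 2 * real_of_int n * E + real N * (real_of_int n)\<^sup>2"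
    unfolding sum.distrib sum_distrib_left[symmetric] z by (simp add: E_def)
  finally show ?thesis
    unfolding casimir.simps s1 E_def[symmetric] using N by (simp add: field_simps power2_eq_square)
qed

text \<open>Reversing the index changes the sign of N + 1 - 2i, and the deviations at the lower end
  are negative, so that end contributes like the upper one. Each end is an
  \<open>orthosymplectic_sum\<close> with d = 1.\<close>

lemma casimir_A_bounds:
  assumes l: "antimono_on {1..N} l" and N: "N \<ge> 2"
  defines "t \<equiv> real (spread N l)"
  shows "casimir TypeA N l \<ge> t / 4" and "\<bar>casimir TypeA N l - t\<bar> \<le> t * (7 * t + 4) / real N"
proof -
  define s where "s = mid N"
  define p q where "p = upper_part N l" and "q = lower_part N l"
  define P Q where "P = real_of_int (abs_sum s p)" and "Q = real_of_int (abs_sum (N - s) q)"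
  note p = upper_part_props[OF l, folded p_def s_def] and q = lower_part_props[OF l, folded q_def s_def]
  have t: "t = P + Q" unfolding t_def P_def Q_def p_def q_def s_def of_int_add[symmetric] spread_eq[OF l, symmetric] by simp
  have PQ: "P \<ge> 0" "Q \<ge> 0" by (auto simp: P_def Q_def abs_sum_def intro!: sum_nonneg)
  have P: "P = (\<Sum>i=1..s. real_of_int (p i))" and Q: "Q = (\<Sum>i=1..N - s. real_of_int (q i))"
    using p q by (auto simp: P_def Q_def abs_sum_def)
  have s: "4 * (real N - real s) \<ge> real N" "4 * real s \<ge> real N" "s \<le> N"
    using N by (auto simp: s_def mid_def)
  define e where "e i = real_of_int (l i - l s)" for i
  have ep: "e i = real_of_int (p i)" for i by (simp add: e_def p_def upper_part_def s_def)
  have eq: "e (N + 1 - j) = - real_of_int (q j)" for j by (simp add: e_def q_def lower_part_def s_def)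
  have c: "casimir TypeA N l = 1 / real N * (\<Sum>i=1..N. e i * (e i + real N + 1 - 2 * real i)) - 1 / (real N)\<^sup>2 * (\<Sum>i=1..N. e i)\<^sup>2"
    unfolding e_def using N by (intro casimir_A_shift) auto
  have E: "(\<Sum>i=1..N. e i) = P - Q"
  proof -
    have "(\<Sum>i=1..N. e i) = (\<Sum>i=1..s. e i) + (\<Sum>j=1..N - s. e (N + 1 - j))"
      unfolding s_def by (rule sum_mid_split)
    also have "\<dots> = P - Q" unfolding eq by (simp add: sum_negf P Q ep)
    finally show ?thesis .
  qed
  have lin: "(\<Sum>i=1..N. e i * (real N + 1 - 2 * real i)) \<ge> real N * t / 4"
  proof -
    have "(\<Sum>i=1..N. e i * (real N + 1 - 2 * real i))
       = (\<Sum>i=1..s. real_of_int (p i) * (real N + 1 - 2 * real i)) + (\<Sum>j=1..N - s. e (N + 1 - j) * (real N + 1 - 2 * real (N + 1 - j)))"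
      by (subst sum_mid_split) (simp add: s_def[symmetric] ep)
    also have "(\<Sum>j=1..N - s. e (N + 1 - j) * (real N + 1 - 2 * real (N + 1 - j))) = (\<Sum>j=1..N - s. real_of_int (q j) * (real N + 1 - 2 * real j))"
      unfolding eq by (intro sum.cong) (auto simp: of_nat_diff algebra_simps)
    finally have "(\<Sum>i=1..N. e i * (real N + 1 - 2 * real i))
       = (\<Sum>i=1..s. real_of_int (p i) * (real N + 1 - 2 * real i)) + (\<Sum>j=1..N - s. real_of_int (q j) * (real N + 1 - 2 * real j))" .
    moreover have "(\<Sum>i=1..s. real_of_int (p i) * (real N + 1 - 2 * real i)) \<ge> (real N + 1 - real s - 1) * P"
      unfolding P by (rule casimir_sum_lower) (use p in \<open>auto simp: monotone_on_def\<close>)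
    moreover have "(\<Sum>j=1..N - s. real_of_int (q j) * (real N + 1 - 2 * real j)) \<ge> (real N + 1 - real (N - s) - 1) * Q"
      unfolding Q by (rule casimir_sum_lower) (use q in \<open>auto simp: monotone_on_def\<close>)
    moreover have "(real N + 1 - real s - 1) * P \<ge> real N / 4 * P" "(real N + 1 - real (N - s) - 1) * Q \<ge> real N / 4 * Q"
    proof -
      have m: "real N / 4 \<le> real N + 1 - real s - 1" "real N / 4 \<le> real N + 1 - real (N - s) - 1"
        using s by (simp_all add: of_nat_diff)
      show "(real N + 1 - real s - 1) * P \<ge> real N / 4 * P" by (rule mult_right_mono[OF m(1) PQ(1)])
      show "(real N + 1 - real (N - s) - 1) * Q \<ge> real N / 4 * Q" by (rule mult_right_mono[OF m(2) PQ(2)])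
    qed
    ultimately show ?thesis by (simp add: t algebra_simps)
  qed
  \<comment> \<open>For the lower bound, the quadratic terms of the sum pay for the subtracted
    square.\<close>
  have cs: "(\<Sum>i=1..N. e i)\<^sup>2 \<le> real N * (\<Sum>i=1..N. (e i)\<^sup>2)"
    using Cauchy_Schwarz_ineq_sum[of "\<lambda>_. 1" e "{1..N}"] by simp
  have "real N * (\<Sum>i=1..N. e i * (e i + real N + 1 - 2 * real i)) = real N * (\<Sum>i=1..N. (e i)\<^sup>2) + real N * (\<Sum>i=1..N. e i * (real N + 1 - 2 * real i))"
  proof -
    have "(\<Sum>i=1..N. e i * (e i + real N + 1 - 2 * real i)) = (\<Sum>i=1..N. (e i)\<^sup>2) + (\<Sum>i=1..N. e i * (real N + 1 - 2 * real i))"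
      unfolding sum.distrib[symmetric] by (intro sum.cong) (auto simp: power2_eq_square algebra_simps)
    then show ?thesis by (simp only: distrib_left)
  qed
  then have num: "real N * (\<Sum>i=1..N. e i * (e i + real N + 1 - 2 * real i)) - (\<Sum>i=1..N. e i)\<^sup>2 \<ge> real N * (real N * t / 4)"
    using cs mult_left_mono[OF lin, of "real N"] by simp
  have frac: "casimir TypeA N l = (real N * (\<Sum>i=1..N. e i * (e i + real N + 1 - 2 * real i)) - (\<Sum>i=1..N. e i)\<^sup>2) / (real N)\<^sup>2"
    unfolding c using N by (simp add: field_simps power2_eq_square)
  have "real N * (real N * t / 4) / (real N)\<^sup>2 \<le> casimir TypeA N l"
    unfolding frac by (intro divide_right_mono num) auto
  also have "real N * (real N * t / 4) / (real N)\<^sup>2 = t / 4" using N by (simp add: power2_eq_square)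
  finally show "casimir TypeA N l \<ge> t / 4" .
  have "(\<Sum>i=1..N. e i * (e i + real N + 1 - 2 * real i))
     = (\<Sum>i=1..s. real_of_int (p i) * (real_of_int (p i) + real N + 1 - 2 * real i))
     + (\<Sum>j=1..N - s. e (N + 1 - j) * (e (N + 1 - j) + real N + 1 - 2 * real (N + 1 - j)))"
    by (subst sum_mid_split) (simp add: s_def[symmetric] ep)
  also have "(\<Sum>j=1..N - s. e (N + 1 - j) * (e (N + 1 - j) + real N + 1 - 2 * real (N + 1 - j)))
     = (\<Sum>j=1..N - s. real_of_int (q j) * (real_of_int (q j) + real N + 1 - 2 * real j))"
    unfolding eq by (intro sum.cong) (auto simp: of_nat_diff algebra_simps)
  finally have "casimir TypeA N l = orthosymplectic_sum s N 1 p + orthosymplectic_sum (N - s) N 1 q - (P - Q)\<^sup>2 / (real N)\<^sup>2"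
    unfolding c E orthosymplectic_sum_def by (simp add: add_divide_distrib)
  moreover have "\<bar>orthosymplectic_sum s N 1 p - P\<bar> \<le> P * (3 * P + 2) / real N"
    unfolding P_def by (rule orthosymplectic_sum_bounds(2)) (use p s N in auto)
  moreover have "\<bar>orthosymplectic_sum (N - s) N 1 q - Q\<bar> \<le> Q * (3 * Q + 2) / real N"
    unfolding Q_def by (rule orthosymplectic_sum_bounds(2)) (use q s N in auto)
  moreover have "P * (3 * P + 2) / real N \<le> t * (3 * t + 2) / real N" "Q * (3 * Q + 2) / real N \<le> t * (3 * t + 2) / real N"
    using PQ by (auto simp: t intro!: divide_right_mono mult_mono)
  moreover have "0 \<le> (P - Q)\<^sup>2 / (real N)\<^sup>2" "(P - Q)\<^sup>2 / (real N)\<^sup>2 \<le> t\<^sup>2 / real N"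
  proof -
    have "(P - Q)\<^sup>2 \<le> t\<^sup>2" unfolding t using PQ by (intro abs_le_square_iff[THEN iffD1]) auto
    moreover have "real N \<le> (real N)\<^sup>2" using N by (simp add: power2_eq_square)
    ultimately show "(P - Q)\<^sup>2 / (real N)\<^sup>2 \<le> t\<^sup>2 / real N" using N by (intro frac_le) auto
  qed auto
  \<comment> \<open>Each end contributes 3t + 2 and the subtracted square contributes t, together 7t
    + 4.\<close>
  ultimately have "\<bar>casimir TypeA N l - t\<bar> \<le> t * (3 * t + 2) / real N + t * (3 * t + 2) / real N + t\<^sup>2 / real N"
    unfolding t by linarith
  also have "\<dots> = t * (7 * t + 4) / real N"
    by (simp add: add_divide_distrib[symmetric] power2_eq_square algebra_simps)
  finally show "\<bar>casimir TypeA N l - t\<bar> \<le> t * (7 * t + 4) / real N" .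
qed

text \<open>The base value is q 1 because the last entry of a type A weight is 0: the first entry of
  its lower partition is the middle entry minus 0.\<close>

definition glue :: "nat \<Rightarrow> (nat \<Rightarrow> int) \<times> (nat \<Rightarrow> int) \<Rightarrow> nat \<Rightarrow> int" where
  "glue N = (\<lambda>(p, q). \<lambda>i\<in>{1..N}. q 1 + (if i < mid N then p i else if i = mid N then 0 else - q (N + 1 - i)))"

definition bipartitions :: "nat \<Rightarrow> nat" where
  "bipartitions m = (\<Sum>i\<le>m. partitions i * partitions (m - i))"

abbreviation A_level :: "nat \<Rightarrow> nat \<Rightarrow> (nat \<Rightarrow> int) set" where
  "A_level N m \<equiv> {l \<in> unitary_dual TypeA N. spread N l = m}"

abbreviation young_pairs :: "nat \<Rightarrow> nat \<Rightarrow> ((nat \<Rightarrow> int) \<times> (nat \<Rightarrow> int)) set" where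
  "young_pairs N m \<equiv> (\<Union>i\<in>{..m}. young (mid N - 1) i \<times> young (N - mid N) (m - i))"

text \<open>The upper part stops before the middle, where its value is always 0.\<close>

abbreviation ends :: "nat \<Rightarrow> (nat \<Rightarrow> int) \<Rightarrow> (nat \<Rightarrow> int) \<times> (nat \<Rightarrow> int)" where
  "ends N \<equiv> \<lambda>l. (restrict (upper_part N l) {1..mid N - 1}, restrict (lower_part N l) {1..N - mid N})"

lemma dual_A_level_bij:
  assumes N: "N \<ge> 2"
  shows "bij_betw (ends N)
    (A_level N m) (young_pairs N m)"
proof (rule bij_betw_byWitness[where f' = "glue N"])
  define s where "s = mid N"
  have s: "1 \<le> s" "s < N" "s - 1 < N" using N by (auto simp: s_def mid_def)
  show "\<forall>l\<in>A_level N m.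
      glue N (ends N l) = l"
    using s by (auto simp: glue_def fun_eq_iff weights_def PiE_def extensional_def upper_part_def lower_part_def s_def[symmetric])
  show "\<forall>x\<in>young_pairs N m.
      ends N (glue N x) = x"
    using s by (auto simp: glue_def fun_eq_iff young_def PiE_def extensional_def upper_part_def lower_part_def s_def[symmetric])
  show "(ends N) `
      A_level N m \<subseteq> (young_pairs N m)"
  proof (rule image_subsetI)
    fix l assume l: "l \<in> A_level N m"
    then have mono: "antimono_on {1..N} l" by simp
    note p = upper_part_props[OF mono, folded s_def] and q = lower_part_props[OF mono, folded s_def]
    define i where "i = nat (\<Sum>i=1..s - 1. upper_part N l i)"
    have i: "(\<Sum>i=1..s - 1. upper_part N l i) = int i"
    proof -
      have "0 \<le> (\<Sum>i=1..s - 1. upper_part N l i)" using p(1) by (intro sum_nonneg) auto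
      then show ?thesis by (simp add: i_def)
    qed
    have "abs_sum s (upper_part N l) = (\<Sum>i=1..s. upper_part N l i)" using p(1) by (simp add: abs_sum_def)
    also have "\<dots> = (\<Sum>i=1..s - 1. upper_part N l i) + upper_part N l s"
      using sum.cl_ivl_Suc[of "upper_part N l" 1 "s - 1"] s by simp
    also have "upper_part N l s = 0" by (simp add: upper_part_def s_def)
    finally have "abs_sum s (upper_part N l) = int i" using i by simp
    moreover have "abs_sum (N - s) (lower_part N l) = (\<Sum>j=1..N - s. lower_part N l j)" using q(1) by (simp add: abs_sum_def)
    ultimately have "int m = int i + (\<Sum>j=1..N - s. lower_part N l j)"
      using spread_eq[OF mono] l by (simp add: s_def)
    moreover have "0 \<le> (\<Sum>j=1..N - s. lower_part N l j)" using q(1) by (intro sum_nonneg) auto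
    ultimately have "i \<le> m" "(\<Sum>j=1..N - s. lower_part N l j) = int (m - i)" by auto
    moreover have "restrict (upper_part N l) {1..s - 1} \<in> young (s - 1) i"
      using p i s by (auto simp: young_def monotone_on_def)
    moreover have "restrict (lower_part N l) {1..N - s} \<in> young (N - s) (m - i)"
      using q calculation(2) by (auto simp: young_def monotone_on_def)
    ultimately show "(ends N l)
        \<in> (young_pairs N m)"
      unfolding s_def by blast
  qed
  show "glue N ` (young_pairs N m) \<subseteq> A_level N m"
  proof (rule image_subsetI)
    fix x assume "x \<in> (young_pairs N m)"
    then obtain i p q where x: "x = (p, q)" "i \<le> m" "p \<in> young (s - 1) i" "q \<in> young (N - s) (m - i)"
      by (auto simp: s_def)
    define l where "l = glue N (p, q)"
    have li: "l j = q 1 + (if j < s then p j else if j = s then 0 else - q (N + 1 - j))" if "j \<in> {1..N}" for j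
      using that by (simp add: l_def glue_def s_def)
    have ls: "l s = q 1" using li[of s] s by simp
    have p: "0 \<le> p j" if "j \<in> {1..s - 1}" for j using x that by (auto simp: young_def)
    have pm: "p k \<le> p j" if "j \<in> {1..s - 1}" "k \<in> {1..s - 1}" "j \<le> k" for j k using x that by (auto simp: young_def monotone_on_def)
    have q: "0 \<le> q j" if "j \<in> {1..N - s}" for j using x that by (auto simp: young_def)
    have qm: "q k \<le> q j" if "j \<in> {1..N - s}" "k \<in> {1..N - s}" "j \<le> k" for j k using x that by (auto simp: young_def monotone_on_def)
    have mono: "antimono_on {1..N} l"
    proof (rule monotone_onI)
      fix j k assume jk: "j \<in> {1..N}" "k \<in> {1..N}" "j \<le> k"
      have pj: "0 \<le> p j" if "j < s" using p[of j] that jk by auto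
      have qk: "0 \<le> q (N + 1 - k)" if "s < k"
      proof -
        have "1 \<le> N + 1 - k" "N + 1 - k \<le> N - s" using that jk by auto
        then show ?thesis by (intro q) simp
      qed
      consider "k < s" | "j < s" "k = s" | "j < s" "s < k" | "j = s" "k = s" | "j = s" "s < k" | "s < j" using jk by linarith
      then show "l k \<le> l j"
      proof cases
        case 1
        then have "p k \<le> p j" using jk by (intro pm) auto
        with 1 show ?thesis using li[OF jk(1)] li[OF jk(2)] jk by simp
      next
        case 6
        then have "q (N + 1 - j) \<le> q (N + 1 - k)" using jk by (intro qm) auto
        with 6 show ?thesis using li[OF jk(1)] li[OF jk(2)] jk by simp
      qed (use li[OF jk(1)] li[OF jk(2)] pj qk in simp_all)
    qed
    \<comment> \<open>At N the reversed index is 1, so the entry is q 1 - q 1.\<close>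
    have lN: "l N = 0" using li[of N] s by simp
    have "0 \<le> l j" if "j \<in> {1..N}" for j
    proof -
      have "l N \<le> l j" using mono that by (auto simp: monotone_on_def)
      with lN show ?thesis by simp
    qed
    moreover have "l \<in> weights TypeA N" by (simp add: l_def glue_def weights_def)
    ultimately have dual: "l \<in> unitary_dual TypeA N" using mono lN by simp
    have "int (spread N l) = (\<Sum>i=1..N. \<bar>l i - l s\<bar>)" by (simp add: spread_def sum_nonneg s_def)
    also have "\<dots> = (\<Sum>i=1..s. \<bar>l i - l s\<bar>) + (\<Sum>j=1..N - s. \<bar>l (N + 1 - j) - l s\<bar>)"
      unfolding s_def by (rule sum_mid_split)
    also have "(\<Sum>i=1..s. \<bar>l i - l s\<bar>) = (\<Sum>i=1..s - 1. \<bar>l i - l s\<bar>)"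
      using sum.cl_ivl_Suc[of "\<lambda>i. \<bar>l i - l s\<bar>" 1 "s - 1"] s by simp
    also have "\<dots> = (\<Sum>i=1..s - 1. p i)"
      using s p by (intro sum.cong) (auto simp: li ls)
    also have "\<dots> = int i" using x by (simp add: young_def)
    also have "(\<Sum>j=1..N - s. \<bar>l (N + 1 - j) - l s\<bar>) = (\<Sum>j=1..N - s. q j)"
    proof (rule sum.cong[OF refl])
      fix j assume j: "j \<in> {1..N - s}"
      then have "N + 1 - j \<in> {1..N}" "\<not> N + 1 - j < s" "N + 1 - j \<noteq> s" "N + 1 - (N + 1 - j) = j" using s by auto
      then show "\<bar>l (N + 1 - j) - l s\<bar> = q j" using q[OF j] by (simp only: li ls if_False)
    qed
    also have "\<dots> = int (m - i)" using x by (simp add: young_def)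
    finally have "spread N l = m" using x(2) by simp
    with dual show "glue N x \<in> A_level N m" by (simp add: l_def x(1))
  qed
qed

lemma dual_A_level_card:
  assumes N: "N \<ge> 2 * m + 4"
  shows "finite (A_level N m) \<and> card (A_level N m) = bipartitions m"
proof -
  define U where "U = young_pairs N m"
  have N2: "N \<ge> 2" using N by simp
  have fin: "finite U" by (auto simp: U_def finite_young)
  have "card U = (\<Sum>i\<in>{..m}. card (young (mid N - 1) i \<times> young (N - mid N) (m - i)))"
  proof -
    have 1: "\<forall>i\<in>{..m}. finite (young (mid N - 1) i \<times> young (N - mid N) (m - i))" by (simp add: finite_young)
    have 2: "\<forall>i\<in>{..m}. \<forall>j\<in>{..m}. i \<noteq> j \<longrightarrow>
      (young (mid N - 1) i \<times> young (N - mid N) (m - i)) \<inter> (young (mid N - 1) j \<times> young (N - mid N) (m - j)) = {}"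
      by (auto simp: young_def)
    show ?thesis unfolding U_def by (rule card_UN_disjoint[OF finite_atMost 1 2])
  qed
  also have "\<dots> = bipartitions m"
    unfolding bipartitions_def using N
    by (intro sum.cong) (auto simp: card_cartesian_product card_young bounded_partitions_eq mid_def)
  finally show ?thesis
    using bij_betw_finite[OF dual_A_level_bij[OF N2, of m]] bij_betw_same_card[OF dual_A_level_bij[OF N2, of m]] fin
    unfolding U_def by simp
qed

lemma counting_A:
  assumes \<Lambda>: "\<Lambda> \<ge> 0" "\<And>n :: nat. \<Lambda> \<noteq> real n"
  shows "\<forall>\<^sub>F N in size_at_top TypeA. finite (casimir_le TypeA N \<Lambda>) \<and>
      card (casimir_le TypeA N \<Lambda>) = (\<Sum>m\<le>nat \<lfloor>\<Lambda>\<rfloor>. bipartitions m)"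
    and "\<forall>\<^sub>F N in size_at_top TypeA. \<forall>l\<in>unitary_dual TypeA N. 0 \<le> casimir TypeA N l"
proof -
  have bounds: "real (spread N l) / 4 \<le> casimir TypeA N l"
    "\<bar>casimir TypeA N l - real (spread N l)\<bar> \<le> real (spread N l) * (7 * real (spread N l) + 4) / real N"
    if "4 \<le> N" "admissible TypeA N" "l \<in> unitary_dual TypeA N" for N l
    using casimir_A_bounds[of N l] that by (simp_all del: casimir.simps)
  note counting = counting_of_bounds[OF dual_A_level_card bounds _ _ \<Lambda>]
  show "\<forall>\<^sub>F N in size_at_top TypeA. finite (casimir_le TypeA N \<Lambda>) \<and>
      card (casimir_le TypeA N \<Lambda>) = (\<Sum>m\<le>nat \<lfloor>\<Lambda>\<rfloor>. bipartitions m)"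
    by (rule counting(1)) auto
  show "\<forall>\<^sub>F N in size_at_top TypeA. \<forall>l\<in>unitary_dual TypeA N. 0 \<le> casimir TypeA N l"
    by (rule counting(2)) auto
qed

section \<open>Type A': the additional integer shift\<close>

definition centre :: "nat \<Rightarrow> (nat \<Rightarrow> int) \<Rightarrow> int" where
  "centre N l = l (mid N)"

definition unitary_size :: "nat \<Rightarrow> (nat \<Rightarrow> int) \<Rightarrow> nat" where
  "unitary_size N l = nat ((centre N l)\<^sup>2) + spread N l"

definition shift_to :: "nat \<Rightarrow> int \<times> (nat \<Rightarrow> int) \<Rightarrow> nat \<Rightarrow> int" where
  "shift_to N = (\<lambda>(j, l). \<lambda>i\<in>{1..N}. l i - l (mid N) + j)"

definition centred_bipartitions :: "nat \<Rightarrow> nat" where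
  "centred_bipartitions m = (\<Sum>i\<le>m. square_count i * bipartitions (m - i))"

lemma spread_shift:
  assumes "N \<ge> 1" "\<And>i. i \<in> {1..N} \<Longrightarrow> l' i = l i + n"
  shows "spread N l' = spread N l"
proof -
  have "mid N \<in> {1..N}" using assms(1) by (auto simp: mid_def)
  then show ?thesis unfolding spread_def using assms(2) by (intro arg_cong[of _ _ nat] sum.cong) auto
qed

abbreviation A'_level :: "nat \<Rightarrow> nat \<Rightarrow> (nat \<Rightarrow> int) set" where
  "A'_level N m \<equiv> {l \<in> unitary_dual TypeA' N. unitary_size N l = m}"

abbreviation centred_pairs :: "nat \<Rightarrow> nat \<Rightarrow> (int \<times> (nat \<Rightarrow> int)) set" where
  "centred_pairs N m \<equiv> (\<Union>i\<in>{..m}. {j. j\<^sup>2 = int i} \<times> A_level N (m - i))"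

text \<open>A weight of U(N) amounts to its middle entry and its representative with last entry 0.
  The former contributes its square to the size, the latter its spread, which the shift leaves
  unchanged.\<close>

lemma dual_A'_level_bij:
  assumes N: "N \<ge> 1"
  shows "bij_betw (\<lambda>l. (centre N l, \<lambda>i\<in>{1..N}. l i - l N))
    (A'_level N m)
    (centred_pairs N m)"
proof (rule bij_betw_byWitness[where f' = "shift_to N"])
  have s: "1 \<le> mid N" "mid N \<le> N" using N by (auto simp: mid_def)
  show "\<forall>l\<in>A'_level N m. shift_to N (centre N l, \<lambda>i\<in>{1..N}. l i - l N) = l"
    using s by (auto simp: shift_to_def centre_def fun_eq_iff weights_def PiE_def extensional_def)
  show "\<forall>x\<in>centred_pairs N m.
      (centre N (shift_to N x), \<lambda>i\<in>{1..N}. shift_to N x i - shift_to N x N) = x"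
    using s N by (auto simp: shift_to_def centre_def fun_eq_iff weights_def PiE_def extensional_def)
  show "(\<lambda>l. (centre N l, \<lambda>i\<in>{1..N}. l i - l N)) ` A'_level N m
      \<subseteq> (centred_pairs N m)"
  proof (rule image_subsetI)
    fix l assume l: "l \<in> A'_level N m"
    then have mono: "antimono_on {1..N} l" by simp
    define l0 where "l0 = (\<lambda>i\<in>{1..N}. l i - l N)"
    have "l0 \<in> unitary_dual TypeA N"
      using mono N by (auto simp: l0_def weights_def monotone_on_def)
    moreover have "spread N l0 = spread N l" by (rule spread_shift[of _ _ _ "- l N"]) (use N in \<open>auto simp: l0_def\<close>)
    moreover define k where "k = nat ((centre N l)\<^sup>2)"
    moreover have "m = k + spread N l" using l by (simp add: unitary_size_def k_def)
    ultimately have "k \<in> {..m}"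
      "(centre N l, l0) \<in> {j. j\<^sup>2 = int k} \<times> {l \<in> unitary_dual TypeA N. spread N l = m - k}"
      by (simp_all del: unitary_dual.simps)
    then show "(centre N l, \<lambda>i\<in>{1..N}. l i - l N) \<in> (centred_pairs N m)"
      unfolding l0_def by blast
  qed
  show "shift_to N ` (centred_pairs N m)
      \<subseteq> A'_level N m"
  proof (rule image_subsetI)
    fix x assume "x \<in> (centred_pairs N m)"
    then obtain i j l where x: "x = (j, l)" "i \<le> m" "j\<^sup>2 = int i" "l \<in> unitary_dual TypeA N" "spread N l = m - i" by blast
    have "spread N (shift_to N x) = spread N l"
      by (rule spread_shift[of _ _ _ "j - l (mid N)"]) (use N in \<open>auto simp: x(1) shift_to_def\<close>)
    moreover have "centre N (shift_to N x) = j" using s by (simp add: x(1) shift_to_def centre_def)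
    moreover have "shift_to N x \<in> unitary_dual TypeA' N"
      using x(4) by (auto simp: x(1) shift_to_def weights_def monotone_on_def)
    ultimately show "shift_to N x \<in> A'_level N m"
      using x by (simp add: unitary_size_def del: unitary_dual.simps)
  qed
qed

lemma finite_square_roots: "finite {j :: int. j\<^sup>2 = int i}"
proof (rule finite_subset)
  show "{j :: int. j\<^sup>2 = int i} \<subseteq> {- int i..int i}"
  proof
    fix j :: int assume "j \<in> {j. j\<^sup>2 = int i}"
    then have j: "\<bar>j\<bar> * \<bar>j\<bar> = int i" by (simp add: power2_eq_square)
    have "\<bar>j\<bar> \<le> \<bar>j\<bar> * \<bar>j\<bar>"
      by (cases "j = 0") (auto intro: mult_right_mono[of 1 "\<bar>j\<bar>" "\<bar>j\<bar>", simplified])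
    then show "j \<in> {- int i..int i}" using j by auto
  qed
qed auto

lemma dual_A'_level_card:
  assumes N: "N \<ge> 2 * m + 4"
  shows "finite (A'_level N m) \<and>
    card (A'_level N m) = centred_bipartitions m"
proof -
  define A where "A i = {j :: int. j\<^sup>2 = int i} \<times> A_level N (m - i)" for i
  have N1: "N \<ge> 1" using N by simp
  have level: "finite (A_level N (m - i)) \<and> card (A_level N (m - i)) = bipartitions (m - i)" for i
    by (rule dual_A_level_card) (use N in simp)
  have fin: "\<forall>i\<in>{..m}. finite (A i)" unfolding A_def using level finite_square_roots by blast
  have disj: "\<forall>i\<in>{..m}. \<forall>j\<in>{..m}. i \<noteq> j \<longrightarrow> A i \<inter> A j = {}" unfolding A_def by auto
  have "card (\<Union>i\<in>{..m}. A i) = (\<Sum>i\<in>{..m}. card (A i))" by (rule card_UN_disjoint[OF finite_atMost fin disj])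
  also have "\<dots> = centred_bipartitions m"
    unfolding centred_bipartitions_def A_def card_cartesian_product square_count_def using level by simp
  finally have "card (\<Union>i\<in>{..m}. A i) = centred_bipartitions m" .
  moreover have "finite (\<Union>i\<in>{..m}. A i)" using fin by blast
  ultimately show ?thesis
    using bij_betw_finite[OF dual_A'_level_bij[OF N1, of m]] bij_betw_same_card[OF dual_A'_level_bij[OF N1, of m]]
    unfolding A_def by (simp del: unitary_dual.simps)
qed

text \<open>The two Casimir numbers differ by the square of the mean entry. The mean is the middle
  entry plus the mean deviation from it, and the deviations add up to at most the spread.\<close>

lemma casimir_A'_eq:
  assumes l: "antimono_on {1..N} l" and N: "N \<ge> 1"
  obtains e where "\<bar>e\<bar> \<le> real (spread N l)"
    "casimir TypeA' N l = casimir TypeA N l + (real_of_int (centre N l) + e / real N)\<^sup>2"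
proof -
  define e where "e = real_of_int (\<Sum>i=1..N. l i - centre N l)"
  have "\<bar>\<Sum>i=1..N. l i - centre N l\<bar> \<le> (\<Sum>i=1..N. \<bar>l i - centre N l\<bar>)" by (rule sum_abs)
  also have "\<dots> = int (spread N l)" by (simp add: spread_def centre_def sum_nonneg)
  finally have "\<bar>e\<bar> \<le> real (spread N l)" unfolding e_def by linarith
  moreover have "(\<Sum>i=1..N. real_of_int (l i)) = real N * (real_of_int (centre N l) + e / real N)"
  proof -
    have "e = (\<Sum>i=1..N. real_of_int (l i)) - real N * real_of_int (centre N l)" by (simp add: e_def sum_subtractf)
    then show ?thesis using N by (simp add: distrib_left)
  qed
  then have "casimir TypeA' N l = casimir TypeA N l + (real_of_int (centre N l) + e / real N)\<^sup>2"
    using N by (simp add: power_mult_distrib)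
  ultimately show ?thesis by (rule that)
qed

text \<open>The square of the mean entry contains a cross term in the middle entry, so
  \<open>counting_of_bounds\<close> does not fit and \<open>counting_limit\<close> is applied
  directly.\<close>

lemma counting_A':
  assumes \<Lambda>: "\<Lambda> \<ge> 0" "\<And>n :: nat. \<Lambda> \<noteq> real n"
  shows "\<forall>\<^sub>F N in size_at_top TypeA'. finite (casimir_le TypeA' N \<Lambda>) \<and>
      card (casimir_le TypeA' N \<Lambda>) = (\<Sum>m\<le>nat \<lfloor>\<Lambda>\<rfloor>. centred_bipartitions m)"
    and "\<forall>\<^sub>F N in size_at_top TypeA'. \<forall>l\<in>unitary_dual TypeA' N. 0 \<le> casimir TypeA' N l"
proof -
  have bounds: "\<exists>e. \<bar>e\<bar> \<le> real (spread N l) \<and>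
      real (spread N l) / 4 + (real_of_int (centre N l) + e / real N)\<^sup>2 \<le> casimir TypeA' N l \<and>
      \<bar>casimir TypeA' N l - (real (spread N l) + (real_of_int (centre N l) + e / real N)\<^sup>2)\<bar>
        \<le> real (spread N l) * (7 * real (spread N l) + 4) / real N"
    if "l \<in> unitary_dual TypeA' N" "N \<ge> 2" for N l
  proof -
    have l: "antimono_on {1..N} l" and N: "N \<ge> 1" "N \<ge> 2" using that by simp_all
    obtain e where e: "\<bar>e\<bar> \<le> real (spread N l)"
      "casimir TypeA' N l = casimir TypeA N l + (real_of_int (centre N l) + e / real N)\<^sup>2"
      using casimir_A'_eq[OF l N(1)] by blast
    then show ?thesis using casimir_A_bounds[OF l N(2)] by (intro exI[of _ e]) linarith
  qed
  have size: "real (unitary_size N l) = (real_of_int (centre N l))\<^sup>2 + real (spread N l)" for N l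
    by (simp add: unitary_size_def of_nat_nat)
  show "\<forall>\<^sub>F N in size_at_top TypeA'. \<forall>l\<in>unitary_dual TypeA' N. 0 \<le> casimir TypeA' N l"
  proof (rule eventually_size_at_top[of 2], rule ballI)
    fix N l assume "2 \<le> N" "l \<in> unitary_dual TypeA' N"
    then obtain e where "real (spread N l) / 4 + (real_of_int (centre N l) + e / real N)\<^sup>2 \<le> casimir TypeA' N l"
      using bounds by blast
    moreover have "0 \<le> real (spread N l) / 4 + (real_of_int (centre N l) + e / real N)\<^sup>2" by simp
    ultimately show "0 \<le> casimir TypeA' N l" by linarith
  qed
  show "\<forall>\<^sub>F N in size_at_top TypeA'. finite (casimir_le TypeA' N \<Lambda>) \<and>
      card (casimir_le TypeA' N \<Lambda>) = (\<Sum>m\<le>nat \<lfloor>\<Lambda>\<rfloor>. centred_bipartitions m)"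
  proof (rule counting_limit[OF _ _ _ \<Lambda>, where sz = unitary_size])
    show "\<forall>\<^sub>F N in size_at_top TypeA'. finite (A'_level N m) \<and>
        card (A'_level N m) = centred_bipartitions m" for m
      by (rule eventually_size_at_top[of "2 * m + 4"]) (rule dual_A'_level_card)
  next
    fix \<Lambda> :: real
    \<comment> \<open>Bounded Casimir number gives spread <= 4 \<Lambda> and |c + e/N| <= sqrt
      \<Lambda>; since |e/N| is at most the spread, |c| <= sqrt \<Lambda> + 4 \<Lambda>.\<close>
    define B where "B = (sqrt \<Lambda> + 4 * \<Lambda>)\<^sup>2 + 4 * \<Lambda>"
    show "\<exists>K. \<forall>\<^sub>F N in size_at_top TypeA'. \<forall>l\<in>unitary_dual TypeA' N. casimir TypeA' N l \<le> \<Lambda> \<longrightarrow> unitary_size N l \<le> K"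
    proof (rule exI, rule eventually_size_at_top[of 2], intro ballI impI)
      fix N l assume *: "2 \<le> N" "l \<in> unitary_dual TypeA' N" "casimir TypeA' N l \<le> \<Lambda>"
      define t where "t = real (spread N l)"
      define c where "c = real_of_int (centre N l)"
      obtain e where e: "\<bar>e\<bar> \<le> t" "t / 4 + (c + e / real N)\<^sup>2 \<le> \<Lambda>"
        using bounds[OF *(2,1)] *(3) unfolding t_def c_def by (meson order_trans)
      have "0 \<le> t" by (simp add: t_def)
      moreover have "t \<le> 4 * \<Lambda>" using e(2) zero_le_power2[of "c + e / real N"] by linarith
      ultimately have t: "0 \<le> t" "t \<le> 4 * \<Lambda>" by auto
      have "(c + e / real N)\<^sup>2 \<le> \<Lambda>" using e(2) t by linarith
      then have "\<bar>c + e / real N\<bar> \<le> sqrt \<Lambda>" by (metis real_le_rsqrt power2_abs)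
      moreover have "\<bar>e / real N\<bar> \<le> t"
      proof -
        have "\<bar>e / real N\<bar> \<le> \<bar>e\<bar> / 1" unfolding abs_divide using *(1) by (intro frac_le) auto
        then show ?thesis using e(1) by linarith
      qed
      ultimately have "\<bar>c\<bar> \<le> \<bar>sqrt \<Lambda> + 4 * \<Lambda>\<bar>" using t by linarith
      then have "c\<^sup>2 \<le> (sqrt \<Lambda> + 4 * \<Lambda>)\<^sup>2" by (simp only: abs_le_square_iff)
      then have "real (unitary_size N l) \<le> B" using t by (simp add: size B_def c_def t_def)
      then show "unitary_size N l \<le> nat \<lceil>B\<rceil>" by linarith
    qed
  next
    fix K :: nat and \<epsilon> :: real assume "\<epsilon> > 0"
    define k where "k = real K"
    have "\<forall>\<^sub>F N in size_at_top TypeA'. N \<ge> 2" by (rule eventually_size_at_top[of 2]) auto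
    \<comment> \<open>Three errors: that of type A, the cross term 2ce/N, and (e/N)^2.\<close>
    with eventually_size_small[OF \<open>\<epsilon> > 0\<close>, where B = "k * (7 * k + 4) + 2 * k * k + k * k"]
    show "\<forall>\<^sub>F N in size_at_top TypeA'. \<forall>l\<in>unitary_dual TypeA' N. unitary_size N l \<le> K \<longrightarrow>
        \<bar>casimir TypeA' N l - real (unitary_size N l)\<bar> \<le> \<epsilon>"
    proof eventually_elim
      case (elim N)
      show ?case
      proof (intro ballI impI)
        fix l assume l: "l \<in> unitary_dual TypeA' N" "unitary_size N l \<le> K"
        define t where "t = real (spread N l)"
        define c where "c = real_of_int (centre N l)"
        obtain e where e: "\<bar>e\<bar> \<le> t" "\<bar>casimir TypeA' N l - (t + (c + e / real N)\<^sup>2)\<bar> \<le> t * (7 * t + 4) / real N"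
          using bounds[OF l(1)] elim unfolding t_def c_def by blast
        have sz: "c\<^sup>2 + t \<le> k" using l(2) size[of N l] by (simp add: k_def c_def t_def)
        have "0 \<le> t" by (simp add: t_def)
        moreover have "t \<le> k" using sz zero_le_power2[of c] by linarith
        ultimately have t: "0 \<le> t" "t \<le> k" by auto
        have c: "\<bar>c\<bar> \<le> k"
        proof -
          \<comment> \<open>An integer is at most its square in absolute value.\<close>
          have "\<bar>centre N l\<bar> \<le> (centre N l)\<^sup>2"
            by (cases "centre N l = 0") (auto simp: power2_eq_square abs_mult[symmetric] intro: order_trans[OF mult_right_mono[of 1 "\<bar>centre N l\<bar>" "\<bar>centre N l\<bar>", simplified]])
          then have "\<bar>c\<bar> \<le> c\<^sup>2" unfolding c_def by (metis of_int_abs of_int_le_iff of_int_power)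
          then show ?thesis using sz t by linarith
        qed
        have N: "real N \<ge> 1" using elim by simp
        have k: "0 \<le> k" by (simp add: k_def)
        have "(c + e / real N)\<^sup>2 - c\<^sup>2 = (2 * c * e) / real N + (e / real N)\<^sup>2"
          by (simp add: power2_eq_square algebra_simps)
        moreover have "\<bar>2 * c * e / real N\<bar> \<le> 2 * k * k / real N"
          unfolding abs_divide abs_mult using c e t k N by (intro frac_le mult_mono) auto
        moreover have "\<bar>(e / real N)\<^sup>2\<bar> \<le> k * k / real N"
        proof -
          have "\<bar>(e / real N)\<^sup>2\<bar> = \<bar>e\<bar> * \<bar>e\<bar> / (real N * real N)" by (simp add: power2_eq_square)
          also have "\<dots> \<le> k * k / (real N * 1)" using e t k N by (intro frac_le mult_mono) auto
          finally show ?thesis by simp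
        qed
        moreover have "t * (7 * t + 4) / real N \<le> k * (7 * k + 4) / real N"
          using t k N by (intro divide_right_mono mult_mono) auto
        ultimately have "\<bar>casimir TypeA' N l - (c\<^sup>2 + t)\<bar> \<le> k * (7 * k + 4) / real N + 2 * k * k / real N + k * k / real N"
          using e(2) by linarith
        also have "\<dots> = (k * (7 * k + 4) + 2 * k * k + k * k) / real N" by (simp add: add_divide_distrib)
        finally show "\<bar>casimir TypeA' N l - real (unitary_size N l)\<bar> \<le> \<epsilon>"
          using elim by (simp add: size c_def t_def)
      qed
    qed
  qed
qed

section \<open>The limit measures\<close>

fun level_count :: "classical_type \<Rightarrow> nat \<Rightarrow> nat" where
  "level_count TypeA' = centred_bipartitions"
| "level_count TypeA = bipartitions"
| "level_count TypeB = partitions"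
| "level_count TypeC = partitions"
| "level_count TypeD = partitions"

definition limit_measure :: "classical_type \<Rightarrow> real measure" where
  "limit_measure \<tau> = distr (point_measure UNIV (\<lambda>n. ennreal (real (level_count \<tau> n)))) borel_nonneg real"

lemma emeasure_limit_measure:
  assumes "A \<in> sets borel" "A \<subseteq> {0..}" "finite (real -` A)"
  shows "emeasure (limit_measure \<tau>) A = ennreal (\<Sum>n\<in>real -` A. real (level_count \<tau> n))"
proof -
  have "A \<in> sets borel_nonneg" using assms by (auto simp: sets_restrict_space_iff)
  moreover have "real \<in> measurable (point_measure UNIV (\<lambda>n. ennreal (real (level_count \<tau> n)))) borel_nonneg"
    by (auto simp: measurable_def space_restrict_space space_point_measure sets_point_measure)
  ultimately have "emeasure (limit_measure \<tau>) A = emeasure (point_measure UNIV (\<lambda>n. ennreal (real (level_count \<tau> n)))) (real -` A)"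
    unfolding limit_measure_def by (simp add: emeasure_distr space_point_measure)
  also have "\<dots> = (\<Sum>n\<in>real -` A. ennreal (real (level_count \<tau> n)))"
    using assms(3) by (intro emeasure_point_measure_finite2) auto
  finally show ?thesis by (simp add: sum_ennreal)
qed

lemma vimage_real_atLeastAtMost:
  assumes "\<Lambda> \<ge> 0" shows "real -` {0..\<Lambda>} = {..nat \<lfloor>\<Lambda>\<rfloor>}"
  using assms by (auto simp: le_nat_iff le_floor_iff)

lemma emeasure_limit_measure_Icc:
  assumes "\<Lambda> \<ge> 0"
  shows "emeasure (limit_measure \<tau>) {0..\<Lambda>} = ennreal (\<Sum>n\<le>nat \<lfloor>\<Lambda>\<rfloor>. real (level_count \<tau> n))"
  using emeasure_limit_measure[of "{0..\<Lambda>}" \<tau>] vimage_real_atLeastAtMost[OF assms] by auto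

text \<open>Thus the limit measure charges every natural number, and its continuity points lie off
  the naturals, as the counting lemmas require.\<close>

lemma level_count_pos: "level_count \<tau> n > 0"
proof -
  have b: "bipartitions n > 0" for n
    unfolding bipartitions_def by (intro sum_pos) (auto simp: partitions_pos)
  have "0 < square_count 0 * bipartitions (n - 0)" using b square_count_square[of 0] by simp
  also have "\<dots> \<le> centred_bipartitions n"
    unfolding centred_bipartitions_def by (rule member_le_sum) auto
  finally show ?thesis using b partitions_pos by (cases \<tau>) auto
qed

lemma limit_measure_atom:
  assumes "emeasure (limit_measure \<tau>) {\<Lambda>} = 0"
  shows "\<Lambda> \<noteq> real n"
proof
  assume "\<Lambda> = real n"
  moreover have "real -` {real n} = {n}" by auto
  ultimately have "emeasure (limit_measure \<tau>) {\<Lambda>} = ennreal (real (level_count \<tau> n))"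
    using emeasure_limit_measure[of "{\<Lambda>}" \<tau>] by simp
  with assms level_count_pos[of \<tau> n] show False by simp
qed

lemma locally_finite_limit_measure: "locally_finite_measure (limit_measure \<tau>)"
  unfolding locally_finite_measure_def
proof
  fix x assume "x \<in> space (limit_measure \<tau>)"
  then have x: "x \<ge> 0" by (simp add: limit_measure_def space_restrict_space)
  have "{..<x + 1} \<inter> space (limit_measure \<tau>) \<subseteq> {0..x + 1}" by (auto simp: limit_measure_def space_restrict_space)
  moreover have "{0..x + 1} \<in> sets (limit_measure \<tau>)" by (auto simp: limit_measure_def sets_restrict_space_iff)
  ultimately have "emeasure (limit_measure \<tau>) ({..<x + 1} \<inter> space (limit_measure \<tau>)) \<le> emeasure (limit_measure \<tau>) {0..x + 1}"
    by (rule emeasure_mono)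
  also have "\<dots> < \<infinity>" using x by (simp add: emeasure_limit_measure_Icc)
  finally show "\<exists>U. open U \<and> x \<in> U \<and> emeasure (limit_measure \<tau>) (U \<inter> space (limit_measure \<tau>)) < \<infinity>"
    by (intro exI[of _ "{..<x + 1}"]) auto
qed

text \<open>Nonnegativity on the whole dual makes \<open>casimir\<close> measurable into
  \<open>borel_nonneg\<close>, so that the image measure takes its intended values. The counting
  lemmas supply it for large N.\<close>

lemma emeasure_casimir_measure:
  assumes "finite (casimir_le \<tau> N \<Lambda>)" "\<forall>l\<in>unitary_dual \<tau> N. 0 \<le> casimir \<tau> N l"
  shows "emeasure (casimir_measure \<tau> N) {0..\<Lambda>} = of_nat (card (casimir_le \<tau> N \<Lambda>))"
proof -
  have "{0..\<Lambda>} \<in> sets borel_nonneg" by (auto simp: sets_restrict_space_iff)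
  moreover have "casimir \<tau> N \<in> measurable (count_space (unitary_dual \<tau> N)) borel_nonneg"
    using assms(2) by (auto simp: measurable_def space_restrict_space)
  moreover have "casimir \<tau> N -` {0..\<Lambda>} \<inter> unitary_dual \<tau> N = casimir_le \<tau> N \<Lambda>"
    using assms(2) by auto
  ultimately show ?thesis
    unfolding casimir_measure_def using assms(1) by (simp add: emeasure_distr emeasure_count_space_finite)
qed

text \<open>The convergence is eventual equality.\<close>

lemma casimir_measure_tendsto:
  assumes \<Lambda>: "\<Lambda> \<ge> 0" "emeasure (limit_measure \<tau>) {\<Lambda>} = 0"
  shows "((\<lambda>N. emeasure (casimir_measure \<tau> N) {0..\<Lambda>}) \<longlongrightarrow> emeasure (limit_measure \<tau>) {0..\<Lambda>}) (size_at_top \<tau>)"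
proof (rule tendsto_eventually)
  have n: "\<Lambda> \<noteq> real n" for n using limit_measure_atom[OF \<Lambda>(2)] .
  have "\<forall>\<^sub>F N in size_at_top \<tau>. finite (casimir_le \<tau> N \<Lambda>) \<and>
      card (casimir_le \<tau> N \<Lambda>) = (\<Sum>m\<le>nat \<lfloor>\<Lambda>\<rfloor>. level_count \<tau> m)"
    using counting_BCD(1)[OF _ \<Lambda>(1) n, of \<tau>] counting_A(1)[OF \<Lambda>(1) n] counting_A'(1)[OF \<Lambda>(1) n]
    by (cases \<tau>) (simp_all del: casimir.simps unitary_dual.simps)
  moreover have "\<forall>\<^sub>F N in size_at_top \<tau>. \<forall>l\<in>unitary_dual \<tau> N. 0 \<le> casimir \<tau> N l"
    using counting_BCD(2)[OF _ \<Lambda>(1) n, of \<tau>] counting_A(2)[OF \<Lambda>(1) n] counting_A'(2)[OF \<Lambda>(1) n]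
    by (cases \<tau>) (simp_all del: casimir.simps unitary_dual.simps)
  ultimately show "\<forall>\<^sub>F N in size_at_top \<tau>. emeasure (casimir_measure \<tau> N) {0..\<Lambda>} = emeasure (limit_measure \<tau>) {0..\<Lambda>}"
  proof eventually_elim
    case (elim N)
    then have "emeasure (casimir_measure \<tau> N) {0..\<Lambda>} = of_nat (\<Sum>m\<le>nat \<lfloor>\<Lambda>\<rfloor>. level_count \<tau> m)"
      using emeasure_casimir_measure[of \<tau> N \<Lambda>] by simp
    also have "\<dots> = ennreal (\<Sum>m\<le>nat \<lfloor>\<Lambda>\<rfloor>. real (level_count \<tau> m))"
      by (simp only: ennreal_of_nat_eq_real_of_nat of_nat_sum)
    finally show ?case using \<Lambda>(1) by (simp add: emeasure_limit_measure_Icc)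
  qed
qed

lemma conv_one_eq: "cumulative g n = (\<Sum>m\<le>n. g m)"
  unfolding conv_def by (rule sum.reindex_bij_witness[of _ "\<lambda>i. n - i" "\<lambda>i. n - i"]) auto

lemma measure_limit_measure_Icc:
  assumes "(\<lambda>n. real (level_count \<tau> n)) = g"
  shows "\<forall>\<^sub>F \<Lambda> in at_top. cumulative g (nat \<lfloor>\<Lambda>\<rfloor>) = measure (limit_measure \<tau>) {0..\<Lambda>}"
  using eventually_ge_at_top[of 0]
proof eventually_elim
  case (elim \<Lambda>)
  show ?case unfolding conv_one_eq assms[symmetric]
    by (simp add: measure_def emeasure_limit_measure_Icc[OF elim] sum_nonneg)
qed

lemma real_bipartitions: "(\<lambda>n. real (bipartitions n)) = conv partitions partitions"
  by (simp add: fun_eq_iff bipartitions_def conv_def)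

lemma real_centred_bipartitions: "(\<lambda>n. real (centred_bipartitions n)) = conv square_count (conv partitions partitions)"
  unfolding real_bipartitions[symmetric] by (simp add: fun_eq_iff centred_bipartitions_def conv_def)

theorem theorem1p4:
  shows "\<exists>\<mu> :: classical_type \<Rightarrow> real measure.
    (\<forall>\<tau>. sets (\<mu> \<tau>) = sets borel_nonneg \<and>
         locally_finite_measure (\<mu> \<tau>) \<and>
         (\<forall>\<Lambda>\<ge>0. emeasure (\<mu> \<tau>) {\<Lambda>} = 0 \<longrightarrow>
            ((\<lambda>N. emeasure (casimir_measure \<tau> N) {0..\<Lambda>}) \<longlongrightarrow> emeasure (\<mu> \<tau>) {0..\<Lambda>})
              (size_at_top \<tau>))) \<and>
    (\<lambda>\<Lambda>. measure (\<mu> TypeA') {0..\<Lambda>}) \<sim>[at_top]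
      (\<lambda>\<Lambda>. 1 / (4 * pi) * \<Lambda> powr (- 1 / 2) * exp (2 * pi * sqrt (\<Lambda> / 3))) \<and>
    (\<lambda>\<Lambda>. measure (\<mu> TypeA) {0..\<Lambda>}) \<sim>[at_top]
      (\<lambda>\<Lambda>. 1 / (4 * pi * 3 powr (1 / 4)) * \<Lambda> powr (- 3 / 4) * exp (2 * pi * sqrt (\<Lambda> / 3))) \<and>
    (\<forall>\<tau>\<in>{TypeB, TypeC, TypeD}.
      (\<lambda>\<Lambda>. measure (\<mu> \<tau>) {0..\<Lambda>}) \<sim>[at_top]
        (\<lambda>\<Lambda>. 1 / (2 * pi * sqrt 2) * \<Lambda> powr (- 1 / 2) * exp (pi * sqrt (2 * \<Lambda> / 3))))"
proof (intro exI[of _ limit_measure] conjI allI impI ballI)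
  fix \<tau>
  show "sets (limit_measure \<tau>) = sets borel_nonneg" by (simp add: limit_measure_def)
  show "locally_finite_measure (limit_measure \<tau>)" by (rule locally_finite_limit_measure)
  show "((\<lambda>N. emeasure (casimir_measure \<tau> N) {0..\<Lambda>}) \<longlongrightarrow> emeasure (limit_measure \<tau>) {0..\<Lambda>}) (size_at_top \<tau>)"
    if "0 \<le> \<Lambda>" "emeasure (limit_measure \<tau>) {\<Lambda>} = 0" for \<Lambda>
    using that by (rule casimir_measure_tendsto)
next
  note transfer = asymp_equiv_cong[THEN iffD1, OF measure_limit_measure_Icc always_eventually[OF allI[OF refl]]]
  show "(\<lambda>\<Lambda>. measure (limit_measure TypeA') {0..\<Lambda>}) \<sim>[at_top]
      (\<lambda>\<Lambda>. 1 / (4 * pi) * \<Lambda> powr (- 1 / 2) * exp (2 * pi * sqrt (\<Lambda> / 3)))"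
    by (rule transfer[OF _ theta_bipartitions_count_asymp]) (simp add: real_centred_bipartitions)
  show "(\<lambda>\<Lambda>. measure (limit_measure TypeA) {0..\<Lambda>}) \<sim>[at_top]
      (\<lambda>\<Lambda>. 1 / (4 * pi * 3 powr (1 / 4)) * \<Lambda> powr (- 3 / 4) * exp (2 * pi * sqrt (\<Lambda> / 3)))"
    by (rule transfer[OF _ bipartitions_count_asymp]) (simp add: real_bipartitions)
  show "(\<lambda>\<Lambda>. measure (limit_measure \<tau>) {0..\<Lambda>}) \<sim>[at_top]
        (\<lambda>\<Lambda>. 1 / (2 * pi * sqrt 2) * \<Lambda> powr (- 1 / 2) * exp (pi * sqrt (2 * \<Lambda> / 3)))"
    if "\<tau> \<in> {TypeB, TypeC, TypeD}" for \<tau>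
    by (rule transfer[OF _ partitions_count_asymp]) (use that in auto)
qed

end
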